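(* Let $M$ be a binary gammoid. Then $M \notin \mathcal{G}_3$ if and only if $M$ does not contain a minor isomorphic to $M(G_i)$ for any $i \in \{2,3,4\}$.
   Context: A binary gammoid is a gammoid that is representable over $GF(2)$. $M(G)$ denotes the cycle matroid of a graph $G$ (loops and parallel edges allowed). Splitting: let $B$ be a binary matroid, $H \subseteq E(B)$, and let $A$ be a matrix over $GF(2)$ representing $B$. Let $A_H$ be obtained from $A$ by adjoining a new last row whose entries are $1$ in the columns corresponding to the elements of $H$ and $0$ elsewhere. The splitting matroid $B_H$ is the vector matroid of $A_H$ (on the same ground set as $B$). $\mathcal{G}_3$ denotes the class of binary gammoids $M$ for which there is a set $H \subseteq E(M)$ with $|H| = 3$ such that $M_H$ is not a binary gammoid. Graphs (each on three vertices $u,v,w$ with six edges): $G_2$ has two parallel edges joining $u$ and $v$, two parallel edges joining $u$ and $w$, one edge joining $v$ and $w$, and one loop at $u$. $G_3$ has two parallel edges joining $u$ and $v$, two parallel edges joining $u$ and $w$, one edge joining $v$ and $w$, and one loop at $w$. $G_4$ has exactly two parallel edges joining each pair of the three vertices and no loops. *)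

theory Defs
  imports "HOL-Library.Z2" "Graph_Theory.Arc_Walk"
begin

record 'a matroid =
  ground :: "'a set"
  indeps :: "'a set set"

definition is_matroid :: "'a matroid \<Rightarrow> bool" where
  "is_matroid M \<longleftrightarrow>
     finite (ground M) \<and>
     indeps M \<subseteq> Pow (ground M) \<and>
     {} \<in> indeps M \<and>
     (\<forall>I\<in>indeps M. \<forall>J\<subseteq>I. J \<in> indeps M) \<and>
     (\<forall>I\<in>indeps M. \<forall>J\<in>indeps M. card I < card J \<longrightarrow> (\<exists>x\<in>J - I. insert x I \<in> indeps M))"

definition is_basis_of :: "'a matroid \<Rightarrow> 'a set \<Rightarrow> 'a set \<Rightarrow> bool" where
  "is_basis_of M Y B \<longleftrightarrow>
     B \<subseteq> Y \<and> B \<in> indeps M \<and> (\<forall>B'. B \<subseteq> B' \<and> B' \<subseteq> Y \<and> B' \<in> indeps M \<longrightarrow> B' = B)"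

definition deletion :: "'a matroid \<Rightarrow> 'a set \<Rightarrow> 'a matroid" where
  "deletion M X = \<lparr>ground = ground M - X, indeps = {I \<in> indeps M. I \<subseteq> ground M - X}\<rparr>"

definition contraction :: "'a matroid \<Rightarrow> 'a set \<Rightarrow> 'a matroid" where
  "contraction M Y =
     \<lparr>ground = ground M - Y,
      indeps = {I. I \<subseteq> ground M - Y \<and> (\<exists>B. is_basis_of M Y B \<and> I \<union> B \<in> indeps M)}\<rparr>"

definition is_minor :: "'a matroid \<Rightarrow> 'a matroid \<Rightarrow> bool" where
  "is_minor N M \<longleftrightarrow>
     (\<exists>X Y. X \<subseteq> ground M \<and> Y \<subseteq> ground M \<and> X \<inter> Y = {} \<and> N = deletion (contraction M Y) X)"

definition matroid_iso :: "'a matroid \<Rightarrow> 'b matroid \<Rightarrow> bool" where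
  "matroid_iso M N \<longleftrightarrow>
     (\<exists>f. bij_betw f (ground M) (ground N) \<and>
          (\<forall>X\<subseteq>ground M. X \<in> indeps M \<longleftrightarrow> f ` X \<in> indeps N))"

definition has_minor_iso :: "'a matroid \<Rightarrow> 'b matroid \<Rightarrow> bool" where
  "has_minor_iso M N \<longleftrightarrow> (\<exists>M'. is_minor M' M \<and> matroid_iso M' N)"

text \<open>
  A matrix over GF(2) with \<open>m\<close> rows and columns labelled by a set \<open>E\<close> is given by \<open>m\<close> and a
  function \<open>A\<close> of which only the entries \<open>A i x\<close> with \<open>i < m\<close> and \<open>x \<in> E\<close> matter.
  Columns are treated as a family: equal columns with different labels are dependent.
\<close>

definition columns_independent :: "nat \<Rightarrow> (nat \<Rightarrow> 'a \<Rightarrow> bit) \<Rightarrow> 'a set \<Rightarrow> bool" where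
  "columns_independent m A X \<longleftrightarrow>
     (\<forall>c. (\<forall>i<m. (\<Sum>x\<in>X. c x * A i x) = 0) \<longrightarrow> (\<forall>x\<in>X. c x = 0))"

definition vector_matroid :: "'a set \<Rightarrow> nat \<Rightarrow> (nat \<Rightarrow> 'a \<Rightarrow> bit) \<Rightarrow> 'a matroid" where
  "vector_matroid E m A = \<lparr>ground = E, indeps = {X. X \<subseteq> E \<and> columns_independent m A X}\<rparr>"

definition represents :: "nat \<Rightarrow> (nat \<Rightarrow> 'a \<Rightarrow> bit) \<Rightarrow> 'a matroid \<Rightarrow> bool" where
  "represents m A M \<longleftrightarrow> M = vector_matroid (ground M) m A"

definition binary :: "'a matroid \<Rightarrow> bool" where
  "binary M \<longleftrightarrow> is_matroid M \<and> (\<exists>m A. represents m A M)"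

text \<open>Every vertex of \<open>X\<close> starts a path ending in \<open>T\<close>, and these paths are pairwise disjoint.
  A path may consist of a single vertex.\<close>

definition linked_into :: "('v, 'b) pre_digraph \<Rightarrow> 'v set \<Rightarrow> 'v set \<Rightarrow> bool" where
  "linked_into D X T \<longleftrightarrow>
     (\<exists>p t. (\<forall>x\<in>X. t x \<in> T \<and> pre_digraph.apath D x (p x) (t x)) \<and>
            (\<forall>x\<in>X. \<forall>y\<in>X. x \<noteq> y \<longrightarrow>
               set (pre_digraph.awalk_verts D x (p x)) \<inter> set (pre_digraph.awalk_verts D y (p y)) = {}))"

text \<open>
  The digraph may need vertices outside the ground set, so its vertices cannot be taken from the
  type of the ground set. As it is finite, natural numbers suffice for vertices and arcs, and the
  ground set is identified with a set of vertices by the injection \<open>\<phi>\<close>.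
\<close>

definition gammoid :: "'a matroid \<Rightarrow> bool" where
  "gammoid M \<longleftrightarrow> is_matroid M \<and>
     (\<exists>(D :: (nat, nat) pre_digraph) T \<phi>.
        fin_digraph D \<and> T \<subseteq> verts D \<and> inj_on \<phi> (ground M) \<and> \<phi> ` ground M \<subseteq> verts D \<and>
        indeps M = {X. X \<subseteq> ground M \<and> linked_into D (\<phi> ` X) T})"

definition binary_gammoid :: "'a matroid \<Rightarrow> bool" where
  "binary_gammoid M \<longleftrightarrow> gammoid M \<and> binary M"

definition adjoin_row :: "nat \<Rightarrow> (nat \<Rightarrow> 'a \<Rightarrow> bit) \<Rightarrow> 'a set \<Rightarrow> nat \<Rightarrow> 'a \<Rightarrow> bit" where
  "adjoin_row m A H = (\<lambda>i x. if i = m then (if x \<in> H then 1 else 0) else A i x)"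

text \<open>
  The representing matrix is chosen arbitrarily; by \<open>splitting_eq\<close> below the result does
  not depend on the choice.
\<close>

definition splitting :: "'a matroid \<Rightarrow> 'a set \<Rightarrow> 'a matroid" where
  "splitting M H =
     (let (m, A) = (SOME (m, A). represents m A M)
      in vector_matroid (ground M) (Suc m) (adjoin_row m A H))"

lemma columns_independent_iff:
  assumes "finite X"
  shows "columns_independent m A X \<longleftrightarrow>
           (\<forall>Z\<subseteq>X. (\<forall>i<m. (\<Sum>x\<in>Z. A i x) = 0) \<longrightarrow> Z = {})"
proof
  assume L: "columns_independent m A X"
  show "\<forall>Z\<subseteq>X. (\<forall>i<m. (\<Sum>x\<in>Z. A i x) = 0) \<longrightarrow> Z = {}"
  proof (intro allI impI)
    fix Z assume Z: "Z \<subseteq> X" "\<forall>i<m. (\<Sum>x\<in>Z. A i x) = 0"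
    define c :: "'a \<Rightarrow> bit" where "c = (\<lambda>x. if x \<in> Z then 1 else 0)"
    have "(\<Sum>x\<in>X. c x * A i x) = (\<Sum>x\<in>Z. A i x)" for i
      using assms Z(1) by (intro sum.mono_neutral_cong_right) (auto simp: c_def)
    hence "\<forall>x\<in>X. c x = 0"
      using L Z(2) unfolding columns_independent_def by metis
    hence "c x = 0" if "x \<in> Z" for x using that Z(1) by blast
    thus "Z = {}" unfolding c_def by (metis all_not_in_conv zero_neq_one)
  qed
next
  assume R: "\<forall>Z\<subseteq>X. (\<forall>i<m. (\<Sum>x\<in>Z. A i x) = 0) \<longrightarrow> Z = {}"
  show "columns_independent m A X"
    unfolding columns_independent_def
  proof (intro allI impI)
    fix c :: "'a \<Rightarrow> bit" assume c: "\<forall>i<m. (\<Sum>x\<in>X. c x * A i x) = 0"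
    define Z where "Z = {x\<in>X. c x \<noteq> 0}"
    have "(\<Sum>x\<in>X. c x * A i x) = (\<Sum>x\<in>Z. A i x)" for i
      using assms by (intro sum.mono_neutral_cong_right) (auto simp: Z_def)
    hence "\<forall>i<m. (\<Sum>x\<in>Z. A i x) = 0" using c by metis
    moreover have "Z \<subseteq> X" by (simp add: Z_def)
    ultimately have "Z = {}" using R by blast
    thus "\<forall>x\<in>X. c x = 0" by (auto simp: Z_def)
  qed
qed

lemma dependent_minimal_sum_zero:
  fixes A :: "nat \<Rightarrow> 'a \<Rightarrow> bit"
  assumes "finite C" "\<not> columns_independent m A C"
    and "\<And>Z. Z \<subset> C \<Longrightarrow> columns_independent m A Z"
  shows "\<forall>i<m. (\<Sum>x\<in>C. A i x) = 0"
proof -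
  obtain Z where Z: "Z \<subseteq> C" "\<forall>i<m. (\<Sum>x\<in>Z. A i x) = 0" "Z \<noteq> {}"
    using assms(2) unfolding columns_independent_iff[OF assms(1)] by blast
  have "\<not> columns_independent m A Z"
    unfolding columns_independent_iff[OF finite_subset[OF Z(1) assms(1)]] using Z by blast
  hence "Z = C" using Z(1) assms(3)[of Z] by blast
  thus ?thesis using Z(2) by simp
qed

lemma zero_sums_subset:
  fixes A B :: "nat \<Rightarrow> 'a \<Rightarrow> bit"
  assumes "finite Z" "Z \<subseteq> E"
    and "\<And>X. X \<subseteq> E \<Longrightarrow> columns_independent m A X \<longleftrightarrow> columns_independent n B X"
    and "\<forall>i<m. (\<Sum>x\<in>Z. A i x) = 0"
  shows "\<forall>i<n. (\<Sum>x\<in>Z. B i x) = 0"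
  using assms(1,2,4)
proof (induction Z rule: finite_psubset_induct)
  case (psubset Z)
  show ?case
  proof (cases "Z = {}")
    case False
    define P where "P = (\<lambda>C. C \<subseteq> Z \<and> \<not> columns_independent m A C)"
    have "P Z"
      unfolding P_def columns_independent_iff[OF psubset.hyps] using False psubset.prems(2) by blast
    then obtain C where C: "P C" "\<And>C'. P C' \<Longrightarrow> card C \<le> card C'"
      using ex_has_least_nat[of P Z card] by blast
    have CZ: "C \<subseteq> Z" and CE: "C \<subseteq> E" and fC: "finite C"
      using C(1) psubset.prems(1) psubset.hyps finite_subset unfolding P_def by blast+
    have depA: "\<not> columns_independent m A C" using C(1) by (simp add: P_def)
    have minA: "columns_independent m A C'" if "C' \<subset> C" for C'
    proof -
      have "\<not> P C'" using C(2)[of C'] psubset_card_mono[OF fC that] by linarith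
      thus ?thesis using that CZ unfolding P_def by blast
    qed
    have sA: "\<forall>i<m. (\<Sum>x\<in>C. A i x) = 0"
      by (rule dependent_minimal_sum_zero[OF fC depA minA])
    have sB: "\<forall>i<n. (\<Sum>x\<in>C. B i x) = 0"
    proof (rule dependent_minimal_sum_zero[OF fC])
      show "\<not> columns_independent n B C" using depA assms(3)[OF CE] by simp
      show "columns_independent n B C'" if "C' \<subset> C" for C'
        using minA[OF that] assms(3)[of C'] that CE by (simp add: subset_trans psubset_imp_subset)
    qed
    have "C \<noteq> {}" using depA unfolding columns_independent_def by blast
    hence smaller: "Z - C \<subset> Z" using CZ by blast
    have split: "(\<Sum>x\<in>Z. F x) = (\<Sum>x\<in>Z - C. F x) + (\<Sum>x\<in>C. F x)" for F :: "'a \<Rightarrow> bit"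
      using sum.subset_diff[OF CZ psubset.hyps] .
    have "\<forall>i<m. (\<Sum>x\<in>Z - C. A i x) = 0"
      using psubset.prems(2) sA split[of "A _"] by simp
    hence "\<forall>i<n. (\<Sum>x\<in>Z - C. B i x) = 0"
      using psubset.IH[OF smaller] psubset.prems(1) by blast
    thus ?thesis using sB split[of "B _"] by simp
  qed simp
qed

lemma columns_independent_adjoin_row_iff:
  assumes "finite X"
  shows "columns_independent (Suc m) (adjoin_row m A H) X \<longleftrightarrow>
           (\<forall>Z\<subseteq>X. (\<forall>i<m. (\<Sum>x\<in>Z. A i x) = 0) \<and> (\<Sum>x\<in>Z. if x \<in> H then 1 else (0 :: bit)) = 0
              \<longrightarrow> Z = {})"
proof -
  have "(\<forall>i<Suc m. (\<Sum>x\<in>Z. adjoin_row m A H i x) = 0) \<longleftrightarrow>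
        (\<forall>i<m. (\<Sum>x\<in>Z. A i x) = 0) \<and> (\<Sum>x\<in>Z. if x \<in> H then 1 else (0 :: bit)) = 0" for Z
    by (auto simp: less_Suc_eq adjoin_row_def)
  thus ?thesis
    unfolding columns_independent_iff[OF assms] by simp
qed

lemma splitting_eq:
  assumes "finite (ground M)" "represents m A M"
  shows "splitting M H = vector_matroid (ground M) (Suc m) (adjoin_row m A H)"
proof -
  obtain n B where nB: "(SOME (m, A). represents m A M) = (n, B)" by fastforce
  have "represents n B M"
    using someI[of "\<lambda>(m, A). represents m A M" "(m, A)"] assms(2) nB by simp
  hence "indeps M = {X. X \<subseteq> ground M \<and> columns_independent n B X}"
    unfolding represents_def vector_matroid_def by (metis matroid.select_convs(2))
  moreover have "indeps M = {X. X \<subseteq> ground M \<and> columns_independent m A X}"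
    using assms(2) unfolding represents_def vector_matroid_def by (metis matroid.select_convs(2))
  ultimately have eq: "columns_independent m A X \<longleftrightarrow> columns_independent n B X"
    if "X \<subseteq> ground M" for X
    using that by auto
  have "(\<forall>i<m. (\<Sum>x\<in>Z. A i x) = 0) \<longleftrightarrow> (\<forall>i<n. (\<Sum>x\<in>Z. B i x) = 0)" if "Z \<subseteq> ground M" for Z
    using zero_sums_subset[of Z "ground M" m A n B] zero_sums_subset[of Z "ground M" n B m A]
      eq that finite_subset[OF that assms(1)] by blast
  note zero_eq = this
  have "columns_independent (Suc m) (adjoin_row m A H) X \<longleftrightarrow>
        columns_independent (Suc n) (adjoin_row n B H) X" if X: "X \<subseteq> ground M" for X
  proof -
    have "finite X" using X assms(1) finite_subset by blast
    thus ?thesis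
      unfolding columns_independent_adjoin_row_iff[OF \<open>finite X\<close>]
      using zero_eq X by (meson subset_trans)
  qed
  thus ?thesis
    by (auto simp: splitting_def nB vector_matroid_def)
qed

definition class_G3 :: "'a matroid set" where
  "class_G3 = {M. binary_gammoid M \<and>
     (\<exists>H\<subseteq>ground M. card H = 3 \<and> \<not> binary_gammoid (splitting M H))}"

record ('v, 'e) multigraph =
  mverts :: "'v set"
  medges :: "'e set"
  mends :: "'e \<Rightarrow> 'v set"

text \<open>A loop at \<open>v\<close> has \<open>{v}\<close> as its set of ends.\<close>

definition wf_multigraph :: "('v, 'e) multigraph \<Rightarrow> bool" where
  "wf_multigraph G \<longleftrightarrow> finite (mverts G) \<and> finite (medges G) \<and>
     (\<forall>e\<in>medges G. mends G e \<subseteq> mverts G \<and> card (mends G e) \<in> {1, 2})"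

text \<open>
  The cycle runs through the vertices \<open>vs\<close> in cyclic order and uses the edge \<open>es ! i\<close> to leave
  \<open>vs ! i\<close>. Length 1 gives the loops, length 2 the pairs of parallel edges.
\<close>

definition is_cycle_edge_set :: "('v, 'e) multigraph \<Rightarrow> 'e set \<Rightarrow> bool" where
  "is_cycle_edge_set G C \<longleftrightarrow>
     (\<exists>vs es. es \<noteq> [] \<and> length vs = length es \<and> distinct vs \<and> distinct es \<and>
        set vs \<subseteq> mverts G \<and> set es \<subseteq> medges G \<and> C = set es \<and>
        (\<forall>i<length es. mends G (es ! i) = {vs ! i, vs ! (Suc i mod length es)}))"

definition cycle_matroid :: "('v, 'e) multigraph \<Rightarrow> 'e matroid" where
  "cycle_matroid G =
     \<lparr>ground = medges G,
      indeps = {X. X \<subseteq> medges G \<and> (\<forall>C\<subseteq>X. \<not> is_cycle_edge_set G C)}\<rparr>"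

datatype vertex = vu | vv | vw

definition graph_of_ends :: "vertex set list \<Rightarrow> (vertex, nat) multigraph" where
  "graph_of_ends xs = \<lparr>mverts = {vu, vv, vw}, medges = {..<length xs}, mends = (\<lambda>i. xs ! i)\<rparr>"

definition graph_G2 :: "(vertex, nat) multigraph" where
  "graph_G2 = graph_of_ends [{vu, vv}, {vu, vv}, {vu, vw}, {vu, vw}, {vv, vw}, {vu}]"

definition graph_G3 :: "(vertex, nat) multigraph" where
  "graph_G3 = graph_of_ends [{vu, vv}, {vu, vv}, {vu, vw}, {vu, vw}, {vv, vw}, {vw}]"

definition graph_G4 :: "(vertex, nat) multigraph" where
  "graph_G4 = graph_of_ends [{vu, vv}, {vu, vv}, {vu, vw}, {vu, vw}, {vv, vw}, {vv, vw}]"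

lemma wf_multigraph_graphs:
  "wf_multigraph graph_G2" "wf_multigraph graph_G3" "wf_multigraph graph_G4"
  by (simp_all add: wf_multigraph_def graph_G2_def graph_G3_def graph_G4_def graph_of_ends_def
      lessThan_Suc)

end

theory Submission
  imports Defs
begin

text \<open>
  A binary matroid is handled through its cycle space: the family of all sets of elements
  whose columns sum to zero. It is closed under symmetric difference, and a set is independent
  exactly if it contains no nonempty member of the family. Two operations become transparent.
  Splitting by \<open>H\<close> keeps the cycles that meet \<open>H\<close> in an even number of elements. Contracting
  \<open>Y\<close> and restricting to \<open>F\<close> keeps the traces on \<open>F\<close> of the cycles inside \<open>F \<union> Y\<close>.

  The argument rests on the classical fact that a binary matroid is a gammoid if and only if
  it has no minor isomorphic to $M(K_4)$ (\<open>binary_gammoid_iff_no_K4_minor\<close>).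

  Granted this, let \<open>M\<close> be a binary gammoid with cycle space \<open>\<C>\<close>. If some splitting of \<open>M\<close> has
  an $M(K_4)$ minor on \<open>F\<close> after contracting \<open>Y\<close>, compare it with the minor of \<open>M\<close> itself that
  has the same \<open>Y\<close> and \<open>F\<close>. The cycle space \<open>\<K>\<close> of $K_4$ has index at most two in the cycle
  space \<open>\<D>\<close> of the latter, and it is not all of \<open>\<D>\<close>, since \<open>M\<close> has no $M(K_4)$ minor. So \<open>\<D>\<close>
  is \<open>\<K>\<close> together with one further coset. The space \<open>\<K>\<close> has seven nonzero cosets: six of them
  contain a single element of $K_4$, and the seventh contains the pairs of opposite edges.
  Making an edge of $K_4$ a loop gives $M(G_2) = M(G_3)$, and making opposite edges parallel
  gives $M(G_4)$ (\<open>G2_G4_minor_of_splitting\<close>). Conversely, in each of $M(G_2)$ and $M(G_4)$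
  three elements can be chosen such that the parity condition they impose turns the matroid
  into $M(K_4)$ (\<open>splitting_of_G2_G4_minor\<close>).

  For the classical fact, a digraph with a set \<open>T\<close> of targets is replaced by the set system
  that assigns to every vertex outside \<open>T\<close> its closed out-neighbourhood. Then \<open>X\<close> is linked
  into \<open>T\<close> if and only if the system has distinct representatives outside \<open>X\<close>
  (\<open>linked_into_iff_avoidable\<close>, after Ingleton and Piff). In this description contracting an
  independent set just deletes it from all members of the system. That $M(K_4)$ has no such
  description follows from Hall's theorem, because the deficiency of a set system is
  submodular and the four triangles of $K_4$ would force contradictory values
  (\<open>no_K4_in_set_system\<close>). In the other direction, a nonempty binary matroid without $M(K_4)$
  minor has a loop, a coloop, a parallel pair or a series pair (\<open>series_parallel_element\<close>).
  This is read off the bipartite graph of fundamental cycles: an isolated vertex, a pendant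
  vertex or a pair of twins yields such an element, and a bipartite graph without these
  contains a domino or an induced cycle of length at least six, each of which yields $M(K_4)$.
  Adding elements of the four kinds preserves the description by set systems, so induction
  finishes the proof (\<open>cotransversal_of_no_K4_minor\<close>).
\<close>

section \<open>Cycle spaces of binary matroids\<close>

text \<open>
  The members of \<open>\<C>\<close> are the vectors of a subspace of $GF(2)^E$, written as sets; symmetric
  difference is vector addition.
\<close>
definition cycle_space :: "'a set \<Rightarrow> 'a set set \<Rightarrow> bool" where
  "cycle_space E \<C> \<longleftrightarrow> finite E \<and> \<C> \<subseteq> Pow E \<and> {} \<in> \<C> \<and> (\<forall>X\<in>\<C>. \<forall>Y\<in>\<C>. sym_diff X Y \<in> \<C>)"

definition cycle_free :: "'a set set \<Rightarrow> 'a set \<Rightarrow> bool" where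
  "cycle_free \<C> X \<longleftrightarrow> (\<forall>Z\<in>\<C>. Z \<subseteq> X \<longrightarrow> Z = {})"

definition cycle_space_matroid :: "'a set \<Rightarrow> 'a set set \<Rightarrow> 'a matroid" where
  "cycle_space_matroid E \<C> = \<lparr>ground = E, indeps = {X. X \<subseteq> E \<and> cycle_free \<C> X}\<rparr>"

lemma cycle_spaceD:
  assumes "cycle_space E \<C>"
  shows "finite E" "\<And>Z. Z \<in> \<C> \<Longrightarrow> Z \<subseteq> E" "{} \<in> \<C>"
    "\<And>X Y. X \<in> \<C> \<Longrightarrow> Y \<in> \<C> \<Longrightarrow> sym_diff X Y \<in> \<C>"
  using assms unfolding cycle_space_def by blast+

lemma cycle_free_mono: "cycle_free \<C> X \<Longrightarrow> Y \<subseteq> X \<Longrightarrow> cycle_free \<C> Y"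
  unfolding cycle_free_def by blast

lemma cycle_free_insertD:
  assumes "cycle_free \<C> X" "\<not> cycle_free \<C> (insert e X)"
  obtains Z where "Z \<in> \<C>" "e \<in> Z" "Z \<subseteq> insert e X"
  using assms unfolding cycle_free_def by blast

lemma sym_diff_parity:
  assumes "finite X" "finite Y"
  shows "even (card (sym_diff X Y)) \<longleftrightarrow> (even (card X) \<longleftrightarrow> even (card Y))"
proof -
  have "card X = card (X - Y) + card (X \<inter> Y)" "card Y = card (Y - X) + card (X \<inter> Y)"
    using card_Diff_subset_Int[of X Y] card_Diff_subset_Int[of Y X] assms
      card_mono[of X "X \<inter> Y"] card_mono[of Y "X \<inter> Y"] by (auto simp: Int_commute)
  moreover have "card (sym_diff X Y) = card (X - Y) + card (Y - X)"
    using assms by (intro card_Un_disjoint) auto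
  ultimately show ?thesis by presburger
qed

text \<open>
  Augmentation holds by counting. If no element of \<open>J\<close> extends \<open>I\<close>, then every subset of \<open>J\<close>
  is congruent modulo \<open>\<C>\<close> to a subset of \<open>I\<close>. Distinct subsets of \<open>J\<close> lie in distinct classes,
  as \<open>J\<close> is independent, so \<open>J\<close> has no more subsets than \<open>I\<close>.
\<close>
lemma is_matroid_cycle_space_matroid:
  assumes "cycle_space E \<C>"
  shows "is_matroid (cycle_space_matroid E \<C>)"
proof -
  note cs = cycle_spaceD[OF assms]
  have aug: "\<exists>x\<in>J - I. insert x I \<subseteq> E \<and> cycle_free \<C> (insert x I)"
    if I: "I \<subseteq> E" "cycle_free \<C> I" and J: "J \<subseteq> E" "cycle_free \<C> J" and lt: "card I < card J" for I J
  proof (rule ccontr)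
    assume no: "\<not> ?thesis"
    have fin: "finite I" "finite J" using I J cs(1) finite_subset by blast+
    have span1: "\<exists>T\<subseteq>I. sym_diff {x} T \<in> \<C>" if x: "x \<in> J" for x
    proof (cases "x \<in> I")
      case True
      show ?thesis by (rule exI[of _ "{x}"]) (use True cs(3) in auto)
    next
      case False
      hence "\<not> cycle_free \<C> (insert x I)" using no x I J by blast
      then obtain Z where Z: "Z \<in> \<C>" "x \<in> Z" "Z \<subseteq> insert x I"
        using cycle_free_insertD[OF I(2)] by blast
      have "sym_diff {x} (Z - {x}) = Z" using Z by auto
      thus ?thesis using Z by (intro exI[of _ "Z - {x}"]) auto
    qed
    have span: "\<exists>T\<subseteq>I. sym_diff S T \<in> \<C>" if "S \<subseteq> J" for S
    proof -
      have "finite S" using that fin finite_subset by blast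
      thus ?thesis using that
      proof (induction S rule: finite_induct)
        case empty
        show ?case using cs(3) by (intro exI[of _ "{}"]) auto
      next
        case (insert x S)
        obtain T where T: "T \<subseteq> I" "sym_diff S T \<in> \<C>" using insert by auto
        obtain U where U: "U \<subseteq> I" "sym_diff {x} U \<in> \<C>" using span1 insert.prems by blast
        have "sym_diff (insert x S) (sym_diff T U) = sym_diff (sym_diff S T) (sym_diff {x} U)"
          using insert.hyps(2) by blast
        hence "sym_diff (insert x S) (sym_diff T U) \<in> \<C>" using cs(4)[OF T(2) U(2)] by simp
        moreover have "sym_diff T U \<subseteq> I" using T U by blast
        ultimately show ?case by blast
      qed
    qed
    \<comment> \<open>The representative of a subset of \<open>J\<close> modulo \<open>\<C>\<close>; it determines the subset.\<close>
    define g where "g S = (SOME T. T \<subseteq> I \<and> sym_diff S T \<in> \<C>)" for S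
    have g: "g S \<subseteq> I" "sym_diff S (g S) \<in> \<C>" if "S \<subseteq> J" for S
      using someI_ex[OF span[OF that]] unfolding g_def by blast+
    have "inj_on g (Pow J)"
    proof (rule inj_onI)
      fix S S' assume S: "S \<in> Pow J" "S' \<in> Pow J" "g S = g S'"
      have "sym_diff (sym_diff S (g S)) (sym_diff S' (g S')) = sym_diff S S'" using S(3) by blast
      hence "sym_diff S S' \<in> \<C>" using cs(4)[OF g(2) g(2)] S by (metis PowD)
      moreover have "sym_diff S S' \<subseteq> J" using S by blast
      ultimately have "sym_diff S S' = {}" using J(2) unfolding cycle_free_def by blast
      thus "S = S'" by blast
    qed
    moreover have "g ` Pow J \<subseteq> Pow I" using g by blast
    ultimately have "card (Pow J) \<le> card (Pow I)" using fin by (intro card_inj_on_le) auto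
    thus False using lt by (simp add: card_Pow fin)
  qed
  have "cycle_free \<C> {}" unfolding cycle_free_def by blast
  thus ?thesis
    unfolding is_matroid_def cycle_space_matroid_def using cs(1) aug
    by (auto intro: cycle_free_mono)
qed

definition matrix_cycles :: "'a set \<Rightarrow> nat \<Rightarrow> (nat \<Rightarrow> 'a \<Rightarrow> bit) \<Rightarrow> 'a set set" where
  "matrix_cycles E m A = {Z. Z \<subseteq> E \<and> (\<forall>i<m. (\<Sum>x\<in>Z. A i x) = 0)}"

lemma cycle_space_matrix_cycles:
  assumes "finite E"
  shows "cycle_space E (matrix_cycles E m A)"
proof -
  have "(\<Sum>x\<in>sym_diff X Y. f x) = (\<Sum>x\<in>X. f x) + (\<Sum>x\<in>Y. f x)" 
    if "finite X" "finite Y" for X Y and f :: "'a \<Rightarrow> bit"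
  proof -
    have "(\<Sum>x\<in>X. f x) = (\<Sum>x\<in>X - Y. f x) + (\<Sum>x\<in>X \<inter> Y. f x)"
      "(\<Sum>x\<in>Y. f x) = (\<Sum>x\<in>Y - X. f x) + (\<Sum>x\<in>X \<inter> Y. f x)"
      unfolding sum.Int_Diff[OF that(1), of f Y] sum.Int_Diff[OF that(2), of f X]
      by (simp_all only: Int_commute add.commute)
    moreover have "(\<Sum>x\<in>sym_diff X Y. f x) = (\<Sum>x\<in>X - Y. f x) + (\<Sum>x\<in>Y - X. f x)"
      using that by (intro sum.union_disjoint) auto
    moreover have "a + c + (b + c) = a + b" for a b c :: bit
      by (cases a; cases b; cases c) simp_all
    ultimately show ?thesis by simp
  qed
  note sum_sd = this
  have "sym_diff X Y \<in> matrix_cycles E m A"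
    if "X \<in> matrix_cycles E m A" "Y \<in> matrix_cycles E m A" for X Y
  proof -
    have "X \<subseteq> E" "Y \<subseteq> E" using that unfolding matrix_cycles_def by blast+
    hence "finite X" "finite Y" using assms finite_subset by blast+
    moreover have "sym_diff X Y \<subseteq> E" using \<open>X \<subseteq> E\<close> \<open>Y \<subseteq> E\<close> by blast
    ultimately show ?thesis using that sum_sd[of X Y] unfolding matrix_cycles_def by simp
  qed
  moreover have "{} \<in> matrix_cycles E m A" "matrix_cycles E m A \<subseteq> Pow E"
    unfolding matrix_cycles_def by auto
  ultimately show ?thesis using assms unfolding cycle_space_def by blast
qed

lemma vector_matroid_eq_cycle_space_matroid:
  assumes "finite E"
  shows "vector_matroid E m A = cycle_space_matroid E (matrix_cycles E m A)"
proof -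
  have "columns_independent m A X \<longleftrightarrow> cycle_free (matrix_cycles E m A) X" if "X \<subseteq> E" for X
  proof -
    have "(\<forall>Z\<subseteq>X. (\<forall>i<m. (\<Sum>x\<in>Z. A i x) = 0) \<longrightarrow> Z = {}) \<longleftrightarrow> cycle_free (matrix_cycles E m A) X"
      unfolding cycle_free_def matrix_cycles_def using that by blast
    thus ?thesis using columns_independent_iff[OF finite_subset[OF that assms]] by blast
  qed
  thus ?thesis unfolding vector_matroid_def cycle_space_matroid_def by (metis (lifting))
qed

definition split_cycles :: "'a set set \<Rightarrow> 'a set \<Rightarrow> 'a set set" where
  "split_cycles \<C> H = {Z \<in> \<C>. even (card (Z \<inter> H))}"

lemma matrix_cycles_adjoin_row:
  assumes "finite E"
  shows "matrix_cycles E (Suc m) (adjoin_row m A H) = split_cycles (matrix_cycles E m A) H"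
proof -
  have "(\<Sum>x\<in>Z. if x \<in> H then 1 else (0 :: bit)) = 0 \<longleftrightarrow> even (card (Z \<inter> H))" if "Z \<subseteq> E" for Z
  proof -
    have "finite Z" using that assms finite_subset by blast
    hence "(\<Sum>x\<in>Z. if x \<in> H then 1 else (0 :: bit)) = of_nat (card (Z \<inter> H))"
      by (subst sum.inter_restrict[symmetric]) auto
    thus ?thesis by (cases "even (card (Z \<inter> H))") (auto simp: elim!: evenE oddE)
  qed
  moreover have "(\<forall>i<Suc m. (\<Sum>x\<in>Z. adjoin_row m A H i x) = 0) \<longleftrightarrow>
     (\<forall>i<m. (\<Sum>x\<in>Z. A i x) = 0) \<and> (\<Sum>x\<in>Z. if x \<in> H then 1 else (0 :: bit)) = 0" for Z
    by (auto simp: less_Suc_eq adjoin_row_def)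
  ultimately show ?thesis unfolding matrix_cycles_def split_cycles_def by auto
qed

lemma cycle_space_split_cycles:
  assumes "cycle_space E \<C>"
  shows "cycle_space E (split_cycles \<C> H)"
proof -
  have "even (card (sym_diff X Y \<inter> H))" 
    if "X \<in> split_cycles \<C> H" "Y \<in> split_cycles \<C> H" for X Y
  proof -
    have "finite X" "finite Y" using that cycle_spaceD(1,2)[OF assms] finite_subset
      unfolding split_cycles_def by blast+
    moreover have "sym_diff X Y \<inter> H = sym_diff (X \<inter> H) (Y \<inter> H)" by blast
    ultimately show ?thesis
      using that sym_diff_parity[of "X \<inter> H" "Y \<inter> H"] unfolding split_cycles_def by simp
  qed
  thus ?thesis using assms unfolding cycle_space_def split_cycles_def by auto
qed

text \<open>
  The passage from matrices to cycle spaces; every later statement about a binary matroid and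
  all its splittings starts from the one space \<open>\<C>\<close> obtained here.
\<close>
lemma binary_cycle_space:
  assumes "binary M"
  obtains \<C> where "cycle_space (ground M) \<C>" "M = cycle_space_matroid (ground M) \<C>"
    "\<And>H. splitting M H = cycle_space_matroid (ground M) (split_cycles \<C> H)"
    "\<And>H. binary (splitting M H)"
proof -
  obtain m A where mA: "represents m A M" and M: "is_matroid M" using assms unfolding binary_def by blast
  have fin: "finite (ground M)" using M unfolding is_matroid_def by blast
  define \<C> where "\<C> = matrix_cycles (ground M) m A"
  have 1: "cycle_space (ground M) \<C>" unfolding \<C>_def using cycle_space_matrix_cycles[OF fin] .
  have 2: "M = cycle_space_matroid (ground M) \<C>" 
    using mA unfolding represents_def vector_matroid_eq_cycle_space_matroid[OF fin] \<C>_def .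
  have 3: "splitting M H = cycle_space_matroid (ground M) (split_cycles \<C> H)" for H
    unfolding splitting_eq[OF fin mA] vector_matroid_eq_cycle_space_matroid[OF fin] matrix_cycles_adjoin_row[OF fin] \<C>_def ..
  have 4: "binary (splitting M H)" for H
  proof -
    have "is_matroid (splitting M H)"
      unfolding 3 by (intro is_matroid_cycle_space_matroid cycle_space_split_cycles 1)
    moreover have "represents (Suc m) (adjoin_row m A H) (splitting M H)"
      unfolding represents_def splitting_eq[OF fin mA] by (simp add: vector_matroid_def)
    ultimately show ?thesis unfolding binary_def by blast
  qed
  show ?thesis using that 1 2 3 4 by blast
qed

text \<open>
  A binary matroid determines its cycle space: a dependent set that has no smaller nonempty
  cycle is itself a cycle, and every cycle splits into such minimal ones.
\<close>
lemma cycle_space_eqI: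
  assumes C: "cycle_space E \<C>" and D: "cycle_space E \<D>"
    and eq: "\<And>X. X \<subseteq> E \<Longrightarrow> cycle_free \<C> X \<longleftrightarrow> cycle_free \<D> X"
  shows "\<C> = \<D>"
proof -
  have *: "Z \<in> \<B>" if "Z \<in> \<A>" and A: "cycle_space E \<A>" and B: "cycle_space E \<B>"
    and eq: "\<And>X. X \<subseteq> E \<Longrightarrow> cycle_free \<A> X \<longleftrightarrow> cycle_free \<B> X" for Z \<A> \<B>
  proof -
    have "finite Z" using that(1) cycle_spaceD(1,2)[OF A] finite_subset by blast
    thus ?thesis using that(1)
    proof (induction Z rule: finite_psubset_induct)
      case (psubset Z)
      show ?case
      proof (cases "Z = {}")
        case False
        have ZE: "Z \<subseteq> E" using psubset.prems cycle_spaceD(2)[OF A] by blast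
        have "\<not> cycle_free \<B> Z"
          using False psubset.prems eq[OF ZE] unfolding cycle_free_def by blast
        then obtain C where C: "C \<in> \<B>" "C \<subseteq> Z" "C \<noteq> {}" unfolding cycle_free_def by blast
        show ?thesis
        proof (cases "\<exists>D\<in>\<A>. D \<noteq> {} \<and> D \<subset> Z")
          case True
          then obtain D where D: "D \<in> \<A>" "D \<noteq> {}" "D \<subset> Z" by blast
          have "sym_diff Z D = Z - D" using D by blast
          hence "Z - D \<in> \<A>" using cycle_spaceD(4)[OF A psubset.prems D(1)] by simp
          moreover have "Z - D \<subset> Z" using D by blast
          ultimately have "Z - D \<in> \<B>" "D \<in> \<B>" using psubset.IH D by blast+
          moreover have "sym_diff (Z - D) D = Z" using D by blast
          ultimately show ?thesis using cycle_spaceD(4)[OF B] by metis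
        next
          case no: False
          have "C = Z"
          proof (rule ccontr)
            assume "C \<noteq> Z"
            hence "cycle_free \<A> C" using no C unfolding cycle_free_def by blast
            hence "cycle_free \<B> C" using eq[of C] C ZE by blast
            thus False using C unfolding cycle_free_def by blast
          qed
          thus ?thesis using C by simp
        qed
      qed (use cycle_spaceD(3)[OF B] in simp)
    qed
  qed
  show ?thesis using *[OF _ C D eq] *[OF _ D C] eq by blast
qed

section \<open>Minors and their cycle spaces\<close>

definition minor_cycles :: "'a set set \<Rightarrow> 'a set \<Rightarrow> 'a set \<Rightarrow> 'a set set" where
  "minor_cycles \<C> Y F = {Z \<inter> F |Z. Z \<in> \<C> \<and> Z \<subseteq> F \<union> Y}"

lemma minor_cyclesI: "Z \<in> \<C> \<Longrightarrow> Z \<subseteq> F \<union> Y \<Longrightarrow> Z \<inter> F \<in> minor_cycles \<C> Y F"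
  unfolding minor_cycles_def by blast

lemma cycle_space_minor_cycles:
  assumes "cycle_space E \<C>" "F \<subseteq> E"
  shows "cycle_space F (minor_cycles \<C> Y F)"
proof -
  note cs = cycle_spaceD[OF assms(1)]
  have "sym_diff X X' \<in> minor_cycles \<C> Y F"
    if X: "X \<in> minor_cycles \<C> Y F" and X': "X' \<in> minor_cycles \<C> Y F" for X X'
  proof -
    obtain Z Z' where Z: "Z \<in> \<C>" "Z \<subseteq> F \<union> Y" "X = Z \<inter> F" and Z': "Z' \<in> \<C>" "Z' \<subseteq> F \<union> Y" "X' = Z' \<inter> F"
      using X X' unfolding minor_cycles_def by blast
    have "sym_diff X X' = sym_diff Z Z' \<inter> F" using Z Z' by blast
    moreover have "sym_diff Z Z' \<subseteq> F \<union> Y" using Z Z' by blast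
    ultimately show ?thesis using cs(4)[OF Z(1) Z'(1)] unfolding minor_cycles_def by blast
  qed
  moreover have "{} \<in> minor_cycles \<C> Y F" using minor_cyclesI[OF cs(3), of F Y] by simp
  moreover have "minor_cycles \<C> Y F \<subseteq> Pow F" unfolding minor_cycles_def by blast
  ultimately show ?thesis
    unfolding cycle_space_def using finite_subset[OF assms(2) cs(1)] by blast
qed

lemma cycle_free_minor_cycles:
  assumes "cycle_free \<C> Y" "F \<inter> Y = {}" "X \<subseteq> F"
  shows "cycle_free (minor_cycles \<C> Y F) X \<longleftrightarrow> cycle_free \<C> (X \<union> Y)"
proof
  assume L: "cycle_free (minor_cycles \<C> Y F) X"
  show "cycle_free \<C> (X \<union> Y)"
    unfolding cycle_free_def
  proof (intro ballI impI)
    fix Z assume Z: "Z \<in> \<C>" "Z \<subseteq> X \<union> Y"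
    have "Z \<inter> F \<in> minor_cycles \<C> Y F" using Z assms(3) by (intro minor_cyclesI) auto
    moreover have "Z \<inter> F \<subseteq> X" using Z(2) assms(2) by blast
    ultimately have "Z \<inter> F = {}" using L unfolding cycle_free_def by simp
    hence "Z \<subseteq> Y" using Z assms(3) by blast
    thus "Z = {}" using assms(1) Z unfolding cycle_free_def by blast
  qed
next
  assume R: "cycle_free \<C> (X \<union> Y)"
  show "cycle_free (minor_cycles \<C> Y F) X"
    unfolding cycle_free_def minor_cycles_def
  proof (intro ballI impI)
    fix Z' assume "Z' \<in> {Z \<inter> F |Z. Z \<in> \<C> \<and> Z \<subseteq> F \<union> Y}" "Z' \<subseteq> X"
    then obtain Z where "Z \<in> \<C>" "Z \<subseteq> F \<union> Y" "Z' = Z \<inter> F" "Z \<inter> F \<subseteq> X" by blast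
    moreover from this have "Z \<subseteq> X \<union> Y" by blast
    ultimately show "Z' = {}" using R unfolding cycle_free_def by blast
  qed
qed

text \<open>
  If \<open>Y\<close> contains a cycle \<open>C\<close>, an element \<open>y\<close> of \<open>C\<close> can be dropped from \<open>Y\<close>: adding \<open>C\<close> to a
  cycle through \<open>y\<close> removes \<open>y\<close> and leaves the trace on \<open>F\<close> as it is.
\<close>
lemma minor_cycles_independent_contraction:
  assumes "cycle_space E \<C>" "Y \<subseteq> E" "F \<inter> Y = {}"
  obtains Y' where "Y' \<subseteq> Y" "cycle_free \<C> Y'" "minor_cycles \<C> Y' F = minor_cycles \<C> Y F"
proof -
  note cs = cycle_spaceD[OF assms(1)]
  have "finite Y" using assms(2) cs(1) finite_subset by blast
  hence "\<exists>Y'\<subseteq>Y. cycle_free \<C> Y' \<and> minor_cycles \<C> Y' F = minor_cycles \<C> Y F"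
    using assms(3)
  proof (induction Y rule: finite_psubset_induct)
    case (psubset Y)
    show ?case
    proof (cases "cycle_free \<C> Y")
      case False
      then obtain C y where C: "C \<in> \<C>" "C \<subseteq> Y" "y \<in> C" unfolding cycle_free_def by blast
      have "minor_cycles \<C> (Y - {y}) F = minor_cycles \<C> Y F"
      proof
        show "minor_cycles \<C> (Y - {y}) F \<subseteq> minor_cycles \<C> Y F" unfolding minor_cycles_def by blast
        show "minor_cycles \<C> Y F \<subseteq> minor_cycles \<C> (Y - {y}) F"
        proof
          fix X assume "X \<in> minor_cycles \<C> Y F"
          then obtain Z where Z: "Z \<in> \<C>" "Z \<subseteq> F \<union> Y" "X = Z \<inter> F" unfolding minor_cycles_def by blast
          define Z' where "Z' = (if y \<in> Z then sym_diff Z C else Z)"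
          have "Z' \<in> \<C>" using Z C cs(4) unfolding Z'_def by simp
          moreover have "Z' \<subseteq> F \<union> (Y - {y})" using Z C psubset.prems unfolding Z'_def by auto
          moreover have "X = Z' \<inter> F" using Z C psubset.prems unfolding Z'_def by auto
          ultimately show "X \<in> minor_cycles \<C> (Y - {y}) F" unfolding minor_cycles_def by blast
        qed
      qed
      moreover have "\<exists>Y'\<subseteq>Y - {y}. cycle_free \<C> Y' \<and> minor_cycles \<C> Y' F = minor_cycles \<C> (Y - {y}) F"
        using psubset.prems C by (intro psubset.IH) auto
      ultimately show ?thesis by auto
    qed blast
  qed
  thus ?thesis using that by blast
qed

text \<open>
  The choice of a basis in the definition of contraction is harmless: modulo the cycles inside
  \<open>Y\<close>, every element of \<open>Y\<close> can be expressed by any maximal independent subset of \<open>Y\<close>.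
\<close>
lemma is_minor_cycle_space_matroid_iff:
  assumes "cycle_space E \<C>"
  shows "is_minor N (cycle_space_matroid E \<C>) \<longleftrightarrow>
    (\<exists>Y F. Y \<subseteq> E \<and> F \<subseteq> E - Y \<and> N = cycle_space_matroid F (minor_cycles \<C> Y F))"
proof -
  let ?M = "cycle_space_matroid E \<C>"
  note cs = cycle_spaceD[OF assms]
  note mat = is_matroid_cycle_space_matroid[OF assms]
  have gr: "ground ?M = E" "indeps ?M = {X. X \<subseteq> E \<and> cycle_free \<C> X}"
    unfolding cycle_space_matroid_def by simp_all
  have minor_eq: "deletion (contraction ?M Y) (E - Y - F) = cycle_space_matroid F (minor_cycles \<C> Y F)"
    if Y: "Y \<subseteq> E" and F: "F \<subseteq> E - Y" for Y F
  proof -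
    have iff: "(\<exists>B. is_basis_of ?M Y B \<and> I \<union> B \<in> indeps ?M) \<longleftrightarrow> cycle_free (minor_cycles \<C> Y F) I"
      if I: "I \<subseteq> F" for I
    proof
      assume "\<exists>B. is_basis_of ?M Y B \<and> I \<union> B \<in> indeps ?M"
      then obtain B where B: "is_basis_of ?M Y B" "cycle_free \<C> (I \<union> B)" "B \<subseteq> Y"
        unfolding gr is_basis_of_def by blast
      have max: "\<not> cycle_free \<C> (insert y B)" if "y \<in> Y - B" for y
        using B(1) that Y unfolding is_basis_of_def gr by blast
      have red: "\<exists>Z'\<in>\<C>. Z' \<subseteq> F \<union> B \<and> Z' \<inter> F = Z \<inter> F" if "Z \<in> \<C>" "Z \<subseteq> F \<union> Y" for Z
      proof -
        have "finite (Z - F - B)" using cs(1,2) that(1) finite_subset by (metis finite_Diff)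
        thus ?thesis using that
        proof (induction "Z - F - B" arbitrary: Z rule: finite_psubset_induct)
          case psubset
          show ?case
          proof (cases "Z - F - B = {}")
            case True thus ?thesis using psubset.prems by blast
          next
            case False
            then obtain y where y: "y \<in> Z - F - B" by blast
            have free: "cycle_free \<C> B" by (rule cycle_free_mono[OF B(2)]) blast
            have "y \<in> Y - B" using y psubset.prems by blast
            then obtain C where C: "C \<in> \<C>" "y \<in> C" "C \<subseteq> insert y B"
              by (rule cycle_free_insertD[OF free max])
            have "C \<inter> F = {}" using C B(3) F y by blast
            hence tr: "sym_diff Z C \<inter> F = Z \<inter> F" by blast
            have "\<exists>Z'\<in>\<C>. Z' \<subseteq> F \<union> B \<and> Z' \<inter> F = sym_diff Z C \<inter> F"
              using psubset.prems cs(4) C B(3) y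
              by (intro psubset.hyps(2)) auto
            thus ?thesis using tr by simp
          qed
        qed
      qed
      show "cycle_free (minor_cycles \<C> Y F) I"
        unfolding cycle_free_def
      proof (intro ballI impI)
        fix X assume "X \<in> minor_cycles \<C> Y F" "X \<subseteq> I"
        then obtain Z where Z: "Z \<in> \<C>" "Z \<subseteq> F \<union> Y" "X = Z \<inter> F" unfolding minor_cycles_def by blast
        obtain Z' where Z': "Z' \<in> \<C>" "Z' \<subseteq> F \<union> B" "Z' \<inter> F = X" using red[OF Z(1,2)] Z(3) by blast
        hence "Z' \<subseteq> I \<union> B" using \<open>X \<subseteq> I\<close> by blast
        thus "X = {}" using B(2) Z' unfolding cycle_free_def by blast
      qed
    next
      assume R: "cycle_free (minor_cycles \<C> Y F) I"
      have FY: "F \<inter> Y = {}" using F by blast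
      define P where "P B \<longleftrightarrow> B \<subseteq> Y \<and> cycle_free \<C> B" for B
      have "finite Y" using Y cs(1) finite_subset by blast
      hence "finite {B. P B}" unfolding P_def by simp
      moreover have "{B. P B} \<noteq> {}" unfolding P_def cycle_free_def by blast
      ultimately obtain B where B: "P B" "\<And>B'. P B' \<Longrightarrow> B \<subseteq> B' \<Longrightarrow> B = B'"
        using finite_has_maximal[of "{B. P B}"] by auto
      have "is_basis_of ?M Y B"
        unfolding is_basis_of_def gr
      proof (intro conjI allI impI)
        show "B \<subseteq> Y" "B \<in> {X. X \<subseteq> E \<and> cycle_free \<C> X}" using B(1) Y unfolding P_def by auto
        show "B' = B" if "B \<subseteq> B' \<and> B' \<subseteq> Y \<and> B' \<in> {X. X \<subseteq> E \<and> cycle_free \<C> X}" for B'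
          using B(2)[of B'] that unfolding P_def by simp
      qed
      moreover have "cycle_free \<C> (I \<union> B)"
      proof -
        have B1: "B \<subseteq> Y" "cycle_free \<C> B" using B(1) unfolding P_def by auto
        hence "minor_cycles \<C> B F \<subseteq> minor_cycles \<C> Y F" unfolding minor_cycles_def by blast
        hence "cycle_free (minor_cycles \<C> B F) I" using R unfolding cycle_free_def by blast
        moreover have "F \<inter> B = {}" using FY B1(1) by blast
        ultimately show ?thesis using cycle_free_minor_cycles[OF B1(2) _ I] by blast
      qed
      ultimately show "\<exists>B. is_basis_of ?M Y B \<and> I \<union> B \<in> indeps ?M"
        using B(1) I F Y unfolding gr P_def by blast
    qed
    have EYF: "E - Y - (E - Y - F) = F" using F by blast
    have "{I \<in> indeps (contraction ?M Y). I \<subseteq> F} = {I. I \<subseteq> F \<and> cycle_free (minor_cycles \<C> Y F) I}"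
      (is "?L = ?R")
    proof (rule set_eqI)
      fix I
      have "I \<in> ?L \<longleftrightarrow> I \<subseteq> F \<and> (\<exists>B. is_basis_of ?M Y B \<and> I \<union> B \<in> indeps ?M)"
        using F unfolding contraction_def gr(1) by auto
      thus "I \<in> ?L \<longleftrightarrow> I \<in> ?R" using iff[of I] by blast
    qed
    moreover have "ground (contraction ?M Y) = E - Y" unfolding contraction_def gr(1) by simp
    ultimately show ?thesis
      unfolding deletion_def cycle_space_matroid_def[of F] by (simp only: EYF)
  qed
  show ?thesis
  proof
    assume "is_minor N ?M"
    then obtain X Y where XY: "X \<subseteq> E" "Y \<subseteq> E" "X \<inter> Y = {}" "N = deletion (contraction ?M Y) X"
      unfolding is_minor_def gr by blast
    have "E - Y - (E - Y - X) = X" using XY by blast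
    thus "\<exists>Y F. Y \<subseteq> E \<and> F \<subseteq> E - Y \<and> N = cycle_space_matroid F (minor_cycles \<C> Y F)"
      using minor_eq[of Y "E - Y - X"] XY by (intro exI[of _ Y] exI[of _ "E - Y - X"]) auto
  next
    assume "\<exists>Y F. Y \<subseteq> E \<and> F \<subseteq> E - Y \<and> N = cycle_space_matroid F (minor_cycles \<C> Y F)"
    then obtain Y F where "Y \<subseteq> E" "F \<subseteq> E - Y" "N = cycle_space_matroid F (minor_cycles \<C> Y F)" by blast
    thus "is_minor N ?M"
      unfolding is_minor_def gr using minor_eq[of Y F]
      by (intro exI[of _ "E - Y - F"] exI[of _ Y]) auto
  qed
qed

section \<open>Hall's theorem and representatives avoiding a set\<close>

text \<open>
  Rado's proof. While some set has two elements \<open>x\<close> and \<open>y\<close>, one of them can be removed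
  without violating Hall's condition: two violating index families, one for \<open>x\<close> and one for
  \<open>y\<close>, would by submodularity contradict the condition for their union and their intersection.
  When all sets are singletons the claim is evident.
\<close>
lemma hall_marriage:
  fixes A :: "'i \<Rightarrow> 'v set"
  assumes "finite W" "\<And>w. w \<in> W \<Longrightarrow> finite (A w)"
    and "\<And>J. J \<subseteq> W \<Longrightarrow> card J \<le> card (\<Union>(A ` J))"
  shows "\<exists>m. inj_on m W \<and> (\<forall>w\<in>W. m w \<in> A w)"
  using assms(2,3)
proof (induction "\<Sum>w\<in>W. card (A w)" arbitrary: A rule: less_induct)
  case less
  note finA = less.prems(1) and hallA = less.prems(2)
  have fJ: "finite J" if "J \<subseteq> W" for J using that assms(1) finite_subset by blast
  have fU: "finite (\<Union>(A ` J))" if "J \<subseteq> W" for J using finA that fJ[OF that] by auto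
  show ?case
  proof (cases "\<exists>w\<in>W. \<exists>x\<in>A w. \<exists>y\<in>A w. x \<noteq> y")
    case True
    then obtain w x y where w: "w \<in> W" "x \<in> A w" "y \<in> A w" "x \<noteq> y" by meson
    have "\<exists>z\<in>{x, y}. \<forall>J\<subseteq>W. card J \<le> card (\<Union>((A(w := A w - {z})) ` J))"
    proof (rule ccontr)
      assume no: "\<not> ?thesis"
      have viol: "\<exists>J\<subseteq>W - {w}. card (\<Union>(A ` J) \<union> (A w - {z})) \<le> card J" if "z \<in> {x, y}" for z
      proof -
        have "\<not> (\<forall>J\<subseteq>W. card J \<le> card (\<Union>((A(w := A w - {z})) ` J)))"
        proof
          assume "\<forall>J\<subseteq>W. card J \<le> card (\<Union>((A(w := A w - {z})) ` J))"
          hence "\<exists>z\<in>{x, y}. \<forall>J\<subseteq>W. card J \<le> card (\<Union>((A(w := A w - {z})) ` J))"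
            using that by (rule bexI)
          thus False using no by (rule notE[rotated])
        qed
        then obtain J where J: "J \<subseteq> W" "card (\<Union>((A(w := A w - {z})) ` J)) < card J"
          unfolding not_all not_imp not_le by (elim exE conjE)
        have "w \<in> J"
        proof (rule ccontr)
          assume "w \<notin> J"
          hence "(A(w := A w - {z})) ` J = A ` J" by (intro image_cong) auto
          thus False using J hallA[OF J(1)] by simp
        qed
        have "\<Union>((A(w := A w - {z})) ` insert w (J - {w})) = \<Union>(A ` (J - {w})) \<union> (A w - {z})"
        proof -
          have "(A(w := A w - {z})) ` (J - {w}) = A ` (J - {w})" by (intro image_cong) auto
          thus ?thesis by (simp only: image_insert Union_insert fun_upd_same Un_commute)
        qed
        hence "\<Union>((A(w := A w - {z})) ` J) = \<Union>(A ` (J - {w})) \<union> (A w - {z})"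
          using \<open>w \<in> J\<close> by (simp only: insert_Diff)
        moreover have "card J = Suc (card (J - {w}))"
          using \<open>w \<in> J\<close> fJ[OF J(1)] by (metis card_Suc_Diff1)
        ultimately have "card (\<Union>(A ` (J - {w})) \<union> (A w - {z})) \<le> card (J - {w})"
          using J(2) by (simp only: less_Suc_eq_le)
        thus ?thesis using J(1) by (intro exI[of _ "J - {w}"] conjI Diff_mono order_refl)
      qed
      obtain J1 where J1: "J1 \<subseteq> W - {w}" "card (\<Union>(A ` J1) \<union> (A w - {x})) \<le> card J1"
        using viol[of x] by blast
      obtain J2 where J2: "J2 \<subseteq> W - {w}" "card (\<Union>(A ` J2) \<union> (A w - {y})) \<le> card J2"
        using viol[of y] by blast
      define P where "P = \<Union>(A ` J1) \<union> (A w - {x})"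
      define Q where "Q = \<Union>(A ` J2) \<union> (A w - {y})"
      have JW: "J1 \<subseteq> W" "J2 \<subseteq> W" "J1 \<inter> J2 \<subseteq> W" "insert w (J1 \<union> J2) \<subseteq> W" using J1 J2 w by auto
      have fPQ: "finite P" "finite Q" unfolding P_def Q_def using fU JW finA w by auto
      have "\<Union>(A ` insert w (J1 \<union> J2)) \<subseteq> P \<union> Q" unfolding P_def Q_def using w by auto
      hence "card (insert w (J1 \<union> J2)) \<le> card (P \<union> Q)"
        using hallA[OF JW(4)] card_mono[of "P \<union> Q"] fPQ by (meson finite_UnI le_trans)
      moreover have "w \<notin> J1 \<union> J2" using J1 J2 by blast
      ultimately have 1: "Suc (card (J1 \<union> J2)) \<le> card (P \<union> Q)"
        using fJ JW by (simp add: card_insert_if)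
      have "\<Union>(A ` (J1 \<inter> J2)) \<subseteq> P \<inter> Q" unfolding P_def Q_def by auto
      hence 2: "card (J1 \<inter> J2) \<le> card (P \<inter> Q)"
        using hallA[OF JW(3)] card_mono[of "P \<inter> Q"] fPQ by (meson finite_Int le_trans)
      have "card P + card Q = card (P \<union> Q) + card (P \<inter> Q)" using fPQ by (rule card_Un_Int)
      moreover have "card J1 + card J2 = card (J1 \<union> J2) + card (J1 \<inter> J2)"
        using fJ JW by (intro card_Un_Int) auto
      ultimately show False using 1 2 J1(2) J2(2) unfolding P_def[symmetric] Q_def[symmetric] by linarith
    qed
    then obtain z where z: "z \<in> A w" "\<forall>J\<subseteq>W. card J \<le> card (\<Union>((A(w := A w - {z})) ` J))"
      using w(2,3) by (elim bexE) auto
    let ?A = "A(w := A w - {z})"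
    have "(\<Sum>v\<in>W. card (?A v)) < (\<Sum>v\<in>W. card (A v))"
    proof (rule sum_strict_mono_ex1[OF assms(1)])
      show "\<forall>v\<in>W. card (?A v) \<le> card (A v)" using finA by (auto intro: card_mono)
      show "\<exists>v\<in>W. card (?A v) < card (A v)"
        using w card_Diff1_less[OF finA[OF w(1)] z(1)] by (intro bexI[of _ w]) simp_all
    qed
    moreover have "finite (?A v)" if "v \<in> W" for v using finA that by auto
    ultimately obtain m where m: "inj_on m W" "\<forall>v\<in>W. m v \<in> ?A v"
      using less.hyps[of ?A] z(2) by blast
    have "m v \<in> A v" if "v \<in> W" for v using m(2) that by (cases "v = w") auto
    thus ?thesis using m(1) by blast
  next
    case False
    have ne: "A w \<noteq> {}" if "w \<in> W" for w
      using hallA[of "{w}"] that by auto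
    define m where "m w = (SOME x. x \<in> A w)" for w
    have m: "A w = {m w}" if "w \<in> W" for w
      using someI_ex[of "\<lambda>x. x \<in> A w"] ne[OF that] False that unfolding m_def by blast
    have "inj_on m W"
    proof (rule inj_onI, rule ccontr)
      fix v w assume vw: "v \<in> W" "w \<in> W" "m v = m w" "v \<noteq> w"
      hence "\<Union>(A ` {v, w}) = {m v}" using m by auto
      thus False using hallA[of "{v, w}"] vw by auto
    qed
    thus ?thesis using m by blast
  qed
qed

text \<open>
  The set system \<open>A\<close>, indexed by \<open>W\<close>, has a system of distinct representatives disjoint from
  \<open>X\<close>. For fixed \<open>A\<close> the sets \<open>X\<close> with this property, if there are any, are the independent
  sets of the dual of the transversal matroid presented by \<open>A\<close>.
\<close>
definition avoidable :: "'i set \<Rightarrow> ('i \<Rightarrow> 'v set) \<Rightarrow> 'v set \<Rightarrow> bool" where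
  "avoidable W A X \<longleftrightarrow> (\<exists>m. inj_on m W \<and> (\<forall>w\<in>W. m w \<in> A w - X))"

text \<open>
  In terms of the deficiency \<open>d(J) = card (\<Union>(A ` J)) - card J\<close> the condition says that \<open>X\<close> has
  at most \<open>d(J)\<close> elements in the union of the members indexed by \<open>J\<close>.
\<close>
lemma avoidable_iff_hall:
  assumes "finite W" "\<And>w. w \<in> W \<Longrightarrow> finite (A w)"
  shows "avoidable W A X \<longleftrightarrow>
    (\<forall>J\<subseteq>W. card J + card (X \<inter> \<Union>(A ` J)) \<le> card (\<Union>(A ` J)))"
proof -
  have fU: "finite (\<Union>(A ` J))" if "J \<subseteq> W" for J
    using finite_subset[OF that assms(1)] that assms(2) by auto
  have split: "card (\<Union>(A ` J)) = card (\<Union>((\<lambda>w. A w - X) ` J)) + card (X \<inter> \<Union>(A ` J))" if "J \<subseteq> W" for J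
  proof -
    have "\<Union>((\<lambda>w. A w - X) ` J) = \<Union>(A ` J) - X" by blast
    thus ?thesis using card_Int_Diff[OF fU[OF that], of X] by (simp add: Int_commute)
  qed
  have "avoidable W A X \<longleftrightarrow> (\<forall>J\<subseteq>W. card J \<le> card (\<Union>((\<lambda>w. A w - X) ` J)))"
  proof
    assume "avoidable W A X"
    then obtain m where m: "inj_on m W" "\<forall>w\<in>W. m w \<in> A w - X" unfolding avoidable_def by blast
    show "\<forall>J\<subseteq>W. card J \<le> card (\<Union>((\<lambda>w. A w - X) ` J))"
    proof (intro allI impI)
      fix J assume J: "J \<subseteq> W"
      have "finite (\<Union>((\<lambda>w. A w - X) ` J))" by (rule finite_subset[OF _ fU[OF J]]) blast
      thus "card J \<le> card (\<Union>((\<lambda>w. A w - X) ` J))"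
        using m J by (intro card_inj_on_le[of m]) (auto intro: inj_on_subset)
    qed
  next
    assume "\<forall>J\<subseteq>W. card J \<le> card (\<Union>((\<lambda>w. A w - X) ` J))"
    thus "avoidable W A X" unfolding avoidable_def
      using hall_marriage[of W "\<lambda>w. A w - X"] assms by simp
  qed
  also have "\<dots> \<longleftrightarrow> (\<forall>J\<subseteq>W. card J + card (X \<inter> \<Union>(A ` J)) \<le> card (\<Union>(A ` J)))"
    using split by (intro all_cong1 imp_cong refl) (simp only: split add_le_cancel_right)
  finally show ?thesis .
qed

lemma avoidable_mono: "avoidable W A X \<Longrightarrow> Y \<subseteq> X \<Longrightarrow> avoidable W A Y"
  unfolding avoidable_def by blast

lemma avoidable_cong:
  assumes "X \<inter> \<Union>(A ` W) = Y \<inter> \<Union>(A ` W)" "\<And>w. w \<in> W \<Longrightarrow> A w = B w"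
  shows "avoidable W A X \<longleftrightarrow> avoidable W B Y"
proof -
  have "A w - X = B w - Y" if "w \<in> W" for w
    using assms(1) assms(2)[OF that] that by blast
  thus ?thesis unfolding avoidable_def by simp
qed

lemma avoidable_image:
  assumes "inj_on g W"
  shows "avoidable (g ` W) B X \<longleftrightarrow> avoidable W (\<lambda>w. B (g w)) X"
proof
  assume "avoidable (g ` W) B X"
  then obtain m where m: "inj_on m (g ` W)" "\<forall>v\<in>g ` W. m v \<in> B v - X" unfolding avoidable_def by (elim exE conjE)
  show "avoidable W (\<lambda>w. B (g w)) X"
    unfolding avoidable_def using m comp_inj_on[OF assms m(1)] by (intro exI[of _ "m \<circ> g"]) simp
next
  assume "avoidable W (\<lambda>w. B (g w)) X"
  then obtain m where m: "inj_on m W" "\<forall>w\<in>W. m w \<in> B (g w) - X" unfolding avoidable_def by (elim exE conjE)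
  have "inj_on (m \<circ> inv_into W g) (g ` W)"
    using m(1) assms by (intro comp_inj_on inj_on_inv_into) (auto simp: inj_on_imp_bij_betw bij_betw_imp_surj_on bij_betw_inv_into)
  moreover have "\<forall>v\<in>g ` W. (m \<circ> inv_into W g) v \<in> B v - X"
    using m(2) assms by simp
  ultimately show "avoidable (g ` W) B X" unfolding avoidable_def by blast
qed

lemma avoidable_insert:
  assumes "w0 \<notin> W"
  shows "avoidable (insert w0 W) A X \<longleftrightarrow> (\<exists>u\<in>A w0 - X. avoidable W A (insert u X))"
proof
  assume "avoidable (insert w0 W) A X"
  then obtain m where m: "inj_on m (insert w0 W)" "\<forall>w\<in>insert w0 W. m w \<in> A w - X"
    unfolding avoidable_def by (elim exE conjE)
  have "m w \<noteq> m w0" if "w \<in> W" for w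
    using inj_onD[OF m(1), of w w0] that assms by auto
  hence "\<forall>w\<in>W. m w \<in> A w - insert (m w0) X" using m(2) by blast
  moreover have "inj_on m W" using m(1) by simp
  ultimately have "avoidable W A (insert (m w0) X)" unfolding avoidable_def by blast
  thus "\<exists>u\<in>A w0 - X. avoidable W A (insert u X)" using m(2) by blast
next
  assume "\<exists>u\<in>A w0 - X. avoidable W A (insert u X)"
  then obtain u m where u: "u \<in> A w0 - X" and m: "inj_on m W" "\<forall>w\<in>W. m w \<in> A w - insert u X"
    unfolding avoidable_def by (elim bexE exE conjE)
  have "inj_on (m(w0 := u)) (insert w0 W)"
    using m assms by (auto simp: inj_on_def)
  moreover have "\<forall>w\<in>insert w0 W. (m(w0 := u)) w \<in> A w - X" using u m(2) by auto
  ultimately show "avoidable (insert w0 W) A X" unfolding avoidable_def by blast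
qed

section \<open>Cotransversal matroids have no $M(K_4)$ minor\<close>

text \<open>
  The triples \<open>abx\<close>, \<open>bcy\<close>, \<open>acz\<close>, \<open>xyz\<close> are the triangles of $K_4$. Each is dependent, which
  provides an index family \<open>J\<^sub>i\<close> of deficiency 2 whose union \<open>N J\<^sub>i\<close> contains the triangle.
  Deficiency is submodular, with an explicit error term counting the common neighbours missed
  by the intersection. Since three independent elements force deficiency 3, the union \<open>K\<close> of
  the first three families has deficiency 3, and comparing it with the fourth leaves
  deficiency at most 2 for \<open>K \<inter> J\<^sub>4\<close>. But \<open>K \<inter> J\<^sub>4\<close> is the union of the three families
  \<open>J\<^sub>i \<inter> J\<^sub>4\<close>. Each of these has deficiency 1 and they meet in deficiency 0, so that their
  union has deficiency 3.
\<close>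
lemma no_K4_in_set_system:
  fixes A :: "'i \<Rightarrow> 'v set"
  assumes finW: "finite W" and finA: "\<And>w. w \<in> W \<Longrightarrow> finite (A w)"
    and dist: "distinct [a, b, c, x, y, z]"
    and dep: "\<not> avoidable W A {a, b, x}" "\<not> avoidable W A {b, c, y}" 
      "\<not> avoidable W A {a, c, z}" "\<not> avoidable W A {x, y, z}"
    and ind: "avoidable W A {a, b, c}" "avoidable W A {a, b, y}" "avoidable W A {a, b, z}"
      "avoidable W A {b, c, x}" "avoidable W A {b, c, z}" "avoidable W A {a, c, x}" "avoidable W A {a, c, y}"
      "avoidable W A {x, y, a}" "avoidable W A {y, z, c}" "avoidable W A {x, z, b}"
  shows False
proof -
  define N where "N J = \<Union>(A ` J)" for J
  define d where "d J = int (card (N J)) - int (card J)" for J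
  have finJ: "finite J" if "J \<subseteq> W" for J using that finW finite_subset by blast
  have finN: "finite (N J)" if "J \<subseteq> W" for J using that finA finJ[OF that] unfolding N_def by auto
  have NU: "N (J \<union> K) = N J \<union> N K" for J K unfolding N_def by blast
  have NI: "N (J \<inter> K) \<subseteq> N J \<inter> N K" for J K unfolding N_def by blast
  have free: "avoidable W A S \<longleftrightarrow> (\<forall>J\<subseteq>W. int (card (S \<inter> N J)) \<le> d J)" for S
  proof -
    have "avoidable W A S \<longleftrightarrow> (\<forall>J\<subseteq>W. card J + card (S \<inter> N J) \<le> card (N J))"
      unfolding N_def by (rule avoidable_iff_hall) (use finW finA in auto)
    also have "\<dots> \<longleftrightarrow> (\<forall>J\<subseteq>W. int (card (S \<inter> N J)) \<le> d J)"
      unfolding d_def by (intro all_cong1 imp_cong refl iffI; linarith)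
    finally show ?thesis .
  qed
  have sub: "avoidable W A T \<Longrightarrow> S \<subseteq> T \<Longrightarrow> avoidable W A S" for S T
    unfolding avoidable_def by blast
  have lower: "int (card S) \<le> d J" if "avoidable W A S" "S \<subseteq> N J" "J \<subseteq> W" for S J
    using that free[of S] by (metis inf.absorb1)
  have d0: "0 \<le> d J" if "J \<subseteq> W" for J using lower[OF sub[OF ind(1), of "{}"] _ that] by simp
  have submod: "d (J \<union> K) + d (J \<inter> K) + int (card (N J \<inter> N K - N (J \<inter> K))) = d J + d K"
    if "J \<subseteq> W" "K \<subseteq> W" for J K
  proof -
    have "card J + card K = card (J \<union> K) + card (J \<inter> K)"
      using finJ that by (intro card_Un_Int) auto
    moreover have "card (N J) + card (N K) = card (N (J \<union> K)) + card (N J \<inter> N K)"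
      unfolding NU using finN that by (intro card_Un_Int) auto
    moreover have "card (N J \<inter> N K) = card (N (J \<inter> K)) + card (N J \<inter> N K - N (J \<inter> K))"
      using card_Int_Diff[of "N J \<inter> N K" "N (J \<inter> K)"] NI[of J K] finN[OF that(1)]
      by (simp add: inf.absorb2)
    ultimately show ?thesis unfolding d_def by linarith
  qed
  \<comment> \<open>Each element of \<open>S\<close> is counted once, either in \<open>N (J \<inter> K)\<close> or in the error term.\<close>
  have submod_le: "d (J \<union> K) \<le> d J + d K - int (card S)"
    if "J \<subseteq> W" "K \<subseteq> W" "S \<subseteq> N J \<inter> N K" "avoidable W A (S \<inter> N (J \<inter> K))" for J K S
  proof -
    have fS: "finite S" using that finN finite_subset by (metis finite_Int)
    have JK: "J \<inter> K \<subseteq> W" using that by blast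
    have "int (card (S \<inter> N (J \<inter> K))) \<le> d (J \<inter> K)" using lower[OF that(4) _ JK] by simp
    moreover have "card (S - N (J \<inter> K)) \<le> card (N J \<inter> N K - N (J \<inter> K))"
      using that finN by (intro card_mono) auto
    moreover have "card S = card (S \<inter> N (J \<inter> K)) + card (S - N (J \<inter> K))"
      using card_Int_Diff[OF fS] .
    ultimately show ?thesis using submod[OF that(1,2)] by linarith
  qed
  have line: "\<exists>J\<subseteq>W. {p, q, r} \<subseteq> N J \<and> d J = 2"
    if h: "\<not> avoidable W A {p, q, r}" "avoidable W A {p, q}" "avoidable W A {p, r}" "avoidable W A {q, r}"
      "p \<noteq> q" "p \<noteq> r" "q \<noteq> r" for p q r
  proof -
    obtain J where J: "J \<subseteq> W" "d J < int (card ({p, q, r} \<inter> N J))"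
      using h(1) free by (meson not_le)
    have pqr: "{p, q, r} \<subseteq> N J"
    proof (rule ccontr)
      assume "\<not> ?thesis"
      hence "{p, q, r} \<inter> N J \<subseteq> {p, q} \<or> {p, q, r} \<inter> N J \<subseteq> {p, r} \<or> {p, q, r} \<inter> N J \<subseteq> {q, r}" by blast
      hence "avoidable W A ({p, q, r} \<inter> N J)" using h(2-4) sub by blast
      thus False using lower[OF _ _ J(1)] J(2) by force
    qed
    have "card ({p, q, r} \<inter> N J) = 3" using pqr h by (simp add: inf.absorb1)
    moreover have "2 \<le> d J" using lower[OF h(2) _ J(1)] pqr h(5) by simp
    ultimately show ?thesis using J pqr by (intro exI[of _ J]) auto
  qed
  obtain J1 where J1: "J1 \<subseteq> W" "{a, b, x} \<subseteq> N J1" "d J1 = 2"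
    using line[OF dep(1) sub[OF ind(1)] sub[OF ind(6)] sub[OF ind(4)]] dist by auto
  obtain J2 where J2: "J2 \<subseteq> W" "{b, c, y} \<subseteq> N J2" "d J2 = 2"
    using line[OF dep(2) sub[OF ind(1)] sub[OF ind(2)] sub[OF ind(7)]] dist by auto
  obtain J3 where J3: "J3 \<subseteq> W" "{a, c, z} \<subseteq> N J3" "d J3 = 2"
    using line[OF dep(3) sub[OF ind(1)] sub[OF ind(3)] sub[OF ind(5)]] dist by auto
  obtain J4 where J4: "J4 \<subseteq> W" "{x, y, z} \<subseteq> N J4" "d J4 = 2"
    using line[OF dep(4) sub[OF ind(8)] sub[OF ind(10)] sub[OF ind(9)]] dist by auto
  have rank3: "3 \<le> d J" if "J \<subseteq> W" "avoidable W A {p, q, r}" "distinct [p, q, r]" "{p, q, r} \<subseteq> N J" for J p q r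
    using lower[OF that(2,4,1)] that(3) by simp
  define K where "K = J1 \<union> J2 \<union> J3"
  have KW: "K \<subseteq> W" "J1 \<union> J2 \<subseteq> W" unfolding K_def using J1 J2 J3 by auto
  have d12: "d (J1 \<union> J2) \<le> 3"
  proof -
    have "avoidable W A ({b} \<inter> N (J1 \<inter> J2))" by (rule sub[OF ind(1)]) auto
    moreover have "{b} \<subseteq> N J1 \<inter> N J2" using J1 J2 by auto
    ultimately have "d (J1 \<union> J2) \<le> d J1 + d J2 - int (card {b})"
      using submod_le[OF J1(1) J2(1)] by blast
    thus ?thesis using J1 J2 by simp
  qed
  have dK: "d K \<le> 3"
  proof -
    have "avoidable W A ({a, c} \<inter> N ((J1 \<union> J2) \<inter> J3))" by (rule sub[OF ind(1)]) auto
    moreover have "{a, c} \<subseteq> N (J1 \<union> J2) \<inter> N J3" using J1 J2 J3 unfolding NU by auto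
    ultimately have "d K \<le> d (J1 \<union> J2) + d J3 - int (card {a, c})"
      unfolding K_def using submod_le[OF KW(2) J3(1)] by blast
    thus ?thesis using d12 J3 dist by simp
  qed
  have xyzK: "{x, y, z} \<subseteq> N K" unfolding K_def NU using J1 J2 J3 by auto
  have dK4: "3 \<le> d (K \<union> J4)"
    using rank3[of "K \<union> J4", OF _ ind(1)] KW J4 J1 J2 dist unfolding K_def NU by auto
  \<comment> \<open>Otherwise the three elements count fully against the union, whose deficiency would drop to 2.\<close>
  have xyz: "{x, y, z} \<subseteq> N (K \<inter> J4)"
  proof (rule ccontr)
    assume "\<not> ?thesis"
    hence "{x, y, z} \<inter> N (K \<inter> J4) \<subseteq> {x, y} \<or> {x, y, z} \<inter> N (K \<inter> J4) \<subseteq> {x, z} \<or> {x, y, z} \<inter> N (K \<inter> J4) \<subseteq> {y, z}"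
      by blast
    hence "avoidable W A ({x, y, z} \<inter> N (K \<inter> J4))"
      by (elim disjE) (rule sub[OF ind(8)] sub[OF ind(10)] sub[OF ind(9)]; erule subset_trans; simp)+
    hence "d (K \<union> J4) \<le> d K + d J4 - int (card {x, y, z})"
      using submod_le[OF KW(1) J4(1)] xyzK J4(2) by blast
    thus False using dK4 dK J4(3) dist by simp
  qed
  define L1 where "L1 = J1 \<inter> J4"
  define L2 where "L2 = J2 \<inter> J4"
  define L3 where "L3 = J3 \<inter> J4"
  have LW: "L1 \<subseteq> W" "L2 \<subseteq> W" "L3 \<subseteq> W" "L1 \<union> L2 \<subseteq> W" "L1 \<inter> L2 \<subseteq> W" "L1 \<inter> L3 \<subseteq> W" "L2 \<inter> L3 \<subseteq> W"
    unfolding L1_def L2_def L3_def using J4 by auto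
  have KL: "K \<inter> J4 = (L1 \<union> L2) \<union> L3" unfolding K_def L1_def L2_def L3_def by blast
  have L: "d (J \<inter> J4) = 1" 
    if "J \<subseteq> W" "d J = 2" "avoidable W A {p, q, s}" "distinct [p, q, s]" "{p, q} \<subseteq> N J" "s \<in> N J4"
      "avoidable W A {t}" "t \<in> N (J \<inter> J4)" for J p q s t
  proof -
    have "3 \<le> d (J \<union> J4)" using rank3[of "J \<union> J4", OF _ that(3,4)] that J4(1) unfolding NU by auto
    hence "d (J \<inter> J4) \<le> 1" using submod[OF that(1) J4(1)] that(2) J4(3) by linarith
    moreover have "1 \<le> d (J \<inter> J4)" using lower[OF that(7), of "J \<inter> J4"] that by auto
    ultimately show ?thesis by simp
  qed
  \<comment> \<open>The union belonging to a triangle contains no further element, as it would contain three independent ones.\<close>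
  have out: "s \<notin> N (J \<inter> J4)"
    if "J \<subseteq> W" "d J = 2" "avoidable W A {p, q, s}" "distinct [p, q, s]" "{p, q} \<subseteq> N J" for J p q s
  proof
    assume "s \<in> N (J \<inter> J4)"
    hence "3 \<le> d J" using rank3[OF that(1,3,4)] that(5) NI[of J J4] by auto
    thus False using that(2) by simp
  qed
  have x1: "x \<in> N L1"
    using xyz out[OF J2(1,3) ind(4)] out[OF J3(1,3) ind(6)] J2(2) J3(2) dist
    unfolding KL NU L1_def L2_def L3_def by auto
  have y2: "y \<in> N L2"
    using xyz out[OF J1(1,3) ind(2)] out[OF J3(1,3) ind(7)] J1(2) J3(2) dist
    unfolding KL NU L1_def L2_def L3_def by auto
  have z3: "z \<in> N L3"
    using xyz out[OF J1(1,3) ind(3)] out[OF J2(1,3) ind(5)] J1(2) J2(2) dist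
    unfolding KL NU L1_def L2_def L3_def by auto
  have dL1: "d L1 = 1"
    using L[OF J1(1,3) ind(2), of x] x1 J1(2) J4(2) dist sub[OF ind(8), of "{x}"] unfolding L1_def by auto
  have dL2: "d L2 = 1"
    using L[OF J2(1,3) ind(4), of y] y2 J2(2) J4(2) dist sub[OF ind(8), of "{y}"] unfolding L2_def by auto
  have dL3: "d L3 = 1"
    using L[OF J3(1,3) ind(6), of z] z3 J3(2) J4(2) dist sub[OF ind(9), of "{z}"] unfolding L3_def by auto
  have pair: "d (L \<inter> L') = 0 \<and> N L \<inter> N L' \<subseteq> N (L \<inter> L') \<and> d (L \<union> L') = 2"
    if "L \<subseteq> W" "L' \<subseteq> W" "d L = 1" "d L' = 1" "avoidable W A {p, q}" "p \<noteq> q" "p \<in> N L" "q \<in> N L'" for L L' p q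
  proof -
    have "2 \<le> d (L \<union> L')" using lower[OF that(5), of "L \<union> L'"] that unfolding NU by auto
    moreover have "0 \<le> d (L \<inter> L')" using d0[of "L \<inter> L'"] that by blast
    ultimately have "d (L \<inter> L') = 0" "card (N L \<inter> N L' - N (L \<inter> L')) = 0" "d (L \<union> L') = 2"
      using submod[OF that(1,2)] that(3,4) by linarith+
    thus ?thesis using finN[OF that(1)] by auto
  qed
  have P12: "d (L1 \<inter> L2) = 0" "d (L1 \<union> L2) = 2"
    using pair[OF LW(1,2) dL1 dL2 sub[OF ind(8)] _ x1 y2] dist by auto
  have P13: "d (L1 \<inter> L3) = 0" "N L1 \<inter> N L3 \<subseteq> N (L1 \<inter> L3)"
    using pair[OF LW(1,3) dL1 dL3 sub[OF ind(10)] _ x1 z3] dist by auto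
  have P23: "d (L2 \<inter> L3) = 0" "N L2 \<inter> N L3 \<subseteq> N (L2 \<inter> L3)"
    using pair[OF LW(2,3) dL2 dL3 sub[OF ind(9)] _ y2 z3] dist by auto
  have I: "(L1 \<union> L2) \<inter> L3 = (L1 \<inter> L3) \<union> (L2 \<inter> L3)" by blast
  have "d ((L1 \<union> L2) \<inter> L3) \<le> 0"
  proof -
    have "(L1 \<inter> L3) \<inter> (L2 \<inter> L3) \<subseteq> W" using LW by blast
    from d0[OF this] show ?thesis unfolding I using submod[OF LW(6,7)] P13(1) P23(1) by linarith
  qed
  moreover have "N (L1 \<union> L2) \<inter> N L3 - N ((L1 \<union> L2) \<inter> L3) = {}"
    unfolding I NU using P13(2) P23(2) by blast
  hence "card (N (L1 \<union> L2) \<inter> N L3 - N ((L1 \<union> L2) \<inter> L3)) = 0" by (simp only: card.empty)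
  ultimately have "3 \<le> d ((L1 \<union> L2) \<union> L3)"
    using submod[OF LW(4,3)] P12(2) dL3 by linarith
  hence "3 \<le> d (K \<inter> J4)" unfolding KL .
  thus False using submod[OF KW(1) J4(1)] dK dK4 J4(3) by linarith
qed

text \<open>
  Such matroids are the restrictions of cotransversal matroids. The injection \<open>\<phi>\<close> allows the
  set system to use points outside \<open>E\<close>, which restriction to \<open>E\<close> hides.
\<close>
definition cotransversal :: "'a set \<Rightarrow> ('a set \<Rightarrow> bool) \<Rightarrow> bool" where
  "cotransversal E ind \<longleftrightarrow> (\<exists>(W :: nat set) (A :: nat \<Rightarrow> nat set) \<phi>.
     finite W \<and> (\<forall>w\<in>W. finite (A w)) \<and> inj_on \<phi> E \<and>
     (\<forall>X\<subseteq>E. ind X \<longleftrightarrow> avoidable W A (\<phi> ` X)))"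

text \<open>
  A subset of a six-element set, given by the six truth values of its membership conditions,
  is mapped to whether it belongs to a prescribed cycle space. Labelled copies of $M(K_4)$,
  $M(G_2)$ and $M(G_4)$ are described in this way.
\<close>
type_synonym pattern = "bool \<Rightarrow> bool \<Rightarrow> bool \<Rightarrow> bool \<Rightarrow> bool \<Rightarrow> bool \<Rightarrow> bool"

definition matches :: "pattern \<Rightarrow> 'a set set \<Rightarrow> 'a \<Rightarrow> 'a \<Rightarrow> 'a \<Rightarrow> 'a \<Rightarrow> 'a \<Rightarrow> 'a \<Rightarrow> bool" where
  "matches P \<D> a b c x y z \<longleftrightarrow> distinct [a, b, c, x, y, z] \<and>
     (\<forall>Z\<subseteq>{a, b, c, x, y, z}. Z \<in> \<D> \<longleftrightarrow> P (a \<in> Z) (b \<in> Z) (c \<in> Z) (x \<in> Z) (y \<in> Z) (z \<in> Z))"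

definition pattern_minor :: "pattern \<Rightarrow> 'a set \<Rightarrow> 'a set set \<Rightarrow> bool" where
  "pattern_minor P E \<C> \<longleftrightarrow> (\<exists>Y a b c x y z. Y \<subseteq> E \<and> {a, b, c, x, y, z} \<subseteq> E - Y \<and>
     matches P (minor_cycles \<C> Y {a, b, c, x, y, z}) a b c x y z)"

text \<open>
  Cycles meet three of the vertex stars of $K_4$ evenly, and hence the fourth: \<open>a\<close>, \<open>b\<close>, \<open>c\<close>
  are a basis and \<open>x = a + b\<close>, \<open>y = b + c\<close>, \<open>z = a + c\<close> as vectors over $GF(2)$.
\<close>
definition K4_parity :: pattern where
  "K4_parity a b c x y z \<longleftrightarrow> (a \<longleftrightarrow> (x \<noteq> z)) \<and> (b \<longleftrightarrow> (x \<noteq> y)) \<and> (c \<longleftrightarrow> (y \<noteq> z))"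

abbreviation "K4_at \<equiv> matches K4_parity"
abbreviation "K4_minor \<equiv> pattern_minor K4_parity"
lemmas K4_minor_iff = pattern_minor_def[of K4_parity]

lemma K4_at_iff:
  "K4_at \<D> a b c x y z \<longleftrightarrow> distinct [a, b, c, x, y, z] \<and>
     (\<forall>Z\<subseteq>{a, b, c, x, y, z}. Z \<in> \<D> \<longleftrightarrow> (a \<in> Z \<longleftrightarrow> ((x \<in> Z) \<noteq> (z \<in> Z))) \<and>
        (b \<in> Z \<longleftrightarrow> ((x \<in> Z) \<noteq> (y \<in> Z))) \<and> (c \<in> Z \<longleftrightarrow> ((y \<in> Z) \<noteq> (z \<in> Z))))"
  unfolding matches_def K4_parity_def ..

text \<open>
  Contracting an independent set \<open>Y\<close> amounts to deleting its points from all members of the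
  set system, so a minor on \<open>F\<close> is again described by a set system.
\<close>
lemma cotransversal_no_K4_minor:
  assumes C: "cycle_space E \<C>" and cot: "cotransversal E (cycle_free \<C>)"
  shows "\<not> K4_minor E \<C>"
proof
  assume "K4_minor E \<C>"
  then obtain Y0 a b c x y z where Y0: "Y0 \<subseteq> E" and F0: "{a, b, c, x, y, z} \<subseteq> E - Y0"
    and K0: "K4_at (minor_cycles \<C> Y0 {a, b, c, x, y, z}) a b c x y z"
    unfolding K4_minor_iff by (elim exE conjE)
  define F where "F = {a, b, c, x, y, z}"
  have "F \<inter> Y0 = {}" using F0 unfolding F_def by blast
  then obtain Y where Y: "Y \<subseteq> Y0" "cycle_free \<C> Y" "minor_cycles \<C> Y F = minor_cycles \<C> Y0 F"
    using minor_cycles_independent_contraction[OF C Y0] by blast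
  have FY: "F \<inter> Y = {}" "F \<subseteq> E" "Y \<subseteq> E" using F0 Y Y0 unfolding F_def by auto
  define \<D> where "\<D> = minor_cycles \<C> Y F"
  have K: "K4_at \<D> a b c x y z" using K0 Y(3) unfolding \<D>_def F_def by simp
  obtain W :: "nat set" and A :: "nat \<Rightarrow> nat set" and \<phi> where fin: "finite W" "\<forall>w\<in>W. finite (A w)"
    and inj: "inj_on \<phi> E" and rep: "\<forall>X\<subseteq>E. cycle_free \<C> X \<longleftrightarrow> avoidable W A (\<phi> ` X)"
    using cot unfolding cotransversal_def by (elim exE conjE)
  let ?A = "\<lambda>w. A w - \<phi> ` Y"
  have free: "avoidable W ?A (\<phi> ` X) \<longleftrightarrow> cycle_free \<D> X" if "X \<subseteq> F" for X
  proof -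
    have "avoidable W ?A (\<phi> ` X) \<longleftrightarrow> avoidable W A (\<phi> ` (X \<union> Y))"
      unfolding avoidable_def by (auto simp: image_Un)
    also have "\<dots> \<longleftrightarrow> cycle_free \<C> (X \<union> Y)"
    proof -
      have "X \<union> Y \<subseteq> E" using that FY(2,3) by simp
      thus ?thesis using rep by simp
    qed
    also have "\<dots> \<longleftrightarrow> cycle_free \<D> X"
      unfolding \<D>_def using cycle_free_minor_cycles[OF Y(2) FY(1) that] by simp
    finally show ?thesis .
  qed
  have dist: "distinct [a, b, c, x, y, z]" using K unfolding K4_at_iff by blast
  hence dist': "distinct [\<phi> a, \<phi> b, \<phi> c, \<phi> x, \<phi> y, \<phi> z]"
    using inj FY(2) unfolding F_def by (auto dest: inj_onD)
  have cyc: "Z \<in> \<D> \<longleftrightarrow> ((a \<in> Z) \<longleftrightarrow> ((x \<in> Z) \<noteq> (z \<in> Z))) \<and> ((b \<in> Z) \<longleftrightarrow> ((x \<in> Z) \<noteq> (y \<in> Z))) \<and>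
      ((c \<in> Z) \<longleftrightarrow> ((y \<in> Z) \<noteq> (z \<in> Z)))" if "Z \<subseteq> F" for Z
    using K that unfolding K4_at_iff F_def by blast
  have dep: "\<not> avoidable W ?A {\<phi> p, \<phi> q, \<phi> r}" if "{p, q, r} \<in> \<D>" "{p, q, r} \<subseteq> F" for p q r
    using free[OF that(2)] that(1) unfolding cycle_free_def by auto
  have ind: "avoidable W ?A {\<phi> p, \<phi> q, \<phi> r}"
    if "{p, q, r} \<subseteq> F" and *: "\<And>Z. Z \<subseteq> {p, q, r} \<Longrightarrow> Z \<in> \<D> \<Longrightarrow> p \<notin> Z \<and> q \<notin> Z \<and> r \<notin> Z" for p q r
  proof -
    have "cycle_free \<D> {p, q, r}" unfolding cycle_free_def using * by blast
    thus ?thesis using free[OF that(1)] by simp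
  qed
  have ind': "avoidable W ?A {\<phi> p, \<phi> q, \<phi> r}"
    if F: "{p, q, r} \<subseteq> F" and "F = {p, q, r, s, t, u}" "distinct [p, q, r, s, t, u]"
    and *: "\<And>Z. Z \<subseteq> F \<Longrightarrow> Z \<in> \<D> \<Longrightarrow> s \<notin> Z \<Longrightarrow> t \<notin> Z \<Longrightarrow> u \<notin> Z \<Longrightarrow> p \<notin> Z \<and> q \<notin> Z \<and> r \<notin> Z"
    for p q r s t u
  proof (rule ind[OF F])
    fix Z assume Z: "Z \<subseteq> {p, q, r}" "Z \<in> \<D>"
    hence "s \<notin> Z" "t \<notin> Z" "u \<notin> Z" using that(3) by auto
    thus "p \<notin> Z \<and> q \<notin> Z \<and> r \<notin> Z" by (rule *[OF subset_trans[OF Z(1) F] Z(2)])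
  qed
  show False
  proof (rule no_K4_in_set_system[OF fin(1) _ dist', of ?A])
    show "finite (A w - \<phi> ` Y)" if "w \<in> W" for w using fin(2) that by blast
    show "\<not> avoidable W ?A {\<phi> a, \<phi> b, \<phi> x}" by (rule dep) (use dist in \<open>auto simp: F_def cyc[unfolded F_def]\<close>)
    show "\<not> avoidable W ?A {\<phi> b, \<phi> c, \<phi> y}" by (rule dep) (use dist in \<open>auto simp: F_def cyc[unfolded F_def]\<close>)
    show "\<not> avoidable W ?A {\<phi> a, \<phi> c, \<phi> z}" by (rule dep) (use dist in \<open>auto simp: F_def cyc[unfolded F_def]\<close>)
    show "\<not> avoidable W ?A {\<phi> x, \<phi> y, \<phi> z}" by (rule dep) (use dist in \<open>auto simp: F_def cyc[unfolded F_def]\<close>)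
    show "avoidable W ?A {\<phi> a, \<phi> b, \<phi> c}" by (rule ind'[of a b c x y z]) (use dist in \<open>auto simp: F_def cyc[unfolded F_def]\<close>)
    show "avoidable W ?A {\<phi> a, \<phi> b, \<phi> y}" by (rule ind'[of a b y x c z]) (use dist in \<open>auto simp: F_def cyc[unfolded F_def]\<close>)
    show "avoidable W ?A {\<phi> a, \<phi> b, \<phi> z}" by (rule ind'[of a b z x y c]) (use dist in \<open>auto simp: F_def cyc[unfolded F_def]\<close>)
    show "avoidable W ?A {\<phi> b, \<phi> c, \<phi> x}" by (rule ind'[of b c x a y z]) (use dist in \<open>auto simp: F_def cyc[unfolded F_def]\<close>)
    show "avoidable W ?A {\<phi> b, \<phi> c, \<phi> z}" by (rule ind'[of b c z a y x]) (use dist in \<open>auto simp: F_def cyc[unfolded F_def]\<close>)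
    show "avoidable W ?A {\<phi> a, \<phi> c, \<phi> x}" by (rule ind'[of a c x b y z]) (use dist in \<open>auto simp: F_def cyc[unfolded F_def]\<close>)
    show "avoidable W ?A {\<phi> a, \<phi> c, \<phi> y}" by (rule ind'[of a c y x b z]) (use dist in \<open>auto simp: F_def cyc[unfolded F_def]\<close>)
    show "avoidable W ?A {\<phi> x, \<phi> y, \<phi> a}" by (rule ind'[of x y a b c z]) (use dist in \<open>auto simp: F_def cyc[unfolded F_def]\<close>)
    show "avoidable W ?A {\<phi> y, \<phi> z, \<phi> c}" by (rule ind'[of y z c a b x]) (use dist in \<open>auto simp: F_def cyc[unfolded F_def]\<close>)
    show "avoidable W ?A {\<phi> x, \<phi> z, \<phi> b}" by (rule ind'[of x z b a c y]) (use dist in \<open>auto simp: F_def cyc[unfolded F_def]\<close>)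
  qed
qed

section \<open>Gammoids and linkings\<close>

lemma (in wf_digraph) awalk_of_vertex_sequence:
  assumes "\<And>k. k < n \<Longrightarrow> a k \<in> arcs G \<and> tail G (a k) = g k \<and> head G (a k) = g (Suc k)" "g 0 \<in> verts G"
  shows "awalk (g 0) (map a [0..<n]) (g n)" "awalk_verts (g 0) (map a [0..<n]) = map g [0..<Suc n]"
proof -
  have "awalk (g 0) (map a [0..<n]) (g n) \<and> awalk_verts (g 0) (map a [0..<n]) = map g [0..<Suc n]"
    using assms
  proof (induction n arbitrary: a g)
    case 0
    thus ?case by (simp add: awalk_Nil_iff)
  next
    case (Suc n)
    let ?a = "\<lambda>k. a (Suc k)" and ?g = "\<lambda>k. g (Suc k)"
    have 0: "a 0 \<in> arcs G" "tail G (a 0) = g 0" "head G (a 0) = g (Suc 0)" using Suc.prems(1)[of 0] by auto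
    have "g (Suc 0) \<in> verts G" using 0 wellformed(2)[of "a 0"] by simp
    hence IH: "awalk (g (Suc 0)) (map ?a [0..<n]) (g (Suc n))"
      "awalk_verts (g (Suc 0)) (map ?a [0..<n]) = map ?g [0..<Suc n]"
      using Suc.IH[of ?a ?g] Suc.prems(1) by auto
    have upt: "map h [0..<Suc k] = h 0 # map (\<lambda>i. h (Suc i)) [0..<k]" for h :: "nat \<Rightarrow> 'z" and k
      by (simp add: upt_conv_Cons map_Suc_upt[symmetric] o_def del: upt_Suc)
    show ?case
      unfolding upt[of a] upt[of g "Suc n"] using IH 0 by (simp add: awalk_Cons_iff del: upt_Suc)
  qed
  thus "awalk (g 0) (map a [0..<n]) (g n)" "awalk_verts (g 0) (map a [0..<n]) = map g [0..<Suc n]" by auto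
qed

text \<open>
  The linkage lemma of Ingleton and Piff. Given disjoint paths, a vertex on a path is
  represented by its successor and every other vertex by itself; the starting vertices are
  successors of nothing. Conversely, following the representatives from a vertex of \<open>X\<close> never
  returns to an earlier vertex, as they are distinct and outside \<open>X\<close>, so it traces a path into
  \<open>T\<close>, and paths from different vertices of \<open>X\<close> do not meet.
\<close>
lemma linked_into_iff_avoidable:
  assumes fin: "fin_digraph D" and X: "X \<subseteq> verts D" and T: "T \<subseteq> verts D"
  shows "linked_into D X T \<longleftrightarrow>
    avoidable (verts D - T) (\<lambda>v. insert v (head D ` out_arcs D v)) X"
proof -
  interpret fin_digraph D by (rule fin)
  let ?N = "\<lambda>v. insert v (head D ` out_arcs D v)"
  show ?thesis
  proof
    assume "linked_into D X T"
    then obtain p t where pt0: "\<forall>x\<in>X. t x \<in> T \<and> apath x (p x) (t x)"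
      and dis: "\<forall>x\<in>X. \<forall>y\<in>X. x \<noteq> y \<longrightarrow> set (awalk_verts x (p x)) \<inter> set (awalk_verts y (p y)) = {}"
      unfolding linked_into_def by (elim exE conjE)
    have pt: "t x \<in> T" "apath x (p x) (t x)" if "x \<in> X" for x using pt0 that by auto
    define ws where "ws x = awalk_verts x (p x)" for x
    have dist: "distinct (ws x)" if "x \<in> X" for x using pt(2)[OF that] unfolding ws_def apath_def by blast
    have cas: "cas x (p x) (t x)" if "x \<in> X" for x using pt(2)[OF that] unfolding apath_def awalk_def by blast
    have sub: "set (p x) \<subseteq> arcs D" if "x \<in> X" for x using pt(2)[OF that] unfolding apath_def awalk_def by blast
    have ne: "ws x \<noteq> []" for x unfolding ws_def by simp
    have len: "length (ws x) = Suc (length (p x))" for x unfolding ws_def by (rule length_awalk_verts)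
    have hd: "ws x ! 0 = x" if "x \<in> X" for x
      using awhd_if_cas[OF cas[OF that]] ne[of x] unfolding ws_def by (simp add: hd_conv_nth)
    have last: "ws x ! length (p x) = t x" if "x \<in> X" for x
      using awlast_if_cas[OF cas[OF that]] ne[of x] len[of x] unfolding ws_def by (simp add: last_conv_nth)
    have tl: "ws x ! i = tail D (p x ! i)" if "i < length (p x)" for x i
      using that unfolding ws_def awalk_verts_conv by (auto simp: nth_append)
    have hdd: "ws x ! Suc i = head D (p x ! i)" if "i < length (p x)" "x \<in> X" for x i
      using that awalk_verts_conv'[OF cas[OF that(2)]] unfolding ws_def by (auto simp del: awalk_verts.simps)
    have same: "x = y \<and> i = j" if "x \<in> X" "y \<in> X" "i \<le> length (p x)" "j \<le> length (p y)" "ws x ! i = ws y ! j" for x y i j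
    proof -
      have i: "i < length (ws x)" "j < length (ws y)" using that len by auto
      have "x = y"
      proof (rule ccontr)
        assume "x \<noteq> y"
        hence "set (ws x) \<inter> set (ws y) = {}" using dis that unfolding ws_def by simp
        thus False using nth_mem[OF i(1)] nth_mem[OF i(2)] that(5) by auto
      qed
      thus ?thesis using i that dist[OF that(1)] by (simp add: nth_eq_iff_index_eq)
    qed
    define R where "R v u \<longleftrightarrow> (\<exists>x\<in>X. \<exists>i<length (p x). v = ws x ! i \<and> u = ws x ! Suc i)" for v u
    have R1: "u = u'" if h: "R v u" "R v u'" for v u u'
    proof -
      obtain x i where x: "x \<in> X" "i < length (p x)" "v = ws x ! i" "u = ws x ! Suc i"
        using h(1) unfolding R_def by blast
      obtain y j where y: "y \<in> X" "j < length (p y)" "v = ws y ! j" "u' = ws y ! Suc j"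
        using h(2) unfolding R_def by blast
      show ?thesis using same[of x y i j] x y by simp
    qed
    have R2: "v = v'" if h: "R v u" "R v' u" for v v' u
    proof -
      obtain x i where x: "x \<in> X" "i < length (p x)" "v = ws x ! i" "u = ws x ! Suc i"
        using h(1) unfolding R_def by blast
      obtain y j where y: "y \<in> X" "j < length (p y)" "v' = ws y ! j" "u = ws y ! Suc j"
        using h(2) unfolding R_def by blast
      show ?thesis using same[of x y "Suc i" "Suc j"] x y by simp
    qed
    have R3: "u \<in> ?N v" "u \<notin> X" if h: "R v u" for v u
    proof -
      obtain x i where x: "x \<in> X" "i < length (p x)" "v = ws x ! i" "u = ws x ! Suc i"
        using h unfolding R_def by blast
      have "p x ! i \<in> out_arcs D v" using sub[OF x(1)] x(2,3) tl[OF x(2)] nth_mem[OF x(2)] by auto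
      thus "u \<in> ?N v" using x hdd by blast
      show "u \<notin> X"
      proof
        assume uX: "u \<in> X"
        have "ws x ! Suc i = ws u ! 0" unfolding hd[OF uX] x(4)[symmetric] ..
        thus False using same[OF x(1) uX, of "Suc i" 0] x(2) by simp
      qed
    qed
    have R4: "\<exists>u. R v u" if "v \<notin> T" "x \<in> X" "i \<le> length (p x)" "v = ws x ! i" for v x i
    proof -
      have "i \<noteq> length (p x)" using that last pt(1) by auto
      thus ?thesis using that unfolding R_def by (intro exI[of _ "ws x ! Suc i"] bexI[of _ x] exI[of _ i]) auto
    qed
    define m where "m v = (if \<exists>u. R v u then SOME u. R v u else v)" for v
    have m1: "R v (m v)" if "\<exists>u. R v u" for v using someI_ex[OF that] that unfolding m_def by simp
    have m2: "m v = v" if "\<nexists>u. R v u" for v unfolding m_def by (rule if_not_P[OF that])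
    have off: "\<not> R v' v" if "v \<in> verts D - T" "\<nexists>u. R v u" for v v'
    proof
      assume "R v' v"
      then obtain x i where "x \<in> X" "i < length (p x)" "v = ws x ! Suc i" unfolding R_def by blast
      thus False using R4[of v x "Suc i"] that by auto
    qed
    have "inj_on m (verts D - T)"
    proof (rule inj_onI)
      fix v v' assume v: "v \<in> verts D - T" "v' \<in> verts D - T" "m v = m v'"
      show "v = v'"
      proof (cases "\<exists>u. R v u"; cases "\<exists>u. R v' u")
        assume "\<exists>u. R v u" "\<exists>u. R v' u"
        thus ?thesis using R2[OF m1 m1[of v', folded v(3)]] v(3) by simp
      next
        assume "\<exists>u. R v u" "\<nexists>u. R v' u"
        thus ?thesis using off[OF v(2)] m1[of v] m2[of v'] v(3) by simp
      next
        assume "\<nexists>u. R v u" "\<exists>u. R v' u"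
        thus ?thesis using off[OF v(1)] m1[of v'] m2[of v] v(3) by simp
      next
        assume n: "\<nexists>u. R v u" "\<nexists>u. R v' u"
        show ?thesis using trans[OF m2[OF n(1), symmetric] trans[OF v(3) m2[OF n(2)]]] .
      qed
    qed
    moreover have "m v \<in> ?N v - X" if v: "v \<in> verts D - T" for v
    proof (cases "\<exists>u. R v u")
      case True
      thus ?thesis using R3[OF m1[OF True]] by blast
    next
      case False
      have "v \<notin> X" using R4[of v v 0] hd[of v] v False by auto
      thus ?thesis using m2[OF False] by simp
    qed
    ultimately show "avoidable (verts D - T) ?N X" unfolding avoidable_def by blast
  next
    assume "avoidable (verts D - T) ?N X"
    then obtain m where inj: "inj_on m (verts D - T)" and m: "\<And>v. v \<in> verts D - T \<Longrightarrow> m v \<in> ?N v - X"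
      unfolding avoidable_def by blast
    have mV: "m v \<in> verts D" if "v \<in> verts D - T" for v
      using m[OF that] that by (auto simp: out_arcs_def)
    have cancel: "x = y \<and> i = j"
      if "x \<in> X" "y \<in> X" "(m ^^ i) x = (m ^^ j) y"
        "\<forall>k<i. (m ^^ k) x \<in> verts D - T" "\<forall>k<j. (m ^^ k) y \<in> verts D - T" for x y i j
      using that
    proof (induction i arbitrary: j)
      case 0
      show ?case
      proof (cases j)
        case (Suc j')
        hence "x = m ((m ^^ j') y)" "(m ^^ j') y \<in> verts D - T" using 0 by auto
        thus ?thesis using m[of "(m ^^ j') y"] 0(1) by auto
      qed (use 0 in simp)
    next
      case (Suc i)
      have i: "(m ^^ i) x \<in> verts D - T" using Suc.prems(4) by blast
      show ?case
      proof (cases j)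
        case 0
        thus ?thesis using m[OF i] Suc.prems(2,3) by auto
      next
        case (Suc j')
        hence j: "(m ^^ j') y \<in> verts D - T" using Suc.prems(5) by blast
        have "(m ^^ i) x = (m ^^ j') y" using inj_onD[OF inj _ i j] Suc.prems(3) Suc by simp
        thus ?thesis using Suc.IH[of j'] Suc.prems Suc by auto
      qed
    qed
    have reach: "\<exists>n. (m ^^ n) x \<in> T" if x: "x \<in> X" for x
    proof (rule ccontr)
      assume no: "\<nexists>n. (m ^^ n) x \<in> T"
      have V: "(m ^^ n) x \<in> verts D - T" for n
      proof (induction n)
        case 0 thus ?case using x X no[simplified, rule_format, of 0] by auto
      next
        case (Suc n)
        have "(m ^^ Suc n) x \<notin> T" using no by blast
        thus ?case using mV[OF Suc] by simp
      qed
      have "inj (\<lambda>n. (m ^^ n) x)" using cancel[OF x x] V by (intro injI) blast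
      moreover have "finite (range (\<lambda>n. (m ^^ n) x))"
        by (rule finite_subset[OF _ finite_verts]) (use V in auto)
      ultimately show False using finite_imageD infinite_UNIV_nat by blast
    qed
    define n where "n x = (LEAST n. (m ^^ n) x \<in> T)" for x
    have nT: "(m ^^ n x) x \<in> T" if "x \<in> X" for x unfolding n_def using LeastI_ex[OF reach[OF that]] .
    have nV: "(m ^^ k) x \<in> verts D - T" if "x \<in> X" "k < n x" for x k
      using that(2)
    proof (induction k)
      case 0 thus ?case using that(1) X not_less_Least[of 0] unfolding n_def by fastforce
    next
      case (Suc k)
      hence "m ((m ^^ k) x) \<in> verts D" using mV by simp
      moreover have "(m ^^ Suc k) x \<notin> T" using not_less_Least Suc.prems unfolding n_def by blast
      ultimately show ?case by simp
    qed
    have same: "x = y \<and> i = j" if "x \<in> X" "y \<in> X" "(m ^^ i) x = (m ^^ j) y" "i \<le> n x" "j \<le> n y" for x y i j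
      using cancel[OF that(1,2,3)] nV[OF that(1)] nV[OF that(2)] that(4,5) by auto
    define a where "a v = (SOME e. e \<in> arcs D \<and> tail D e = v \<and> head D e = m v)" for v
    have a: "a ((m ^^ k) x) \<in> arcs D \<and> tail D (a ((m ^^ k) x)) = (m ^^ k) x \<and> head D (a ((m ^^ k) x)) = (m ^^ Suc k) x"
      if "x \<in> X" "k < n x" for x k
    proof -
      let ?v = "(m ^^ k) x"
      have "m ?v \<noteq> ?v" using same[of x x "Suc k" k] that by auto
      hence "\<exists>e. e \<in> arcs D \<and> tail D e = ?v \<and> head D e = m ?v"
        using m[OF nV[OF that]] by (auto simp: out_arcs_def)
      from someI_ex[OF this] show ?thesis unfolding a_def by simp
    qed
    define p where "p x = map (\<lambda>k. a ((m ^^ k) x)) [0..<n x]" for x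
    have p: "awalk x (p x) ((m ^^ n x) x)" "awalk_verts x (p x) = map (\<lambda>k. (m ^^ k) x) [0..<Suc (n x)]"
      if "x \<in> X" for x
      using awalk_of_vertex_sequence[of "n x" "\<lambda>k. a ((m ^^ k) x)" "\<lambda>k. (m ^^ k) x", OF a[OF that]] that X
      unfolding p_def by auto
    show "linked_into D X T"
      unfolding linked_into_def
    proof (intro exI conjI ballI impI)
      fix x assume x: "x \<in> X"
      show "(m ^^ n x) x \<in> T" by (rule nT[OF x])
      have "inj_on (\<lambda>k. (m ^^ k) x) {0..<Suc (n x)}"
        using same[OF x x] by (intro inj_onI) auto
      thus "apath x (p x) ((m ^^ n x) x)"
        unfolding apath_def p(2)[OF x] using p(1)[OF x] by (simp add: distinct_map del: upt_Suc)
    next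
      fix x y assume xy: "x \<in> X" "y \<in> X" "x \<noteq> y"
      show "set (awalk_verts x (p x)) \<inter> set (awalk_verts y (p y)) = {}"
        unfolding p(2)[OF xy(1)] p(2)[OF xy(2)] using same[OF xy(1,2)] xy(3)
        by (auto simp: less_Suc_eq_le simp del: upt_Suc)
    qed
  qed
qed

text \<open>
  To turn a set system into a digraph, fix a system \<open>m0\<close> of distinct representatives, which
  exists because the empty set is independent. The index \<open>w\<close> becomes the vertex \<open>m0 w\<close> with
  arcs to all of \<open>A w\<close>, and \<open>T\<close> consists of the vertices that are not representatives. The arc
  from \<open>i\<close> to \<open>j\<close> is the code of the pair \<open>(i, j)\<close>.
\<close>
lemma gammoid_iff_cotransversal:
  assumes "is_matroid M"
  shows "gammoid M \<longleftrightarrow> cotransversal (ground M) (\<lambda>X. X \<in> indeps M)"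
proof
  assume "gammoid M"
  then obtain D :: "(nat, nat) pre_digraph" and T \<phi> where D: "fin_digraph D" "T \<subseteq> verts D" "inj_on \<phi> (ground M)"
    "\<phi> ` ground M \<subseteq> verts D" "indeps M = {X. X \<subseteq> ground M \<and> linked_into D (\<phi> ` X) T}"
    unfolding gammoid_def by (elim conjE exE)
  interpret fin_digraph D by (rule D(1))
  let ?N = "\<lambda>v. insert v (head D ` out_arcs D v)"
  have "X \<in> indeps M \<longleftrightarrow> avoidable (verts D - T) ?N (\<phi> ` X)" if "X \<subseteq> ground M" for X
  proof -
    have "\<phi> ` X \<subseteq> verts D" using that D(4) by blast
    thus ?thesis using linked_into_iff_avoidable[OF D(1) _ D(2)] D(5) that by simp
  qed
  thus "cotransversal (ground M) (\<lambda>X. X \<in> indeps M)"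
    unfolding cotransversal_def using D(3)
    by (intro exI[of _ "verts D - T"] exI[of _ ?N] exI[of _ \<phi>]) auto
next
  assume "cotransversal (ground M) (\<lambda>X. X \<in> indeps M)"
  then obtain W :: "nat set" and A :: "nat \<Rightarrow> nat set" and \<phi> where W: "finite W" "\<forall>w\<in>W. finite (A w)"
    "inj_on \<phi> (ground M)" "\<forall>X\<subseteq>ground M. X \<in> indeps M \<longleftrightarrow> avoidable W A (\<phi> ` X)"
    unfolding cotransversal_def by (elim conjE exE)
  have fin: "finite (ground M)" and sub: "indeps M \<subseteq> Pow (ground M)" and em: "{} \<in> indeps M"
    using assms unfolding is_matroid_def by blast+
  have "avoidable W A {}" using W(4) em by force
  then obtain m0 where m0: "inj_on m0 W" "\<forall>w\<in>W. m0 w \<in> A w" unfolding avoidable_def by auto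
  define V where "V = \<phi> ` ground M \<union> \<Union>(A ` W)"
  define T where "T = V - m0 ` W"
  define D :: "(nat, nat) pre_digraph" where
    "D = \<lparr>verts = V, arcs = (\<Union>w\<in>W. (\<lambda>u. prod_encode (m0 w, u)) ` A w),
      tail = fst \<circ> prod_decode, head = snd \<circ> prod_decode\<rparr>"
  have m0V: "m0 ` W \<subseteq> V" unfolding V_def using m0(2) by blast
  have VT: "verts D - T = m0 ` W" unfolding T_def D_def using m0V by auto
  have "finite V" unfolding V_def using fin W(1,2) by auto
  hence D: "fin_digraph D"
    using W(1,2) m0V by unfold_locales (auto simp: D_def V_def)
  have N: "insert (m0 w) (head D ` out_arcs D (m0 w)) = A w" if "w \<in> W" for w
  proof -
    have "head D ` out_arcs D (m0 w) = A w"
    proof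
      show "head D ` out_arcs D (m0 w) \<subseteq> A w"
      proof
        fix u assume "u \<in> head D ` out_arcs D (m0 w)"
        then obtain w' where w': "w' \<in> W" "m0 w' = m0 w" "u \<in> A w'"
          unfolding out_arcs_def D_def by auto
        thus "u \<in> A w" using inj_onD[OF m0(1) w'(2,1) that] by simp
      qed
      show "A w \<subseteq> head D ` out_arcs D (m0 w)"
      proof
        fix u assume "u \<in> A w"
        hence "prod_encode (m0 w, u) \<in> out_arcs D (m0 w)" "head D (prod_encode (m0 w, u)) = u"
          using that unfolding out_arcs_def D_def by auto
        thus "u \<in> head D ` out_arcs D (m0 w)" by (metis imageI)
      qed
    qed
    thus ?thesis using m0(2) that by auto
  qed
  have "linked_into D (\<phi> ` X) T \<longleftrightarrow> X \<in> indeps M" if "X \<subseteq> ground M" for X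
  proof -
    have "\<phi> ` X \<subseteq> verts D" "T \<subseteq> verts D" using that unfolding D_def V_def T_def by auto
    from linked_into_iff_avoidable[OF D this]
    have "linked_into D (\<phi> ` X) T \<longleftrightarrow> avoidable W (\<lambda>w. insert (m0 w) (head D ` out_arcs D (m0 w))) (\<phi> ` X)"
      unfolding VT avoidable_image[OF m0(1)] .
    also have "\<dots> \<longleftrightarrow> avoidable W A (\<phi> ` X)" by (rule avoidable_cong) (auto simp: N simp del: insert_iff)
    finally show ?thesis using W(4) that by simp
  qed
  hence "indeps M = {X. X \<subseteq> ground M \<and> linked_into D (\<phi> ` X) T}" using sub by auto
  moreover have "T \<subseteq> verts D" "\<phi> ` ground M \<subseteq> verts D" unfolding D_def V_def T_def by auto
  ultimately show "gammoid M"
    unfolding gammoid_def using assms D W(3) by blast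
qed

section \<open>One-element extensions of cotransversal matroids\<close>

lemma cotransversal_cong:
  assumes "\<And>X. X \<subseteq> E \<Longrightarrow> ind X \<longleftrightarrow> ind' X"
  shows "cotransversal E ind \<longleftrightarrow> cotransversal E ind'"
  unfolding cotransversal_def using assms by (intro ex_cong1 conj_cong refl all_cong1 imp_cong) simp

text \<open>
  Fresh points and a fresh index for enlarging a presentation by one element.
\<close>
lemma cotransversal_extend:
  fixes ind' :: "'a set \<Rightarrow> bool"
  assumes E: "finite E" and cot: "cotransversal E' ind'" and E': "E' \<subseteq> E"
  shows "\<exists>(W :: nat set) (A :: nat \<Rightarrow> nat set) (\<phi> :: 'a \<Rightarrow> nat) w0 v0 v1.
    finite W \<and> (\<forall>w\<in>W. finite (A w)) \<and> inj_on \<phi> E' \<and>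
    (\<forall>X\<subseteq>E'. ind' X \<longleftrightarrow> avoidable W A (\<phi> ` X)) \<and>
    w0 \<notin> W \<and> v0 \<noteq> v1 \<and> v0 \<notin> \<phi> ` E' \<and> v1 \<notin> \<phi> ` E' \<and> v0 \<notin> \<Union>(A ` W) \<and> v1 \<notin> \<Union>(A ` W)"
proof -
  obtain W :: "nat set" and A :: "nat \<Rightarrow> nat set" and \<phi> :: "'a \<Rightarrow> nat"
    where W: "finite W" "\<forall>w\<in>W. finite (A w)" "inj_on \<phi> E'" "\<forall>X\<subseteq>E'. ind' X \<longleftrightarrow> avoidable W A (\<phi> ` X)"
    using cot unfolding cotransversal_def by (elim conjE exE)
  define S where "S = \<phi> ` E' \<union> \<Union>(A ` W)"
  have fin: "finite S" unfolding S_def using W finite_subset[OF E' E] by auto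
  obtain w0 where w0: "w0 \<notin> W" using ex_new_if_finite[OF infinite_UNIV_nat W(1)] by blast
  obtain v0 where v0: "v0 \<notin> S" using ex_new_if_finite[OF infinite_UNIV_nat fin] by blast
  have "finite (insert v0 S)" using fin by simp
  then obtain v1 where v1: "v1 \<notin> insert v0 S" using ex_new_if_finite[OF infinite_UNIV_nat] by blast
  show ?thesis
    by (rule exI[of _ W], rule exI[of _ A], rule exI[of _ \<phi>], rule exI[of _ w0], rule exI[of _ v0], rule exI[of _ v1])
      (use W w0 v0 v1 in \<open>auto simp: S_def\<close>)
qed

lemma cotransversal_add_coloop:
  assumes E: "finite E" and cot: "cotransversal (E - {e}) ind'"
    and ind: "\<And>X. X \<subseteq> E \<Longrightarrow> ind X \<longleftrightarrow> ind' (X - {e})"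
  shows "cotransversal E ind"
proof -
  obtain W :: "nat set" and A and \<phi> :: "'a \<Rightarrow> nat" and w0 v0 v1 where W: "finite W" "\<forall>w\<in>W. finite (A w)" "inj_on \<phi> (E - {e})"
    "\<forall>X\<subseteq>E - {e}. ind' X \<longleftrightarrow> avoidable W A (\<phi> ` X)"
    "w0 \<notin> W" "v0 \<noteq> v1" "v0 \<notin> \<phi> ` (E - {e})" "v1 \<notin> \<phi> ` (E - {e})" "v0 \<notin> \<Union>(A ` W)" "v1 \<notin> \<Union>(A ` W)"
    using cotransversal_extend[OF E cot Diff_subset] by (elim exE conjE)
  let ?\<phi> = "\<phi>(e := v0)"
  have "inj_on ?\<phi> E" using W(3,7) by (auto simp: inj_on_def)
  moreover have "ind X \<longleftrightarrow> avoidable W A (?\<phi> ` X)" if X: "X \<subseteq> E" for X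
  proof -
    have "X - {e} \<subseteq> E - {e}" using X by blast
    hence "ind X \<longleftrightarrow> avoidable W A (\<phi> ` (X - {e}))" using ind[OF X] W(4) by simp
    also have "\<dots> \<longleftrightarrow> avoidable W A (?\<phi> ` X)"
      by (rule avoidable_cong) (use W(9) in auto)
    finally show ?thesis .
  qed
  ultimately show ?thesis unfolding cotransversal_def using W(1,2) by blast
qed

text \<open>
  The new point is the only one in a new member of the system, so it has to be its
  representative.
\<close>
lemma cotransversal_add_loop:
  assumes E: "finite E" and cot: "cotransversal (E - {e}) ind'"
    and ind: "\<And>X. X \<subseteq> E \<Longrightarrow> ind X \<longleftrightarrow> e \<notin> X \<and> ind' X"
  shows "cotransversal E ind"
proof -
  obtain W :: "nat set" and A and \<phi> :: "'a \<Rightarrow> nat" and w0 v0 v1 where W: "finite W" "\<forall>w\<in>W. finite (A w)" "inj_on \<phi> (E - {e})"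
    "\<forall>X\<subseteq>E - {e}. ind' X \<longleftrightarrow> avoidable W A (\<phi> ` X)"
    "w0 \<notin> W" "v0 \<noteq> v1" "v0 \<notin> \<phi> ` (E - {e})" "v1 \<notin> \<phi> ` (E - {e})" "v0 \<notin> \<Union>(A ` W)" "v1 \<notin> \<Union>(A ` W)"
    using cotransversal_extend[OF E cot Diff_subset] by (elim exE conjE)
  let ?\<phi> = "\<phi>(e := v0)" and ?A = "A(w0 := {v0})"
  have "inj_on ?\<phi> E" using W(3,7) by (auto simp: inj_on_def)
  moreover have "ind X \<longleftrightarrow> avoidable (insert w0 W) ?A (?\<phi> ` X)" if X: "X \<subseteq> E" for X
  proof -
    have v0: "v0 \<in> ?\<phi> ` X \<longleftrightarrow> e \<in> X" using W(7) X by (auto split: if_splits)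
    have "avoidable (insert w0 W) ?A (?\<phi> ` X) \<longleftrightarrow>
        v0 \<notin> ?\<phi> ` X \<and> avoidable W ?A (insert v0 (?\<phi> ` X))"
      unfolding avoidable_insert[OF W(5)] by auto
    also have "\<dots> \<longleftrightarrow> e \<notin> X \<and> avoidable W ?A (insert v0 (?\<phi> ` X))" by (simp only: v0)
    also have "\<dots> \<longleftrightarrow> e \<notin> X \<and> avoidable W A (\<phi> ` X)"
    proof (rule conj_cong[OF refl])
      assume "e \<notin> X"
      thus "avoidable W ?A (insert v0 (?\<phi> ` X)) \<longleftrightarrow> avoidable W A (\<phi> ` X)"
        by (intro avoidable_cong) (use W(5,9) in auto)
    qed
    also have "\<dots> \<longleftrightarrow> ind X"
    proof -
      have "X \<subseteq> E - {e}" if "e \<notin> X" using that X by blast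
      thus ?thesis using ind[OF X] W(4)[rule_format, of X] by blast
    qed
    finally show ?thesis ..
  qed
  moreover have "finite (insert w0 W)" "\<forall>w\<in>insert w0 W. finite (?A w)" using W(1,2) by auto
  ultimately show ?thesis unfolding cotransversal_def by blast
qed

text \<open>
  The new member consists of the point of \<open>f\<close> and a new point for \<open>e\<close>, and one of the two
  represents it. If \<open>e\<close> is to be avoided, then the point of \<open>f\<close> is used up, which has the same
  effect as avoiding \<open>f\<close>.
\<close>
lemma cotransversal_add_parallel:
  assumes E: "finite E" and ef: "e \<in> E" "f \<in> E" "e \<noteq> f" and cot: "cotransversal (E - {e}) ind'"
    and ind: "\<And>X. X \<subseteq> E \<Longrightarrow> ind X \<longleftrightarrow>
      \<not> (e \<in> X \<and> f \<in> X) \<and> ind' (if e \<in> X then insert f (X - {e}) else X)"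
  shows "cotransversal E ind"
proof -
  obtain W :: "nat set" and A and \<phi> :: "'a \<Rightarrow> nat" and w0 v0 v1 where W: "finite W" "\<forall>w\<in>W. finite (A w)" "inj_on \<phi> (E - {e})"
    "\<forall>X\<subseteq>E - {e}. ind' X \<longleftrightarrow> avoidable W A (\<phi> ` X)"
    "w0 \<notin> W" "v0 \<noteq> v1" "v0 \<notin> \<phi> ` (E - {e})" "v1 \<notin> \<phi> ` (E - {e})" "v0 \<notin> \<Union>(A ` W)" "v1 \<notin> \<Union>(A ` W)"
    using cotransversal_extend[OF E cot Diff_subset] by (elim exE conjE)
  let ?\<phi> = "\<phi>(e := v0)" and ?A = "A(w0 := {v0, \<phi> f})"
  have inj: "inj_on ?\<phi> E" using W(3,7) by (auto simp: inj_on_def)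
  moreover have "ind X \<longleftrightarrow> avoidable (insert w0 W) ?A (?\<phi> ` X)" if X: "X \<subseteq> E" for X
  proof -
    have v0: "v0 \<in> ?\<phi> ` X \<longleftrightarrow> e \<in> X" using inj_on_image_mem_iff[OF inj ef(1) X] by simp
    have vf: "\<phi> f \<in> ?\<phi> ` X \<longleftrightarrow> f \<in> X" using inj_on_image_mem_iff[OF inj ef(2) X] ef(3) by simp
    have A: "avoidable (insert w0 W) ?A (?\<phi> ` X) \<longleftrightarrow>
        (e \<notin> X \<and> avoidable W ?A (insert v0 (?\<phi> ` X))) \<or> (f \<notin> X \<and> avoidable W ?A (insert (\<phi> f) (?\<phi> ` X)))"
      unfolding avoidable_insert[OF W(5)] using v0 vf by (auto simp: Bex_def)
    have 0: "avoidable W ?A (insert v0 (?\<phi> ` X)) \<longleftrightarrow> avoidable W A (\<phi> ` X)" if "e \<notin> X"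
      by (rule avoidable_cong) (use W(5,9) that in auto)
    have 1: "avoidable W ?A (insert (\<phi> f) (?\<phi> ` X)) \<longleftrightarrow> avoidable W A (\<phi> ` (insert f (X - {e})))"
      by (rule avoidable_cong) (use W(5,9) in auto)
    show ?thesis
    proof (cases "e \<in> X")
      case True
      have "insert f (X - {e}) \<subseteq> E - {e}" using X ef by blast
      from W(4)[rule_format, OF this] show ?thesis unfolding A ind[OF X] 1 using True by simp
    next
      case False
      have "X \<subseteq> E - {e}" using X False by blast
      hence "ind X \<longleftrightarrow> avoidable W A (\<phi> ` X)" using W(4) ind[OF X] False by simp
      moreover have "avoidable W A (\<phi> ` (insert f (X - {e}))) \<Longrightarrow> avoidable W A (\<phi> ` X)"
        by (erule avoidable_mono) (use False in auto)
      ultimately show ?thesis unfolding A 1 using 0[OF False] False by blast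
    qed
  qed
  moreover have "finite (insert w0 W)" "\<forall>w\<in>insert w0 W. finite (?A w)" using W(1,2) by auto
  ultimately show ?thesis unfolding cotransversal_def by blast
qed

text \<open>
  The old point of \<open>f\<close> becomes hidden; \<open>e\<close> and \<open>f\<close> get new points, and a new member contains
  all three. As long as one of the new points is free it represents the new member, and the
  rest of the system is unaffected. Only if both are to be avoided does the hidden point
  represent it, which has the effect of avoiding \<open>f\<close> in the old system.
\<close>
lemma cotransversal_add_series:
  assumes E: "finite E" and ef: "e \<in> E" "f \<in> E" "e \<noteq> f" and cot: "cotransversal (E - {e}) ind'"
    and ind: "\<And>X. X \<subseteq> E \<Longrightarrow> ind X \<longleftrightarrow> ind' (if e \<in> X \<and> f \<in> X then X - {e} else X - {e, f})"
  shows "cotransversal E ind"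
proof -
  obtain W :: "nat set" and A and \<phi> :: "'a \<Rightarrow> nat" and w0 v0 v1 where W: "finite W" "\<forall>w\<in>W. finite (A w)" "inj_on \<phi> (E - {e})"
    "\<forall>X\<subseteq>E - {e}. ind' X \<longleftrightarrow> avoidable W A (\<phi> ` X)"
    "w0 \<notin> W" "v0 \<noteq> v1" "v0 \<notin> \<phi> ` (E - {e})" "v1 \<notin> \<phi> ` (E - {e})" "v0 \<notin> \<Union>(A ` W)" "v1 \<notin> \<Union>(A ` W)"
    using cotransversal_extend[OF E cot Diff_subset] by (elim exE conjE)
  let ?\<phi> = "\<phi>(e := v0, f := v1)" and ?A = "A(w0 := {\<phi> f, v0, v1})"
  have inj: "inj_on ?\<phi> E" using W(3,6,7,8) by (auto simp: inj_on_def)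
  moreover have "ind X \<longleftrightarrow> avoidable (insert w0 W) ?A (?\<phi> ` X)" if X: "X \<subseteq> E" for X
  proof -
    have v0: "v0 \<in> ?\<phi> ` X \<longleftrightarrow> e \<in> X" using inj_on_image_mem_iff[OF inj ef(1) X] ef(3) by simp
    have v1: "v1 \<in> ?\<phi> ` X \<longleftrightarrow> f \<in> X" using inj_on_image_mem_iff[OF inj ef(2) X] by simp
    have f: "f \<in> E - {e}" using ef by blast
    have nf: "\<phi> f \<noteq> v0" "\<phi> f \<noteq> v1" using W(7,8) f by auto
    have h: "\<phi> f \<notin> ?\<phi> ` X"
    proof
      assume "\<phi> f \<in> ?\<phi> ` X"
      then obtain x where x: "x \<in> X" "\<phi> f = ?\<phi> x" by blast
      have "?\<phi> e = v0" "?\<phi> f = v1" using ef(3) by simp_all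
      hence "x \<noteq> f" "x \<noteq> e" using nf x(2) by metis+
      thus False using x inj_onD[OF W(3), of f x] f X by auto
    qed
    have A: "avoidable (insert w0 W) ?A (?\<phi> ` X) \<longleftrightarrow>
        avoidable W ?A (insert (\<phi> f) (?\<phi> ` X)) \<or>
        (e \<notin> X \<and> avoidable W ?A (insert v0 (?\<phi> ` X))) \<or> (f \<notin> X \<and> avoidable W ?A (insert v1 (?\<phi> ` X)))"
      unfolding avoidable_insert[OF W(5)] using v0 v1 h by (auto simp: Bex_def)
    have 0: "avoidable W ?A (insert v0 (?\<phi> ` X)) \<longleftrightarrow> avoidable W A (\<phi> ` (X - {e, f}))"
      by (rule avoidable_cong) (use W(5,9,10) in auto)
    have 1: "avoidable W ?A (insert v1 (?\<phi> ` X)) \<longleftrightarrow> avoidable W A (\<phi> ` (X - {e, f}))"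
      by (rule avoidable_cong) (use W(5,9,10) in auto)
    have 2: "avoidable W ?A (insert (\<phi> f) (?\<phi> ` X)) \<longleftrightarrow> avoidable W A (\<phi> ` (insert f (X - {e})))"
      by (rule avoidable_cong) (use W(5,9,10) in auto)
    show ?thesis
    proof (cases "e \<in> X \<and> f \<in> X")
      case True
      hence "insert f (X - {e}) = X - {e}" using ef by blast
      moreover have "X - {e} \<subseteq> E - {e}" using X by blast
      ultimately show ?thesis unfolding A ind[OF X] 2 using True W(4)[rule_format, of "X - {e}"] by simp
    next
      case False
      have "X - {e, f} \<subseteq> E - {e}" using X by blast
      hence "ind X \<longleftrightarrow> avoidable W A (\<phi> ` (X - {e, f}))" using W(4) ind[OF X] False by simp
      moreover have "avoidable W A (\<phi> ` (insert f (X - {e}))) \<Longrightarrow> avoidable W A (\<phi> ` (X - {e, f}))"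
        by (erule avoidable_mono) auto
      ultimately show ?thesis unfolding A 0 1 2 using False by blast
    qed
  qed
  moreover have "finite (insert w0 W)" "\<forall>w\<in>insert w0 W. finite (?A w)" using W(1,2) by auto
  ultimately show ?thesis unfolding cotransversal_def by blast
qed

section \<open>Pendant vertices and twins in bipartite graphs\<close>

text \<open>
  A six-cycle \<open>v a z b w x\<close> with the chord \<open>xz\<close>. In a bipartite graph the non-edges not listed
  hold because the two vertices lie on the same side.
\<close>
definition domino :: "('a \<Rightarrow> 'a \<Rightarrow> bool) \<Rightarrow> 'a \<Rightarrow> 'a \<Rightarrow> 'a \<Rightarrow> 'a \<Rightarrow> 'a \<Rightarrow> 'a \<Rightarrow> bool" where
  "domino adj v a z b w x \<longleftrightarrow> adj v a \<and> adj v x \<and> \<not> adj v b \<and> adj w x \<and> adj w b \<and> \<not> adj w a \<and>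
     adj z a \<and> adj z b \<and> adj z x"

text \<open>
  An induced cycle of length \<open>m + 2 \<ge> 6\<close>, given as an induced path \<open>p 0, \<dots>, p m\<close> and a further
  vertex \<open>v\<close> that is adjacent to its two ends only.
\<close>
definition hole :: "('a \<Rightarrow> 'a \<Rightarrow> bool) \<Rightarrow> 'a \<Rightarrow> (nat \<Rightarrow> 'a) \<Rightarrow> nat \<Rightarrow> bool" where
  "hole adj v p m \<longleftrightarrow> 4 \<le> m \<and> even m \<and> inj_on p {..m} \<and> v \<notin> p ` {..m} \<and>
     (\<forall>i\<le>m. \<forall>j\<le>m. adj (p i) (p j) \<longleftrightarrow> j = Suc i \<or> i = Suc j) \<and>
     (\<forall>i\<le>m. adj v (p i) \<longleftrightarrow> i = 0 \<or> i = m)"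

text \<open>
  A repeated vertex or a chord would give a shortcut in a walk of least length.
\<close>
lemma shortest_walk_is_induced_path:
  assumes sym: "\<And>x y. adj x y \<Longrightarrow> adj y x" and irr: "\<And>x. \<not> adj x x"
    and conn: "(x, y) \<in> {(s, t). adj s t \<and> s \<in> L \<and> t \<in> L}\<^sup>*"
  shows "\<exists>p m. p 0 = x \<and> p m = y \<and> (\<forall>i<m. p i \<in> L \<and> p (Suc i) \<in> L) \<and> inj_on p {..m} \<and>
    (\<forall>i\<le>m. \<forall>j\<le>m. adj (p i) (p j) \<longleftrightarrow> j = Suc i \<or> i = Suc j)"
proof -
  let ?S = "{(s, t). adj s t \<and> s \<in> L \<and> t \<in> L}"
  define W where "W m p \<longleftrightarrow> p 0 = x \<and> p m = y \<and> (\<forall>i<m. (p i, p (Suc i)) \<in> ?S)" for m :: nat and p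
  have "\<exists>m. \<exists>p. W m p"
    using conn unfolding rtrancl_power relpow_fun_conv W_def by auto
  hence W0: "\<exists>p. W (LEAST m. \<exists>p. W m p) p" by (rule LeastI_ex)
  define m where "m = (LEAST m. \<exists>p. W m p)"
  obtain p where p: "W m p" using W0 unfolding m_def by blast
  have least: "m \<le> n" if "W n q" for n q unfolding m_def by (rule Least_le) (use that in blast)
  have step: "(p i, p (Suc i)) \<in> ?S" if "i < m" for i using p that unfolding W_def by blast
  have ends: "p 0 = x" "p m = y" using p unfolding W_def by blast+
  have inj: "p i \<noteq> p j" if "i < j" "j \<le> m" for i j
  proof
    assume eq: "p i = p j"
    define q where "q t = (if t \<le> i then p t else p (t + (j - i)))" for t
    have "W (m - (j - i)) q" unfolding W_def
    proof (intro conjI allI impI)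
      show "q 0 = x" unfolding q_def using ends by simp
      show "q (m - (j - i)) = y"
        unfolding q_def using that ends eq by (cases "j = m") auto
      fix t assume t: "t < m - (j - i)"
      show "(q t, q (Suc t)) \<in> ?S"
      proof (cases "t < i")
        case True thus ?thesis unfolding q_def using step[of t] that by simp
      next
        case False
        have "q t = p (t + (j - i))" unfolding q_def using False eq that by (cases "t = i") auto
        moreover have "q (Suc t) = p (Suc (t + (j - i)))" unfolding q_def using False by simp
        moreover have "t + (j - i) < m" using t by simp
        ultimately show ?thesis using step by simp
      qed
    qed
    from least[OF this] show False using that by simp
  qed
  have chord: "\<not> adj (p i) (p j)" if "Suc i < j" "j \<le> m" for i j
  proof
    assume adj: "adj (p i) (p j)"
    have iL: "p i \<in> L" using step[of i] that by simp
    have jL: "p j \<in> L" using step[of "j - 1"] that by simp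
    define d where "d = j - Suc i"
    have d: "0 < d" "j = Suc i + d" unfolding d_def using that by auto
    define q where "q t = (if t \<le> i then p t else p (t + d))" for t
    have "W (m - d) q" unfolding W_def
    proof (intro conjI allI impI)
      show "q 0 = x" unfolding q_def using ends by simp
      have "\<not> m - d \<le> i" "m - d + d = m" using d that by auto
      thus "q (m - d) = y" unfolding q_def using ends by simp
      fix t assume t: "t < m - d"
      show "(q t, q (Suc t)) \<in> ?S"
      proof (cases "t < i")
        case True thus ?thesis unfolding q_def using step[of t] that by simp
      next
        case False
        show ?thesis
        proof (cases "t = i")
          case True
          hence "q t = p i" "q (Suc t) = p j" unfolding q_def using d by simp_all
          thus ?thesis using adj iL jL by simp
        next
          case neq: False
          thus ?thesis unfolding q_def using False step[of "t + d"] t by simp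
        qed
      qed
    qed
    from least[OF this] show False using d that by simp
  qed
  have "inj_on p {..m}"
  proof (rule inj_onI)
    fix i j assume ij: "i \<in> {..m}" "j \<in> {..m}" "p i = p j"
    show "i = j" using inj[of i j] inj[of j i] ij by (cases i j rule: linorder_cases) auto
  qed
  moreover have "adj (p i) (p j) \<longleftrightarrow> j = Suc i \<or> i = Suc j" if "i \<le> m" "j \<le> m" for i j
  proof -
    have s1: "adj (p i) (p (Suc i))" if "i < m" for i using step[OF that] by simp
    show ?thesis
    proof (cases i j rule: linorder_cases)
      case less
      show ?thesis
      proof (cases "j = Suc i")
        case True thus ?thesis using s1[of i] that by simp
      next
        case False thus ?thesis using chord[of i j] that less by simp
      qed
    next
      case equal thus ?thesis using irr by simp
    next
      case greater
      show ?thesis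
      proof (cases "i = Suc j")
        case True thus ?thesis using sym[OF s1[of j]] that by simp
      next
        case False thus ?thesis using chord[of j i] sym[of "p i" "p j"] that greater by auto
      qed
    qed
  qed
  ultimately show ?thesis
    using ends step by (intro exI[of _ p] exI[of _ m] conjI) auto
qed

text \<open>
  After Bandelt and Mulder's work on distance-hereditary graphs. Arrange the component of a
  vertex \<open>u\<close> in levels by the distance from \<open>u\<close>. Two facts suffice. First, two vertices of one
  level with a common neighbour in the next level have the same neighbours in the previous
  level: otherwise either they share some lower neighbour, and a domino appears, or a shortest
  path between them through lower levels closes to a hole. Second, if two vertices of the last
  level have a common neighbour, then one neighbourhood contains the other, again because of
  dominoes. Now take a vertex \<open>v\<close> of the last level with the fewest neighbours. It is pendant,
  or any two of its neighbours are twins.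
\<close>
lemma bipartite_pendant_or_twins:
  fixes adj :: "'a \<Rightarrow> 'a \<Rightarrow> bool" and side :: "'a \<Rightarrow> bool"
  assumes fin: "finite V" and ne: "V \<noteq> {}" and V: "\<And>x y. adj x y \<Longrightarrow> x \<in> V \<and> y \<in> V"
    and sym: "\<And>x y. adj x y \<Longrightarrow> adj y x" and bip: "\<And>x y. adj x y \<Longrightarrow> side x \<noteq> side y"
    and no_domino: "\<And>v a z b w x. \<not> domino adj v a z b w x"
    and no_hole: "\<And>v p m. \<not> hole adj v p m"
  shows "\<exists>x\<in>V. (\<forall>y. \<not> adj x y) \<or> (\<exists>y. \<forall>z. adj x z \<longleftrightarrow> z = y) \<or>
    (\<exists>y. y \<noteq> x \<and> (\<exists>z. adj x z) \<and> (\<forall>z. adj x z \<longleftrightarrow> adj y z))"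
proof (rule ccontr)
  assume contra: "\<not> ?thesis"
  obtain u where u: "u \<in> V" using ne by blast
  have irr: "\<not> adj x x" for x using bip by blast
  let ?R = "{(x, y). adj x y}"
  define C where "C = {x. (u, x) \<in> ?R\<^sup>*}"
  define l where "l x = (LEAST n. (u, x) \<in> ?R ^^ n)" for x
  have uC: "u \<in> C" unfolding C_def by simp
  have lR: "(u, x) \<in> ?R ^^ l x" if "x \<in> C" for x
  proof -
    have "\<exists>n. (u, x) \<in> ?R ^^ n" using that unfolding C_def rtrancl_power by simp
    thus ?thesis unfolding l_def by (rule LeastI_ex)
  qed
  have l_le: "l x \<le> n" if "(u, x) \<in> ?R ^^ n" for x n unfolding l_def using that by (rule Least_le)
  have C_adj: "y \<in> C" if "x \<in> C" "adj x y" for x y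
    using that unfolding C_def by (auto intro: rtrancl_into_rtrancl)
  have l_Suc: "l y \<le> Suc (l x)" if "x \<in> C" "adj x y" for x y
    by (rule l_le) (use lR[OF that(1)] that(2) in auto)
  have parity: "side x \<longleftrightarrow> (side u \<longleftrightarrow> even n)" if "(u, x) \<in> ?R ^^ n" for x n
    using that
  proof (induction n arbitrary: x)
    case (Suc n)
    then obtain y where y: "(u, y) \<in> ?R ^^ n" "adj y x" by auto
    show ?case using Suc.IH[OF y(1)] bip[OF y(2)] by auto
  qed simp
  have level: "l y = Suc (l x) \<or> l x = Suc (l y)" if "x \<in> C" "adj x y" for x y
  proof -
    have y: "y \<in> C" using C_adj that by blast
    have "l x \<noteq> l y" using bip[OF that(2)] parity[OF lR[OF that(1)]] parity[OF lR[OF y]] by auto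
    thus ?thesis using l_Suc[OF that] l_Suc[OF y sym[OF that(2)]] by linarith
  qed
  have l0: "x = u" if "x \<in> C" "l x = 0" for x using lR[OF that(1)] that(2) by simp
  have lu: "l u = 0" using l_le[of u 0] by simp
  have down: "\<exists>y\<in>C. adj x y \<and> l y = n" if h: "x \<in> C" "l x = Suc n" for x n
  proof -
    obtain y where y: "(u, y) \<in> ?R ^^ n" "adj y x" using lR[OF h(1)] h(2) by auto
    have yC: "y \<in> C" unfolding C_def using relpow_imp_rtrancl[OF y(1)] by simp
    have "l y \<le> n" using l_le[OF y(1)] .
    moreover have "Suc n \<le> Suc (l y)" using l_Suc[OF yC y(2)] h(2) by simp
    ultimately show ?thesis using yC sym[OF y(2)] by (intro bexI[of _ y]) auto
  qed
  have common: "adj y z"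
    if "x \<in> C" "y \<in> C" "adj v x" "adj v y" "adj x z" "l z = n" "l x = Suc n" "l y = Suc n" "l v = Suc (Suc n)"
    for x y z v n
    using that
  proof (induction n arbitrary: x y z v rule: less_induct)
    case (less n)
    have zC: "z \<in> C" using C_adj less.prems by blast
    have vC: "v \<in> C" using C_adj[OF less.prems(1)] sym less.prems(3) by blast
    show ?case
    proof (rule ccontr)
      assume nyz: "\<not> adj y z"
      have xy: "x \<noteq> y" using nyz less.prems(5) by blast
      show False
      proof (cases "\<exists>z'. adj x z' \<and> adj y z' \<and> l z' = n")
        case True
        then obtain z' where z': "adj x z'" "adj y z'" "l z' = n" by blast
        have z'C: "z' \<in> C" using C_adj less.prems(1) z'(1) by blast
        show False
        proof (cases n)
          case 0
          thus False using l0[OF zC] l0[OF z'C] z' nyz less.prems(6) by simp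
        next
          case (Suc k)
          obtain t where t: "t \<in> C" "adj z t" "l t = k" using down[OF zC] less.prems(6) Suc by blast
          \<comment> \<open>One level below, \<open>z\<close> and \<open>z'\<close> have the common neighbour \<open>x\<close>.\<close>
          have "adj z' t"
            using less.IH[of k z z' x t] zC z'C less.prems z' t Suc by simp
          moreover have "\<not> adj v t" using level[OF vC, of t] less.prems(9) t(3) Suc by auto
          ultimately have "domino adj z t z' y v x"
            unfolding domino_def using sym t z' less.prems nyz by blast
          thus False using no_domino by blast
        qed
      next
        case no: False
        \<comment> \<open>All lower levels are connected through \<open>u\<close>; the interior of the path stays away from the neighbours of \<open>v\<close>.\<close>
        define L where "L = {w \<in> C. l w \<le> n} \<union> {x, y}"
        let ?S = "{(s, t). adj s t \<and> s \<in> L \<and> t \<in> L}"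
        have to_u: "(w, u) \<in> ?S\<^sup>*" if "w \<in> C" "w \<in> L" "l w = k" for w k
          using that
        proof (induction k arbitrary: w)
          case 0
          thus ?case using l0[of w] by simp
        next
          case (Suc k)
          obtain w' where w': "w' \<in> C" "adj w w'" "l w' = k" using down[OF Suc.prems(1,3)] by blast
          have "k \<le> n" using Suc.prems less.prems(7,8) unfolding L_def by auto
          hence "w' \<in> L" unfolding L_def using w' by simp
          hence "(w, w') \<in> ?S" "(w', u) \<in> ?S\<^sup>*" using w' Suc.prems(2) Suc.IH[OF w'(1)] by auto
          thus ?case by (rule converse_rtrancl_into_rtrancl)
        qed
        have "sym ?S" unfolding sym_def using sym by blast
        hence symS: "sym (?S\<^sup>*)" by (rule sym_rtrancl)
        have u: "(x, u) \<in> ?S\<^sup>*" "(y, u) \<in> ?S\<^sup>*"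
          using to_u[OF less.prems(1)] to_u[OF less.prems(2)] unfolding L_def by auto
        have conn: "(x, y) \<in> ?S\<^sup>*" using rtrancl_trans[OF u(1) symD[OF symS u(2)]] .
        have "\<exists>p m. p 0 = x \<and> p m = y \<and> (\<forall>i<m. p i \<in> L \<and> p (Suc i) \<in> L) \<and> inj_on p {..m} \<and>
            (\<forall>i\<le>m. \<forall>j\<le>m. adj (p i) (p j) \<longleftrightarrow> j = Suc i \<or> i = Suc j)"
          by (rule shortest_walk_is_induced_path, rule sym, assumption, rule irr, rule conn)
        then obtain p m where p: "p 0 = x" "p m = y" "\<forall>i<m. p i \<in> L \<and> p (Suc i) \<in> L" "inj_on p {..m}"
          "\<forall>i\<le>m. \<forall>j\<le>m. adj (p i) (p j) \<longleftrightarrow> j = Suc i \<or> i = Suc j"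
          by (elim exE conjE)
        have pL: "p i \<in> L" if "i \<le> m" for i
          using p(3) p(2) that unfolding L_def by (cases "i = m") auto
        have int: "p i \<in> C" "l (p i) \<le> n" if "0 < i" "i < m" for i
        proof -
          have "p i \<noteq> x" using inj_onD[OF p(4), of i 0] p(1) that by auto
          moreover have "p i \<noteq> y" using inj_onD[OF p(4), of i m] p(2) that by auto
          ultimately show "p i \<in> C" "l (p i) \<le> n" using pL[of i] that unfolding L_def by auto
        qed
        have side: "side (p i) \<longleftrightarrow> (side x \<longleftrightarrow> even i)" if "i \<le> m" for i
          using that
        proof (induction i)
          case (Suc i)
          have "adj (p i) (p (Suc i))" using p(5) Suc.prems by simp
          from bip[OF this] show ?case using Suc by auto
        qed (simp add: p(1))
        have ev: "even m"
          using side[of m] p(2) bip[OF less.prems(3)] bip[OF less.prems(4)] by auto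
        have m0: "m \<noteq> 0" using p(1,2) xy by (cases m) auto
        have m2: "m \<noteq> 2"
        proof
          assume m: "m = 2"
          have 1: "adj x (p 1)" "adj (p 1) y" using p(5)[rule_format, of 0 1] p(5)[rule_format, of 1 2] p(1,2) m by auto
          have "l (p 1) = n" using level[OF less.prems(1) 1(1)] int(2)[of 1] m less.prems(7) by auto
          thus False using no 1 sym by blast
        qed
        have m4: "4 \<le> m" using ev m0 m2 by presburger
        have "adj v (p i) \<longleftrightarrow> i = 0 \<or> i = m" if "i \<le> m" for i
        proof (cases "i = 0 \<or> i = m")
          case True thus ?thesis using p(1,2) less.prems(3,4) by auto
        next
          case False
          hence "l (p i) \<le> n" using int(2) that by simp
          thus ?thesis using level[OF vC, of "p i"] less.prems(9) False by auto
        qed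
        moreover have "v \<notin> p ` {..m}"
        proof
          assume "v \<in> p ` {..m}"
          then obtain i where "i \<le> m" "v = p i" by blast
          thus False using pL[of i] less.prems(7-9) unfolding L_def by auto
        qed
        ultimately have "hole adj v p m" unfolding hole_def using m4 ev p(4,5) by blast
        thus False using no_hole by blast
      qed
    qed
  qed
  have CV: "C \<subseteq> V"
  proof
    fix x assume "x \<in> C"
    hence "(u, x) \<in> ?R\<^sup>*" unfolding C_def by simp
    thus "x \<in> V" by (cases rule: rtranclE) (use u V in auto)
  qed
  hence finC: "finite C" using fin finite_subset by blast
  define k where "k = Max (l ` C)"
  have lk: "l x \<le> k" if "x \<in> C" for x unfolding k_def using that finC by simp
  obtain w where w: "adj u w" using contra u by blast
  have "l w = 1" using level[OF uC w] lu by auto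
  hence "1 \<le> k" using lk[OF C_adj[OF uC w]] by simp
  then obtain j where k: "k = Suc j" by (cases k) auto
  define N where "N v = {x. adj v x}" for v
  have finN: "finite (N v)" for v by (rule finite_subset[OF _ fin]) (use V in \<open>auto simp: N_def\<close>)
  have "k \<in> l ` C" unfolding k_def using finC uC by (intro Max_in) auto
  then obtain v0 where v0: "v0 \<in> C \<and> l v0 = k" by blast
  obtain v where v: "v \<in> C" "l v = k" and min: "\<And>v'. v' \<in> C \<and> l v' = k \<Longrightarrow> card (N v) \<le> card (N v')"
    using ex_has_least_nat[of "\<lambda>v. v \<in> C \<and> l v = k" v0 "\<lambda>v. card (N v)"] v0 by blast
  have top: "l x = j" if "adj q x" "q \<in> C" "l q = k" for q x
    using level[OF that(2,1)] lk[OF C_adj[OF that(2,1)]] that(3) k by auto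
  obtain x where x: "adj v x" using down[OF v(1)] v(2) k by blast
  have vV: "v \<in> V" using v CV by blast
  have "\<exists>y. adj v y \<and> y \<noteq> x"
  proof (rule ccontr)
    assume "\<not> ?thesis"
    hence "\<forall>z. adj v z \<longleftrightarrow> z = x" using x by blast
    thus False using contra vV by blast
  qed
  then obtain y where y: "adj v y" "y \<noteq> x" by blast
  have trans: "adj y q" if x: "adj v x" and y: "adj v y" and q: "adj x q" for x y q
  proof -
    have C: "x \<in> C" "y \<in> C" "q \<in> C" using C_adj[OF v(1)] C_adj x y q by blast+
    have lx: "l x = j" "l y = j" using top[OF _ v] x y by auto
    from level[OF C(1) q] show ?thesis
    proof
      assume "l x = Suc (l q)"
      thus ?thesis using common[of x y v q "l q"] C x y q lx v(2) k by simp
    next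
      assume "l q = Suc (l x)"
      hence lq: "l q = k" using lx k by simp
      have "N v \<subseteq> N q"
      proof (rule ccontr)
        assume "\<not> N v \<subseteq> N q"
        then obtain a where a: "adj v a" "\<not> adj q a" unfolding N_def by blast
        have "\<not> N q \<subseteq> N v"
        proof
          assume s: "N q \<subseteq> N v"
          hence "N q = N v" using card_subset_eq[OF finN s] min[of q] card_mono[OF finN s] C lq by simp
          thus False using a unfolding N_def by blast
        qed
        then obtain b where b: "adj q b" "\<not> adj v b" unfolding N_def by blast
        have aC: "a \<in> C" "b \<in> C" using C_adj v(1) C(3) a b by blast+
        have la: "l a = j" "l b = j" using top[OF a(1) v] top[OF b(1) C(3) lq] by auto
        show False
        proof (cases j)
          case 0
          thus False using l0[OF C(1)] l0[OF aC(1)] la lx a(2) sym[OF q] by auto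
        next
          case (Suc i)
          obtain z where z: "z \<in> C" "adj x z" "l z = i" using down[OF C(1)] lx Suc by blast
          have "adj a z" using common[of x a v z i] C aC a x z la lx v k Suc by simp
          moreover have "adj b z" using common[of x b q z i] C aC b sym[OF q] z la lx lq k Suc by simp
          ultimately have "domino adj v a z b q x"
            unfolding domino_def using a b x sym q z by blast
          thus False using no_domino by blast
        qed
      qed
      thus ?thesis using y sym unfolding N_def by blast
    qed
  qed
  have "\<forall>q. adj x q \<longleftrightarrow> adj y q" using trans x y by blast
  moreover have "x \<in> V" "\<exists>q. adj x q" using V[OF x] sym[OF x] by blast+
  ultimately show False using contra y(2) by blast
qed

section \<open>Fundamental cycles and $M(K_4)$ minors\<close>

text \<open>
  \<open>T c\<close> is the fundamental cycle of \<open>c\<close> with respect to the basis \<open>B\<close>, without \<open>c\<close> itself.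
\<close>
definition fundamental_cycles :: "'a set \<Rightarrow> 'a set set \<Rightarrow> 'a set \<Rightarrow> ('a \<Rightarrow> 'a set) \<Rightarrow> bool" where
  "fundamental_cycles E \<C> B T \<longleftrightarrow> B \<subseteq> E \<and> cycle_free \<C> B \<and>
     (\<forall>c\<in>E - B. T c \<subseteq> B \<and> insert c (T c) \<in> \<C>)"

lemma fundamental_cycles_exist:
  assumes "cycle_space E \<C>"
  shows "\<exists>B T. fundamental_cycles E \<C> B T"
proof -
  note cs = cycle_spaceD[OF assms]
  define P where "P B \<longleftrightarrow> B \<subseteq> E \<and> cycle_free \<C> B" for B
  have "finite {B. P B}" unfolding P_def using cs(1) by simp
  moreover have "{} \<in> {B. P B}" unfolding P_def cycle_free_def by simp
  ultimately obtain B where B: "P B" "\<And>B'. P B' \<Longrightarrow> B \<subseteq> B' \<Longrightarrow> B = B'"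
    using finite_has_maximal[of "{B. P B}"] by auto
  have BE: "B \<subseteq> E" "cycle_free \<C> B" using B(1) unfolding P_def by auto
  have "\<exists>S. S \<subseteq> B \<and> insert c S \<in> \<C>" if c: "c \<in> E - B" for c
  proof -
    have "\<not> cycle_free \<C> (insert c B)" using B(2)[of "insert c B"] c BE unfolding P_def by auto
    then obtain Z where Z: "Z \<in> \<C>" "c \<in> Z" "Z \<subseteq> insert c B" by (rule cycle_free_insertD[OF BE(2)])
    hence "insert c (Z - {c}) = Z" "Z - {c} \<subseteq> B" by auto
    thus ?thesis using Z(1) by metis
  qed
  hence "\<forall>c\<in>E - B. \<exists>S. S \<subseteq> B \<and> insert c S \<in> \<C>" by blast
  then obtain T where "\<forall>c\<in>E - B. T c \<subseteq> B \<and> insert c (T c) \<in> \<C>" using bchoice by meson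
  thus ?thesis unfolding fundamental_cycles_def using BE by blast
qed

text \<open>
  The sum over \<open>GF(2)\<close> of the fundamental cycles of the elements of \<open>D\<close>.
\<close>
definition fundamental_sum :: "'a set \<Rightarrow> ('a \<Rightarrow> 'a set) \<Rightarrow> 'a set \<Rightarrow> 'a set" where
  "fundamental_sum B T D = D \<union> {b \<in> B. odd (card {c \<in> D. b \<in> T c})}"

lemma fundamental_sum_cycle:
  assumes C: "cycle_space E \<C>" and F: "fundamental_cycles E \<C> B T" and D: "D \<subseteq> E - B"
  shows "fundamental_sum B T D \<in> \<C>"
proof -
  note cs = cycle_spaceD[OF C]
  have "finite D" using D cs(1) finite_subset by blast
  thus ?thesis using D
  proof (induction D rule: finite_induct)
    case empty
    show ?case using cs(3) unfolding fundamental_sum_def by simp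
  next
    case (insert c D)
    have c: "T c \<subseteq> B" "insert c (T c) \<in> \<C>" "c \<notin> B"
      using F insert.prems unfolding fundamental_cycles_def by auto
    have par: "odd (card {c' \<in> insert c D. b \<in> T c'}) \<longleftrightarrow> (odd (card {c' \<in> D. b \<in> T c'}) \<noteq> (b \<in> T c))" for b
    proof (cases "b \<in> T c")
      case True
      hence "{c' \<in> insert c D. b \<in> T c'} = insert c {c' \<in> D. b \<in> T c'}" by blast
      thus ?thesis using True insert.hyps by simp
    next
      case False
      hence "{c' \<in> insert c D. b \<in> T c'} = {c' \<in> D. b \<in> T c'}" by blast
      thus ?thesis using False by simp
    qed
    have "fundamental_sum B T (insert c D) = sym_diff (fundamental_sum B T D) (insert c (T c))"
      unfolding fundamental_sum_def par using c insert.hyps(2) insert.prems by auto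
    thus ?case using cs(4)[OF insert.IH c(2)] insert.prems by simp
  qed
qed

lemma cycle_iff_fundamental_sum:
  assumes C: "cycle_space E \<C>" and F: "fundamental_cycles E \<C> B T" and Z: "Z \<subseteq> E"
  shows "Z \<in> \<C> \<longleftrightarrow> Z = fundamental_sum B T (Z - B)"
proof
  have ZB: "Z - B \<subseteq> E - B" using Z by blast
  have S: "fundamental_sum B T (Z - B) \<in> \<C>" by (rule fundamental_sum_cycle[OF C F ZB])
  show "Z = fundamental_sum B T (Z - B)" if "Z \<in> \<C>"
  proof -
    have sub: "sym_diff Z (fundamental_sum B T (Z - B)) \<subseteq> B" unfolding fundamental_sum_def by blast
    have "\<forall>Z\<in>\<C>. Z \<subseteq> B \<longrightarrow> Z = {}"
      using F unfolding fundamental_cycles_def cycle_free_def by blast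
    from this[rule_format, OF cycle_spaceD(4)[OF C that S] sub] show ?thesis by blast
  qed
  show "Z \<in> \<C>" if "Z = fundamental_sum B T (Z - B)" using S that by simp
qed

text \<open>
  Every element of the basis outside \<open>Q\<close> is contracted, so that only the parity conditions
  belonging to \<open>Q\<close> remain; of the non-basis elements, those in \<open>G\<close> are kept and those in \<open>D0\<close>
  are contracted. The elements of \<open>Q - P\<close> are deleted.
\<close>
lemma minor_cycles_fundamental:
  assumes C: "cycle_space E \<C>" and F: "fundamental_cycles E \<C> B T"
    and sub: "Q \<subseteq> B" "G \<subseteq> E - B" "D0 \<subseteq> E - B" "G \<inter> D0 = {}" "P \<subseteq> Q" and X: "X \<subseteq> P \<union> G"
  shows "X \<in> minor_cycles \<C> ((B - Q) \<union> D0) (P \<union> G) \<longleftrightarrow>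
    (\<exists>D\<subseteq>D0. \<forall>b\<in>Q. b \<in> X \<longleftrightarrow> odd (card {c \<in> (X \<inter> G) \<union> D. b \<in> T c}))"
proof
  have BE: "B \<subseteq> E" using F unfolding fundamental_cycles_def by blast
  {
    assume "X \<in> minor_cycles \<C> ((B - Q) \<union> D0) (P \<union> G)"
    then obtain Z where Z: "Z \<in> \<C>" "Z \<subseteq> (P \<union> G) \<union> ((B - Q) \<union> D0)" "X = Z \<inter> (P \<union> G)"
      unfolding minor_cycles_def by blast
    have eq: "Z = fundamental_sum B T (Z - B)"
      using cycle_iff_fundamental_sum[OF C F] cycle_spaceD(2)[OF C Z(1)] Z(1) by blast
    have ZB: "Z - B = (X \<inter> G) \<union> (Z \<inter> D0)" using Z(2,3) sub by blast
    have "b \<in> X \<longleftrightarrow> odd (card {c \<in> (X \<inter> G) \<union> (Z \<inter> D0). b \<in> T c})" if "b \<in> Q" for b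
    proof -
      have "b \<in> X \<longleftrightarrow> b \<in> Z" using Z(2,3) that sub by blast
      also have "\<dots> \<longleftrightarrow> odd (card {c \<in> Z - B. b \<in> T c})"
        using eq that sub(1) unfolding fundamental_sum_def by blast
      finally show ?thesis unfolding ZB .
    qed
    thus "\<exists>D\<subseteq>D0. \<forall>b\<in>Q. b \<in> X \<longleftrightarrow> odd (card {c \<in> (X \<inter> G) \<union> D. b \<in> T c})"
      by (intro exI[of _ "Z \<inter> D0"]) auto
  }
  {
    assume "\<exists>D\<subseteq>D0. \<forall>b\<in>Q. b \<in> X \<longleftrightarrow> odd (card {c \<in> (X \<inter> G) \<union> D. b \<in> T c})"
    then obtain D where D: "D \<subseteq> D0" "\<forall>b\<in>Q. b \<in> X \<longleftrightarrow> odd (card {c \<in> (X \<inter> G) \<union> D. b \<in> T c})" by blast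
    define Z where "Z = fundamental_sum B T ((X \<inter> G) \<union> D)"
    have "(X \<inter> G) \<union> D \<subseteq> E - B" using D(1) sub by blast
    hence ZC: "Z \<in> \<C>" unfolding Z_def by (rule fundamental_sum_cycle[OF C F])
    have Q: "b \<in> Z \<longleftrightarrow> b \<in> X" if "b \<in> Q" for b
    proof -
      have "b \<in> B" "b \<notin> (X \<inter> G) \<union> D" using that sub D(1) by blast+
      thus ?thesis using D(2) that unfolding Z_def fundamental_sum_def by blast
    qed
    have ZB: "Z \<subseteq> B \<union> ((X \<inter> G) \<union> D)" "(X \<inter> G) \<union> D \<subseteq> Z" unfolding Z_def fundamental_sum_def by auto
    have XQ: "X \<inter> Q \<subseteq> P" using X sub by blast
    have 1: "Z \<subseteq> (P \<union> G) \<union> ((B - Q) \<union> D0)" using ZB(1) Q XQ D(1) by blast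
    have "Z \<inter> (P \<union> G) = X"
    proof
      show "Z \<inter> (P \<union> G) \<subseteq> X"
      proof
        fix e assume e: "e \<in> Z \<inter> (P \<union> G)"
        show "e \<in> X"
        proof (cases "e \<in> P")
          case True thus ?thesis using Q[of e] e sub(5) by blast
        next
          case False
          hence "e \<in> G" using e by blast
          hence "e \<notin> B" "e \<notin> D" using sub D(1) by auto
          thus ?thesis using e ZB(1) by blast
        qed
      qed
      show "X \<subseteq> Z \<inter> (P \<union> G)"
      proof
        fix e assume e: "e \<in> X"
        show "e \<in> Z \<inter> (P \<union> G)"
        proof (cases "e \<in> P")
          case True thus ?thesis using Q[of e] e sub(5) by blast
        next
          case False thus ?thesis using e X ZB(2) by blast
        qed
      qed
    qed
    thus "X \<in> minor_cycles \<C> ((B - Q) \<union> D0) (P \<union> G)"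
      using minor_cyclesI[OF ZC 1] by simp
  }
qed

lemma odd_card_Collect_insert:
  assumes "finite A" "a \<notin> A"
  shows "odd (card {c \<in> insert a A. P c}) \<longleftrightarrow> (P a \<noteq> odd (card {c \<in> A. P c}))"
proof (cases "P a")
  case True
  hence "{c \<in> insert a A. P c} = insert a {c \<in> A. P c}" by blast
  thus ?thesis using True assms by simp
next
  case False
  hence "{c \<in> insert a A. P c} = {c \<in> A. P c}" by blast
  thus ?thesis using False by simp
qed

lemma odd_card_three:
  assumes "distinct [x, y, z]"
  shows "odd (card {c \<in> X \<inter> {x, y, z}. P c}) \<longleftrightarrow>
    ((x \<in> X \<and> P x) \<noteq> ((y \<in> X \<and> P y) \<noteq> (z \<in> X \<and> P z)))"
proof -
  have "{c \<in> X \<inter> {x, y, z}. P c} = {c \<in> insert x (insert y (insert z {})). c \<in> X \<and> P c}" by blast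
  moreover have "odd (card {c \<in> {z}. Q c}) \<longleftrightarrow> Q z"
    "odd (card {c \<in> {y, z}. Q c}) \<longleftrightarrow> (Q y \<noteq> odd (card {c \<in> {z}. Q c}))"
    "odd (card {c \<in> {x, y, z}. Q c}) \<longleftrightarrow> (Q x \<noteq> odd (card {c \<in> {y, z}. Q c}))" for Q
    using odd_card_Collect_insert[of "{}" z Q] odd_card_Collect_insert[of "{z}" y Q]
      odd_card_Collect_insert[of "{y, z}" x Q] assms by auto
  ultimately show ?thesis by (simp only:)
qed

text \<open>
  In $GF(2)^3$ with basis \<open>a\<close>, \<open>b\<close>, \<open>x\<close> the six vectors are all nonzero ones except \<open>a + b\<close>.
  The Fano plane minus a point is $M(K_4)$, and \<open>a\<close>, \<open>x\<close>, \<open>w\<close> is a basis with sum \<open>a + b\<close>,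
  which makes the labelling a standard one.
\<close>
lemma K4_minor_of_triangle_basis:
  assumes C: "cycle_space E \<C>" and F: "fundamental_cycles E \<C> B T"
    and s: "a \<in> B" "b \<in> B" "x \<in> B" "v \<in> E - B" "w \<in> E - B" "z \<in> E - B"
    and d: "distinct [a, b, x]" "distinct [v, w, z]"
    and adj: "a \<in> T v" "x \<in> T v" "b \<notin> T v" "x \<in> T w" "b \<in> T w" "a \<notin> T w" "a \<in> T z" "b \<in> T z" "x \<in> T z"
  shows "K4_minor E \<C>"
proof -
  have BE: "B \<subseteq> E" using F unfolding fundamental_cycles_def by blast
  let ?Y = "B - {a, b, x}"
  have eq: "{a, b, x} \<union> {v, w, z} = {a, x, w, v, b, z}" by blast
  have iff: "X \<in> minor_cycles \<C> ?Y {a, x, w, v, b, z} \<longleftrightarrow>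
      (a \<in> X \<longleftrightarrow> ((v \<in> X) \<noteq> (z \<in> X))) \<and> (x \<in> X \<longleftrightarrow> ((v \<in> X) \<noteq> ((w \<in> X) \<noteq> (z \<in> X)))) \<and>
      (b \<in> X \<longleftrightarrow> ((w \<in> X) \<noteq> (z \<in> X)))"
    if X: "X \<subseteq> {a, x, w, v, b, z}" for X
  proof -
    have sub: "{a, b, x} \<subseteq> B" "{v, w, z} \<subseteq> E - B" using s by auto
    have "X \<in> minor_cycles \<C> (?Y \<union> {}) ({a, b, x} \<union> {v, w, z}) \<longleftrightarrow>
        (\<exists>D\<subseteq>{}. \<forall>b'\<in>{a, b, x}. b' \<in> X \<longleftrightarrow> odd (card {c \<in> (X \<inter> {v, w, z}) \<union> D. b' \<in> T c}))"
      by (rule minor_cycles_fundamental[OF C F sub]) (use X in auto)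
    also have "\<dots> \<longleftrightarrow> (\<forall>b'\<in>{a, b, x}. b' \<in> X \<longleftrightarrow> odd (card {c \<in> X \<inter> {v, w, z}. b' \<in> T c}))"
      by (simp only: subset_empty Un_empty_right ex_simps simp_thms)
    also have "\<dots> \<longleftrightarrow> (a \<in> X \<longleftrightarrow> ((v \<in> X) \<noteq> (z \<in> X))) \<and> (x \<in> X \<longleftrightarrow> ((v \<in> X) \<noteq> ((w \<in> X) \<noteq> (z \<in> X)))) \<and>
      (b \<in> X \<longleftrightarrow> ((w \<in> X) \<noteq> (z \<in> X)))"
      unfolding odd_card_three[OF d(2)] using adj by auto
    finally show ?thesis unfolding eq Un_empty_right .
  qed
  have dist: "distinct [a, x, w, v, b, z]" using s d by auto
  have "K4_at (minor_cycles \<C> ?Y {a, x, w, v, b, z}) a x w v b z"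
    unfolding K4_at_iff using dist iff by auto
  moreover have "?Y \<subseteq> E" "{a, x, w, v, b, z} \<subseteq> E - ?Y" using s BE by auto
  ultimately show ?thesis unfolding K4_minor_iff by blast
qed

text \<open>
  The elements \<open>b i\<close> and \<open>c i = b i + b (i + 1)\<close> form the cycle matroid of the wheel with \<open>k\<close>
  spokes. Contracting \<open>c 2, \<dots>, c (k - 2)\<close> makes \<open>b 2, \<dots>, b (k - 1)\<close> parallel; deleting all of
  these but \<open>b 2\<close> leaves the wheel with three spokes, which is $K_4$.
\<close>
lemma K4_minor_of_wheel:
  assumes C: "cycle_space E \<C>" and F: "fundamental_cycles E \<C> B T"
    and k: "3 \<le> k" and b: "\<And>i. i < k \<Longrightarrow> b i \<in> B" "inj_on b {..<k}"
    and c: "\<And>i. i < k \<Longrightarrow> c i \<in> E - B" "inj_on c {..<k}"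
    and T: "\<And>i j. i < k \<Longrightarrow> j < k \<Longrightarrow> b j \<in> T (c i) \<longleftrightarrow> j = i \<or> j = (if Suc i = k then 0 else Suc i)"
  shows "K4_minor E \<C>"
proof -
  have BE: "B \<subseteq> E" using F unfolding fundamental_cycles_def by blast
  let ?Q = "b ` {..<k}" and ?P = "{b 0, b 1, b 2}" and ?G = "{c 0, c 1, c (k - 1)}" and ?D = "c ` {2..<k - 1}"
  let ?Y = "(B - ?Q) \<union> ?D" and ?F = "{b 0, b 1, b 2, c 0, c 1, c (k - 1)}"
  have eq: "?P \<union> ?G = ?F" by blast
  have beq: "b i = b j \<longleftrightarrow> i = j" if "i < k" "j < k" for i j using inj_on_eq_iff[OF b(2)] that by simp
  have ceq: "c i = c j \<longleftrightarrow> i = j" if "i < k" "j < k" for i j using inj_on_eq_iff[OF c(2)] that by simp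
  have bc: "b i \<noteq> c j" if "i < k" "j < k" for i j using b(1)[OF that(1)] c(1)[OF that(2)] by auto
  have b_out: "b j \<notin> ?F" if "3 \<le> j" "j < k" for j
    using that by (simp add: beq bc)
  have sub: "?Q \<subseteq> B" "?G \<subseteq> E - B" "?D \<subseteq> E - B" "?P \<subseteq> ?Q" using b(1) c(1) k by auto
  have GD: "?G \<inter> ?D = {}" using ceq k by auto
  have par: "odd (card {c' \<in> U. b j \<in> T c'}) \<longleftrightarrow> ((c j \<in> U) \<noteq> (c (if j = 0 then k - 1 else j - 1) \<in> U))"
    if U: "U \<subseteq> c ` {..<k}" and j: "j < k" for U j
  proof -
    let ?i = "if j = 0 then k - 1 else j - 1"
    have i: "?i < k" "?i \<noteq> j" using j k by auto
    have "{c' \<in> U. b j \<in> T c'} = {c' \<in> {c j, c ?i}. c' \<in> U}"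
    proof -
      have "b j \<in> T (c i') \<longleftrightarrow> i' = j \<or> i' = ?i" if "i' < k" for i'
        using T[OF that j] that j k by auto
      thus ?thesis using U j i by auto
    qed
    moreover have "c j \<noteq> c ?i" using ceq[OF j i(1)] i(2) by simp
    ultimately show ?thesis
      using odd_card_Collect_insert[of "{}" "c ?i" "\<lambda>c'. c' \<in> U"]
        odd_card_Collect_insert[of "{c ?i}" "c j" "\<lambda>c'. c' \<in> U"] by simp
  qed
  have iff: "X \<in> minor_cycles \<C> ?Y ?F \<longleftrightarrow>
      (b 0 \<in> X \<longleftrightarrow> (c 0 \<in> X) \<noteq> (c (k - 1) \<in> X)) \<and> (b 1 \<in> X \<longleftrightarrow> (c 0 \<in> X) \<noteq> (c 1 \<in> X)) \<and>
      (b 2 \<in> X \<longleftrightarrow> (c 1 \<in> X) \<noteq> (c (k - 1) \<in> X))" (is "_ \<longleftrightarrow> ?R")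
    if X: "X \<subseteq> ?F" for X
  proof -
    have UG: "(X \<inter> ?G) \<union> D \<subseteq> c ` {..<k}" if "D \<subseteq> ?D" for D
    proof -
      have "?D \<subseteq> c ` {..<k}" by (rule image_mono) auto
      moreover have "?G \<subseteq> c ` {..<k}" using k by auto
      ultimately show ?thesis using that by blast
    qed
    have U01: "c i \<in> (X \<inter> ?G) \<union> D \<longleftrightarrow> c i \<in> X" if "D \<subseteq> ?D" "i \<in> {0, 1, k - 1}" for i D
    proof -
      have "c i \<in> ?G" using that(2) by auto
      thus ?thesis using GD that(1) by blast
    qed
    have "X \<in> minor_cycles \<C> ?Y ?F \<longleftrightarrow>
      (\<exists>D\<subseteq>?D. \<forall>b'\<in>?Q. b' \<in> X \<longleftrightarrow> odd (card {c \<in> (X \<inter> ?G) \<union> D. b' \<in> T c}))"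
      using minor_cycles_fundamental[OF C F sub(1,2,3) GD sub(4)] X unfolding eq by simp
    also have "\<dots> \<longleftrightarrow> (\<exists>D\<subseteq>?D. \<forall>j<k. b j \<in> X \<longleftrightarrow>
        ((c j \<in> (X \<inter> ?G) \<union> D) \<noteq> (c (if j = 0 then k - 1 else j - 1) \<in> (X \<inter> ?G) \<union> D)))" (is "_ \<longleftrightarrow> (\<exists>D\<subseteq>?D. ?S D)")
    proof (intro ex_cong1 conj_cong refl)
      fix D assume D: "D \<subseteq> ?D"
      have "(\<forall>b'\<in>?Q. R b') \<longleftrightarrow> (\<forall>j<k. R (b j))" for R by auto
      thus "(\<forall>b'\<in>?Q. b' \<in> X \<longleftrightarrow> odd (card {c \<in> (X \<inter> ?G) \<union> D. b' \<in> T c})) \<longleftrightarrow> ?S D"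
        by (simp only: par[OF UG[OF D]] cong: imp_cong)
    qed
    also have "\<dots> \<longleftrightarrow> ?R"
    proof
      assume "\<exists>D\<subseteq>?D. ?S D"
      then obtain D where D: "D \<subseteq> ?D" and S: "?S D" by blast
      let ?U = "(X \<inter> ?G) \<union> D"
      \<comment> \<open>The deleted elements \<open>b j\<close> force consecutive rim elements to be used together.\<close>
      have chain: "c j \<in> ?U \<longleftrightarrow> c 2 \<in> ?U" if "2 \<le> j" "j < k" for j
        using that
      proof (induction j rule: dec_induct)
        case (step j)
        have "b (Suc j) \<notin> ?F" by (rule b_out) (use step in simp_all)
        hence "b (Suc j) \<notin> X" using X by blast
        moreover have "b (Suc j) \<in> X \<longleftrightarrow> ((c (Suc j) \<in> ?U) \<noteq> (c j \<in> ?U))"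
          using S[rule_format, of "Suc j"] step.prems by (simp only: nat.distinct if_False diff_Suc_1)
        moreover have "c j \<in> ?U \<longleftrightarrow> c 2 \<in> ?U" using step.IH step.prems by simp
        ultimately show ?case by blast
      qed simp
      have last: "c 2 \<in> ?U \<longleftrightarrow> c (k - 1) \<in> X" using chain[of "k - 1"] U01[OF D, of "k - 1"] k by simp
      show ?R
        using S[rule_format, of 0] S[rule_format, of 1] S[rule_format, of 2] k last
          U01[OF D, of 0] U01[OF D, of 1] U01[OF D, of "k - 1"] by auto
    next
      assume R: ?R
      define D where "D = (if c (k - 1) \<in> X then ?D else {})"
      have D: "D \<subseteq> ?D" unfolding D_def by simp
      let ?U = "(X \<inter> ?G) \<union> D"
      have mem: "c j \<in> ?U \<longleftrightarrow> c (k - 1) \<in> X" if "2 \<le> j" "j < k" for j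
      proof (cases "j = k - 1")
        case True thus ?thesis using U01[OF D, of j] by simp
      next
        case False
        hence j: "j \<in> {2..<k - 1}" using that by auto
        hence "c j \<in> ?D" by blast
        hence "c j \<notin> ?G" using GD by blast
        thus ?thesis using \<open>c j \<in> ?D\<close> unfolding D_def by auto
      qed
      have "?S D"
      proof (intro allI impI)
        fix j assume j: "j < k"
        consider "j = 0" | "j = 1" | "j = 2" | "3 \<le> j" by linarith
        thus "b j \<in> X \<longleftrightarrow> ((c j \<in> ?U) \<noteq> (c (if j = 0 then k - 1 else j - 1) \<in> ?U))"
        proof cases
          case 1 thus ?thesis using R U01[OF D, of 0] U01[OF D, of "k - 1"] by simp
        next
          case 2 thus ?thesis using R U01[OF D, of 0] U01[OF D, of 1] by auto
        next
          case 3 thus ?thesis using R mem[of 2] U01[OF D, of 1] k by auto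
        next
          case 4
          have "b j \<notin> X" using b_out[OF 4 j] X by (rule contra_subsetD[rotated])
          moreover have "(c j \<in> ?U) = (c (j - 1) \<in> ?U)" using mem[of j] mem[of "j - 1"] 4 j by simp
          ultimately show ?thesis using 4 by simp
        qed
      qed
      thus "\<exists>D\<subseteq>?D. ?S D" using D by blast
    qed
    finally show ?thesis .
  qed
  have dist: "distinct [b 0, b 1, b 2, c 0, c 1, c (k - 1)]"
    using k beq[of 0 1] beq[of 0 2] beq[of 1 2] ceq[of 0 1] ceq[of 0 "k - 1"] ceq[of 1 "k - 1"]
      bc[of 0 0] bc[of 0 1] bc[of 0 "k - 1"] bc[of 1 0] bc[of 1 1] bc[of 1 "k - 1"] bc[of 2 0] bc[of 2 1] bc[of 2 "k - 1"]
    by auto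
  have "K4_at (minor_cycles \<C> ?Y ?F) (b 0) (b 1) (b 2) (c 0) (c 1) (c (k - 1))"
    unfolding K4_at_iff using dist iff by simp
  moreover have "?Y \<subseteq> E" using BE sub(3) by blast
  moreover have "?F \<subseteq> E - ?Y"
  proof -
    have "P \<union> G \<subseteq> E - ((B - Q) \<union> D)"
      if "P \<subseteq> Q" "Q \<subseteq> B" "G \<subseteq> E - B" "D \<subseteq> E - B" "G \<inter> D = {}" for P Q G D
      using that BE by blast
    from this[OF sub(4,1,2,3) GD] show ?thesis unfolding eq .
  qed
  ultimately show ?thesis unfolding K4_minor_iff
    by (intro exI[of _ ?Y] exI[of _ "b 0"] exI[of _ "b 1"] exI[of _ "b 2"] exI[of _ "c 0"] exI[of _ "c 1"]
        exI[of _ "c (k - 1)"] conjI)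
qed

text \<open>
  A hole of the fundamental graph is a wheel: it alternates between basis elements, the
  spokes, and non-basis elements, the rim. On which side \<open>v\<close> lies decides how the path is
  split into the two sequences.
\<close>
lemma K4_minor_of_hole:
  assumes C: "cycle_space E \<C>" and F: "fundamental_cycles E \<C> B T"
    and adj: "\<And>x y. adj x y \<longleftrightarrow> (x \<in> B \<and> y \<in> E - B \<and> x \<in> T y) \<or> (y \<in> B \<and> x \<in> E - B \<and> y \<in> T x)"
    and hole: "hole adj v p m"
  shows "K4_minor E \<C>"
proof -
  have m: "4 \<le> m" "even m" "inj_on p {..m}" "v \<notin> p ` {..m}"
    and pp: "\<forall>i\<le>m. \<forall>j\<le>m. adj (p i) (p j) \<longleftrightarrow> j = Suc i \<or> i = Suc j"
    and vp: "\<forall>i\<le>m. adj v (p i) \<longleftrightarrow> i = 0 \<or> i = m"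
    using hole unfolding hole_def by blast+
  obtain h where h: "m = 2 * h" "2 \<le> h" using m(1,2) by (auto elim!: evenE)
  have adjT: "x \<in> T y \<longleftrightarrow> adj y x" if "x \<in> B" "y \<in> E - B" for x y using adj[of y x] that by blast
  have side: "p i \<in> B \<longleftrightarrow> (p 0 \<in> B \<longleftrightarrow> even i)" if "i \<le> m" for i
    using that
  proof (induction i)
    case (Suc i)
    have "adj (p i) (p (Suc i))" using pp Suc.prems by simp
    hence "p i \<in> B \<longleftrightarrow> p (Suc i) \<notin> B" unfolding adj by blast
    thus ?case using Suc by auto
  qed simp
  have inE: "p i \<in> E" if "i \<le> m" for i
  proof -
    have BE: "B \<subseteq> E" using F unfolding fundamental_cycles_def by blast
    have "\<exists>j. adj (p i) (p j)"
    proof (cases i)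
      case 0 thus ?thesis using pp[rule_format, of 0 1] h by auto
    next
      case (Suc j) thus ?thesis using pp[rule_format, of i j] that by auto
    qed
    thus ?thesis unfolding adj using BE by blast
  qed
  have vE: "v \<in> E" "v \<in> B \<longleftrightarrow> p 0 \<notin> B"
  proof -
    have "adj v (p 0)" using vp by simp
    thus "v \<in> E" "v \<in> B \<longleftrightarrow> p 0 \<notin> B" using F unfolding adj fundamental_cycles_def by blast+
  qed
  have pinj: "p i = p j \<longleftrightarrow> i = j" if "i \<le> m" "j \<le> m" for i j using inj_on_eq_iff[OF m(3)] that by simp
  have vne: "v \<noteq> p i" if "i \<le> m" for i using m(4) that by blast
  show ?thesis
  proof (cases "v \<in> B")
    case True
    \<comment> \<open>The spokes are \<open>v\<close> and the vertices of odd index, the rim consists of those of even index.\<close>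
    define b where "b j = (if j = 0 then v else p (2 * j - 1))" for j
    define c where "c j = p (2 * j)" for j
    have bB: "b i \<in> B" if "i < Suc h" for i
      using True side[of "2 * i - 1"] that vE h unfolding b_def by auto
    have cB: "c i \<in> E - B" if "i < Suc h" for i
      using True side[of "2 * i"] inE[of "2 * i"] that vE h unfolding c_def by auto
    show ?thesis
    proof (rule K4_minor_of_wheel[OF C F, of "Suc h" b c])
      show "3 \<le> Suc h" using h by simp
      show "b i \<in> B" if "i < Suc h" for i by (rule bB[OF that])
      show "c i \<in> E - B" if "i < Suc h" for i by (rule cB[OF that])
      show "inj_on c {..<Suc h}" using pinj h unfolding c_def by (intro inj_onI) auto
      show "inj_on b {..<Suc h}"
      proof (rule inj_onI)
        fix i j assume ij: "i \<in> {..<Suc h}" "j \<in> {..<Suc h}" "b i = b j"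
        hence l: "2 * i - 1 \<le> m" "2 * j - 1 \<le> m" using h by auto
        show "i = j"
        proof (cases "i = 0"; cases "j = 0")
          assume "i \<noteq> 0" "j \<noteq> 0"
          hence "2 * i - 1 = 2 * j - 1" using ij(3) pinj[OF l] unfolding b_def by simp
          thus ?thesis using \<open>i \<noteq> 0\<close> \<open>j \<noteq> 0\<close> by simp
        qed (use ij(3) vne[OF l(1)] vne[OF l(2)] in \<open>auto simp: b_def\<close>)
      qed
      fix i j assume ij: "i < Suc h" "j < Suc h"
      show "b j \<in> T (c i) \<longleftrightarrow> j = i \<or> j = (if Suc i = Suc h then 0 else Suc i)"
      proof (cases "j = 0")
        case True
        have "b j \<in> T (c i) \<longleftrightarrow> adj v (p (2 * i))"
          using adjT[OF bB[OF ij(2)] cB[OF ij(1)]] True adj[of v "p (2 * i)"] adj[of "p (2 * i)" v] unfolding b_def c_def by auto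
        thus ?thesis using vp[rule_format, of "2 * i"] ij h True by auto
      next
        case False
        have "b j \<in> T (c i) \<longleftrightarrow> adj (p (2 * i)) (p (2 * j - 1))"
          using adjT[OF bB[OF ij(2)] cB[OF ij(1)]] False unfolding b_def c_def by simp
        also have "\<dots> \<longleftrightarrow> 2 * j - 1 = Suc (2 * i) \<or> 2 * i = Suc (2 * j - 1)"
          using pp[rule_format, of "2 * i" "2 * j - 1"] ij h by simp
        also have "\<dots> \<longleftrightarrow> j = i \<or> j = (if Suc i = Suc h then 0 else Suc i)"
        proof -
          have "2 * j - 1 = Suc (2 * i) \<longleftrightarrow> j = Suc i" using False by presburger
          moreover have "2 * i = Suc (2 * j - 1) \<longleftrightarrow> j = i" using False by presburger
          ultimately show ?thesis using ij False by auto
        qed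
        finally show ?thesis .
      qed
    qed
  next
    case False
    \<comment> \<open>The spokes are the vertices of even index, and \<open>v\<close> is the last element of the rim.\<close>
    define b where "b j = p (2 * j)" for j
    define c where "c j = (if j = h then v else p (2 * j + 1))" for j
    have bB: "b i \<in> B" if "i < Suc h" for i
      using False side[of "2 * i"] that vE h unfolding b_def by auto
    have cB: "c i \<in> E - B" if "i < Suc h" for i
      using False side[of "2 * i + 1"] inE[of "2 * i + 1"] that vE h unfolding c_def by auto
    show ?thesis
    proof (rule K4_minor_of_wheel[OF C F, of "Suc h" b c])
      show "3 \<le> Suc h" using h by simp
      show "b i \<in> B" if "i < Suc h" for i by (rule bB[OF that])
      show "c i \<in> E - B" if "i < Suc h" for i by (rule cB[OF that])
      show "inj_on b {..<Suc h}" using pinj h unfolding b_def by (intro inj_onI) auto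
      show "inj_on c {..<Suc h}"
      proof (rule inj_onI)
        fix i j assume ij: "i \<in> {..<Suc h}" "j \<in> {..<Suc h}" "c i = c j"
        show "i = j"
        proof (cases "i = h"; cases "j = h")
          assume "i \<noteq> h" "j \<noteq> h"
          hence "2 * i + 1 = 2 * j + 1" using ij pinj[of "2 * i + 1" "2 * j + 1"] h unfolding c_def by simp
          thus ?thesis by simp
        qed (use ij vne[of "2 * i + 1"] vne[of "2 * j + 1"] h in \<open>auto simp: c_def\<close>)
      qed
      fix i j assume ij: "i < Suc h" "j < Suc h"
      show "b j \<in> T (c i) \<longleftrightarrow> j = i \<or> j = (if Suc i = Suc h then 0 else Suc i)"
      proof (cases "i = h")
        case True
        have "b j \<in> T (c i) \<longleftrightarrow> adj v (p (2 * j))"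
          using adjT[OF bB[OF ij(2)] cB[OF ij(1)]] True unfolding b_def c_def by simp
        thus ?thesis using vp[rule_format, of "2 * j"] ij h True by auto
      next
        case neq: False
        have "b j \<in> T (c i) \<longleftrightarrow> adj (p (2 * i + 1)) (p (2 * j))"
          using adjT[OF bB[OF ij(2)] cB[OF ij(1)]] neq unfolding b_def c_def by simp
        also have "\<dots> \<longleftrightarrow> 2 * j = Suc (2 * i + 1) \<or> 2 * i + 1 = Suc (2 * j)"
          using pp[rule_format, of "2 * i + 1" "2 * j"] ij h neq by simp
        also have "\<dots> \<longleftrightarrow> j = i \<or> j = (if Suc i = Suc h then 0 else Suc i)" using ij neq by auto
        finally show ?thesis .
      qed
    qed
  qed
qed

text \<open>
  The roles of the two sides of a domino are interchanged by the reflection that swaps \<open>x\<close> and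
  \<open>z\<close>.
\<close>
lemma K4_minor_of_domino:
  assumes C: "cycle_space E \<C>" and F: "fundamental_cycles E \<C> B T"
    and adj: "\<And>x y. adj x y \<longleftrightarrow> (x \<in> B \<and> y \<in> E - B \<and> x \<in> T y) \<or> (y \<in> B \<and> x \<in> E - B \<and> y \<in> T x)"
    and dom: "domino adj v a z b w x"
  shows "K4_minor E \<C>"
proof -
  have d: "adj v a" "adj v x" "\<not> adj v b" "adj w x" "adj w b" "\<not> adj w a" "adj z a" "adj z b" "adj z x"
    using dom unfolding domino_def by blast+
  have dist: "distinct [a, b, x]" "distinct [v, w, z]" using d by auto
  show ?thesis
  proof (cases "v \<in> B")
    case True
    have s: "a \<in> E - B" "x \<in> E - B" "w \<in> B" "z \<in> B" "b \<in> E - B"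
      using True d(1,2,4,5,7) unfolding adj by blast+
    show ?thesis
      by (rule K4_minor_of_triangle_basis[OF C F, of v w z a b x])
        (use True s dist d in \<open>auto simp: adj\<close>)
  next
    case False
    have s: "a \<in> B" "x \<in> B" "v \<in> E - B" "w \<in> E - B" "z \<in> E - B" "b \<in> B"
      using False d(1,2,4,5,7) unfolding adj by blast+
    show ?thesis
      by (rule K4_minor_of_triangle_basis[OF C F, of a b x v w z])
        (use s dist d in \<open>auto simp: adj\<close>)
  qed
qed

section \<open>Binary gammoids are the binary matroids without $M(K_4)$ minor\<close>

text \<open>
  In the fundamental graph an isolated vertex is a loop or a coloop, a pendant vertex is
  parallel to or in series with its neighbour, and twins are parallel or in series with each
  other, depending on whether they lie outside or inside the basis.
\<close>
lemma series_parallel_element: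
  assumes C: "cycle_space E \<C>" and ne: "E \<noteq> {}" and no: "\<not> K4_minor E \<C>"
  shows "\<exists>e\<in>E. {e} \<in> \<C> \<or> (\<forall>Z\<in>\<C>. e \<notin> Z) \<or>
    (\<exists>f\<in>E. f \<noteq> e \<and> ({e, f} \<in> \<C> \<or> (\<forall>Z\<in>\<C>. e \<in> Z \<longleftrightarrow> f \<in> Z)))"
proof -
  note cs = cycle_spaceD[OF C]
  obtain B T where F: "fundamental_cycles E \<C> B T" using fundamental_cycles_exist[OF C] by blast
  have BE: "B \<subseteq> E" and T: "\<And>c. c \<in> E - B \<Longrightarrow> T c \<subseteq> B" "\<And>c. c \<in> E - B \<Longrightarrow> insert c (T c) \<in> \<C>"
    using F unfolding fundamental_cycles_def by blast+
  define adj where "adj x y \<longleftrightarrow> (x \<in> B \<and> y \<in> E - B \<and> x \<in> T y) \<or> (y \<in> B \<and> x \<in> E - B \<and> y \<in> T x)" for x y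
  have mem: "b \<in> Z \<longleftrightarrow> odd (card {c \<in> Z - B. b \<in> T c})" if "Z \<in> \<C>" "b \<in> B" for Z b
  proof -
    have "Z = fundamental_sum B T (Z - B)"
      using cycle_iff_fundamental_sum[OF C F cs(2)[OF that(1)]] that(1) by blast
    hence "b \<in> Z \<longleftrightarrow> b \<in> fundamental_sum B T (Z - B)" by simp
    thus ?thesis using that(2) unfolding fundamental_sum_def by blast
  qed
  have NB: "{c \<in> Z - B. b \<in> T c} = {c \<in> Z - B. adj b c}" if "Z \<in> \<C>" "b \<in> B" for Z b
    using cs(2)[OF that(1)] that(2) unfolding adj_def by blast
  have NC: "T c = {b. adj c b}" if "c \<in> E - B" for c
    using T(1)[OF that] that unfolding adj_def by blast
  have "\<exists>x\<in>E. (\<forall>y. \<not> adj x y) \<or> (\<exists>y. \<forall>z. adj x z \<longleftrightarrow> z = y) \<or>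
    (\<exists>y. y \<noteq> x \<and> (\<exists>z. adj x z) \<and> (\<forall>z. adj x z \<longleftrightarrow> adj y z))"
  proof (rule bipartite_pendant_or_twins[OF cs(1) ne, where side = "\<lambda>x. x \<in> B"])
    show "x \<in> E \<and> y \<in> E" if "adj x y" for x y using that BE unfolding adj_def by blast
    show "adj y x" if "adj x y" for x y using that unfolding adj_def by blast
    show "(x \<in> B) \<noteq> (y \<in> B)" if "adj x y" for x y using that unfolding adj_def by blast
    show "\<not> domino adj v a z b w x" for v a z b w x using K4_minor_of_domino[OF C F adj_def] no by blast
    show "\<not> hole adj v p m" for v p m using K4_minor_of_hole[OF C F adj_def] no by blast
  qed
  then obtain x where xE: "x \<in> E" and x: "(\<forall>y. \<not> adj x y) \<or> (\<exists>y. \<forall>z. adj x z \<longleftrightarrow> z = y) \<or>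
    (\<exists>y. y \<noteq> x \<and> (\<exists>z. adj x z) \<and> (\<forall>z. adj x z \<longleftrightarrow> adj y z))" by (elim bexE)
  have goalI: ?thesis if "{x} \<in> \<C> \<or> (\<forall>Z\<in>\<C>. x \<notin> Z) \<or>
    (\<exists>f\<in>E. f \<noteq> x \<and> ({x, f} \<in> \<C> \<or> (\<forall>Z\<in>\<C>. x \<in> Z \<longleftrightarrow> f \<in> Z)))"
    using that xE by (rule bexI)
  from x consider (isolated) "\<forall>y. \<not> adj x y" | (pendant) y where "\<forall>z. adj x z \<longleftrightarrow> z = y"
    | (twins) y z where "y \<noteq> x" "adj x z" "\<forall>z. adj x z \<longleftrightarrow> adj y z" by blast
  thus ?thesis
  proof cases
    case isolated
    show ?thesis
    proof (cases "x \<in> B")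
      case True
      have "x \<notin> Z" if "Z \<in> \<C>" for Z
      proof -
        have "{c \<in> Z - B. x \<in> T c} = {}" unfolding NB[OF that True] using isolated by blast
        thus ?thesis using mem[OF that True] by (simp only: card.empty even_zero not_True_eq_False not_False_eq_True)
      qed
      thus ?thesis by (intro goalI) blast
    next
      case False
      hence "T x = {}" using NC[of x] xE isolated by blast
      hence "{x} \<in> \<C>" using T(2)[of x] xE False by simp
      thus ?thesis by (intro goalI) blast
    qed
  next
    case pendant
    have xy: "adj x y" using pendant by blast
    have yE: "y \<in> E" "y \<noteq> x" using xy BE unfolding adj_def by auto
    show ?thesis
    proof (cases "x \<in> B")
      case True
      have yB: "y \<notin> B" using xy True unfolding adj_def by blast
      have "x \<in> Z \<longleftrightarrow> y \<in> Z" if "Z \<in> \<C>" for Z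
      proof -
        have eq: "{c \<in> Z - B. x \<in> T c} = (if y \<in> Z then {y} else {})"
          unfolding NB[OF that True] using pendant yB by auto
        show ?thesis unfolding mem[OF that True] eq by simp
      qed
      thus ?thesis using yE by (intro goalI) blast
    next
      case False
      have "T x = {y}" using NC[of x] xE False pendant by blast
      hence "{x, y} \<in> \<C>" using T(2)[of x] xE False by simp
      thus ?thesis using yE by (intro goalI) blast
    qed
  next
    case twins
    have yz: "adj y z" using twins(2,3) by blast
    have yE: "y \<in> E" using yz BE unfolding adj_def by blast
    show ?thesis
    proof (cases "x \<in> B")
      case True
      have yB: "y \<in> B" using True twins(2) yz unfolding adj_def by blast
      have "x \<in> Z \<longleftrightarrow> y \<in> Z" if "Z \<in> \<C>" for Z
      proof -
        have eq: "{c \<in> Z - B. x \<in> T c} = {c \<in> Z - B. y \<in> T c}"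
          unfolding NB[OF that True] NB[OF that yB] using twins(3) by blast
        show ?thesis unfolding mem[OF that True] mem[OF that yB] eq ..
      qed
      thus ?thesis using yE twins(1) by (intro goalI) blast
    next
      case False
      have yB: "y \<notin> B" using False twins(2) yz unfolding adj_def by blast
      have "T x = T y" using NC[of x] NC[of y] xE yE False yB twins(3) by simp
      moreover have "x \<notin> T y" "y \<notin> T y" using T(1)[of y] yE False yB by auto
      ultimately have "sym_diff (insert x (T x)) (insert y (T y)) = {x, y}" using twins(1) by auto
      hence "{x, y} \<in> \<C>" using cs(4)[OF T(2)[of x] T(2)[of y]] xE yE False yB by simp
      thus ?thesis using yE twins(1) by (intro goalI) blast
    qed
  qed
qed

lemma minor_cycles_minor_cycles:
  assumes "F \<union> Y' \<subseteq> G" "G \<inter> Y = {}"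
  shows "minor_cycles (minor_cycles \<C> Y G) Y' F = minor_cycles \<C> (Y \<union> Y') F"
proof
  show "minor_cycles (minor_cycles \<C> Y G) Y' F \<subseteq> minor_cycles \<C> (Y \<union> Y') F"
  proof
    fix X assume "X \<in> minor_cycles (minor_cycles \<C> Y G) Y' F"
    then obtain Z where Z: "Z \<in> \<C>" "Z \<subseteq> G \<union> Y" "Z \<inter> G \<subseteq> F \<union> Y'" "X = (Z \<inter> G) \<inter> F"
      unfolding minor_cycles_def by blast
    have "Z \<subseteq> F \<union> (Y \<union> Y')" "X = Z \<inter> F" using Z assms by blast+
    thus "X \<in> minor_cycles \<C> (Y \<union> Y') F" using minor_cyclesI[OF Z(1)] by simp
  qed
  show "minor_cycles \<C> (Y \<union> Y') F \<subseteq> minor_cycles (minor_cycles \<C> Y G) Y' F"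
  proof
    fix X assume "X \<in> minor_cycles \<C> (Y \<union> Y') F"
    then obtain Z where Z: "Z \<in> \<C>" "Z \<subseteq> F \<union> (Y \<union> Y')" "X = Z \<inter> F"
      unfolding minor_cycles_def by blast
    have "Z \<subseteq> G \<union> Y" "Z \<inter> G \<subseteq> F \<union> Y'" "X = (Z \<inter> G) \<inter> F" using Z assms by blast+
    thus "X \<in> minor_cycles (minor_cycles \<C> Y G) Y' F"
      using minor_cyclesI[OF minor_cyclesI[OF Z(1)]] by simp
  qed
qed

lemma K4_minor_of_minor:
  assumes "K4_minor G (minor_cycles \<C> Y G)" "Y \<subseteq> E" "G \<subseteq> E - Y"
  shows "K4_minor E \<C>"
proof -
  obtain Y' a b c x y z where Y': "Y' \<subseteq> G" "{a, b, c, x, y, z} \<subseteq> G - Y'"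
    "K4_at (minor_cycles (minor_cycles \<C> Y G) Y' {a, b, c, x, y, z}) a b c x y z"
    using assms(1) unfolding K4_minor_iff by (elim exE conjE)
  have "minor_cycles (minor_cycles \<C> Y G) Y' {a, b, c, x, y, z} = minor_cycles \<C> (Y \<union> Y') {a, b, c, x, y, z}"
    by (rule minor_cycles_minor_cycles) (use Y'(1,2) assms(3) in blast)+
  hence K: "K4_at (minor_cycles \<C> (Y \<union> Y') {a, b, c, x, y, z}) a b c x y z" using Y'(3) by simp
  have sub: "Y \<union> Y' \<subseteq> E" "{a, b, c, x, y, z} \<subseteq> E - (Y \<union> Y')" using Y'(1,2) assms(2,3) by blast+
  show ?thesis unfolding K4_minor_iff
    by (rule exI[of _ "Y \<union> Y'"], rule exI[of _ a], rule exI[of _ b], rule exI[of _ c],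
        rule exI[of _ x], rule exI[of _ y], rule exI[of _ z], intro conjI sub K)
qed

text \<open>
  Induction on the ground set. An element that is a loop, a coloop or in a parallel pair is
  deleted, an element of a series pair is contracted, and the presentation of the smaller
  matroid is extended again.
\<close>
theorem cotransversal_of_no_K4_minor:
  assumes "cycle_space E \<C>" "\<not> K4_minor E \<C>"
  shows "cotransversal E (cycle_free \<C>)"
proof -
  have "finite E" using cycle_spaceD(1)[OF assms(1)] .
  thus ?thesis using assms
  proof (induction E arbitrary: \<C> rule: finite_psubset_induct)
    case (psubset E)
    note cs = cycle_spaceD[OF psubset.prems(1)]
    show ?case
    proof (cases "E = {}")
      case True
      have "\<C> \<subseteq> {{}}" using cs(2) True by blast
      thus ?thesis unfolding cotransversal_def True
        by (intro exI[of _ "{}"] exI[of _ "\<lambda>_. {}"] exI[of _ "\<lambda>_. 0"]) (auto simp: cycle_free_def avoidable_def)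
    next
      case False
      obtain e where e: "e \<in> E" and red: "{e} \<in> \<C> \<or> (\<forall>Z\<in>\<C>. e \<notin> Z) \<or>
        (\<exists>f\<in>E. f \<noteq> e \<and> ({e, f} \<in> \<C> \<or> (\<forall>Z\<in>\<C>. e \<in> Z \<longleftrightarrow> f \<in> Z)))"
        using series_parallel_element[OF psubset.prems(1) False psubset.prems(2)] by (elim bexE)
      have IH: "cotransversal (E - {e}) (cycle_free (minor_cycles \<C> Y (E - {e})))" if "Y \<subseteq> {e}" for Y
      proof (rule psubset.IH)
        show "E - {e} \<subset> E" using e by blast
        show "cycle_space (E - {e}) (minor_cycles \<C> Y (E - {e}))"
          by (rule cycle_space_minor_cycles[OF psubset.prems(1)]) blast
        show "\<not> K4_minor (E - {e}) (minor_cycles \<C> Y (E - {e}))"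
          using K4_minor_of_minor[of "E - {e}" \<C> Y E] psubset.prems(2) that e by blast
      qed
      have del: "cotransversal (E - {e}) (cycle_free \<C>)"
      proof -
        have "cycle_free \<C> {}" unfolding cycle_free_def by blast
        hence eq: "cycle_free (minor_cycles \<C> {} (E - {e})) X \<longleftrightarrow> cycle_free \<C> X" if "X \<subseteq> E - {e}" for X
          using cycle_free_minor_cycles[of \<C> "{}" "E - {e}" X] that by simp
        have "cotransversal (E - {e}) (cycle_free (minor_cycles \<C> {} (E - {e}))) \<longleftrightarrow>
            cotransversal (E - {e}) (cycle_free \<C>)"
          by (rule cotransversal_cong) (rule eq)
        thus ?thesis using IH[of "{}"] by blast
      qed
      from red consider (loop) "{e} \<in> \<C>" | (coloop) "\<forall>Z\<in>\<C>. e \<notin> Z"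
        | (parallel) f where "f \<in> E" "f \<noteq> e" "{e, f} \<in> \<C>"
        | (series) f where "f \<in> E" "f \<noteq> e" "\<forall>Z\<in>\<C>. e \<in> Z \<longleftrightarrow> f \<in> Z" by blast
      thus ?thesis
      proof cases
        case loop
        show ?thesis
          by (rule cotransversal_add_loop[OF cs(1) del]) (use loop in \<open>auto simp: cycle_free_def\<close>)
      next
        case coloop
        show ?thesis
          by (rule cotransversal_add_coloop[OF cs(1) del]) (use coloop in \<open>auto simp: cycle_free_def\<close>)
      next
        case parallel
        have swap: "cycle_free \<C> (insert q X)"
          if "{p, q} \<in> \<C>" "p \<noteq> q" "cycle_free \<C> (insert p X)" "p \<notin> X" "q \<notin> X" for p q X
          unfolding cycle_free_def
        proof (intro ballI impI)
          fix Z assume Z: "Z \<in> \<C>" "Z \<subseteq> insert q X"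
          show "Z = {}"
          proof (cases "q \<in> Z")
            case True
            have "sym_diff Z {p, q} \<subseteq> insert p X" using Z(2) True by blast
            hence "sym_diff Z {p, q} = {}"
              by (rule that(3)[unfolded cycle_free_def, rule_format, OF cs(4)[OF Z(1) that(1)]])
            thus ?thesis using Z(2) that(2,4) by blast
          next
            case False
            hence "Z \<subseteq> insert p X" using Z(2) by blast
            thus ?thesis using that(3) Z(1) unfolding cycle_free_def by simp
          qed
        qed
        show ?thesis
        proof (rule cotransversal_add_parallel[OF cs(1) e parallel(1) parallel(2)[symmetric] del])
          fix X assume X: "X \<subseteq> E"
          show "cycle_free \<C> X \<longleftrightarrow> \<not> (e \<in> X \<and> f \<in> X) \<and> cycle_free \<C> (if e \<in> X then insert f (X - {e}) else X)"
          proof (cases "e \<in> X \<and> f \<in> X")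
            case True
            hence "\<not> cycle_free \<C> X"
              using parallel(3) unfolding cycle_free_def by (intro notI) (drule bspec, assumption, simp)
            thus ?thesis using True by simp
          next
            case nb: False
            show ?thesis
            proof (cases "e \<in> X")
              case True
              have X0: "insert e (X - {e}) = X" "e \<notin> X - {e}" "f \<notin> X - {e}" using True nb by auto
              have "cycle_free \<C> (insert e (X - {e})) \<longleftrightarrow> cycle_free \<C> (insert f (X - {e}))"
              proof
                show "cycle_free \<C> (insert f (X - {e}))" if "cycle_free \<C> (insert e (X - {e}))"
                  by (rule swap[OF parallel(3) parallel(2)[symmetric] that X0(2,3)])
                have "{f, e} \<in> \<C>" using parallel(3) by (simp add: insert_commute)
                thus "cycle_free \<C> (insert e (X - {e}))" if "cycle_free \<C> (insert f (X - {e}))"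
                  by (rule swap[OF _ parallel(2) that X0(3,2)])
              qed
              thus ?thesis unfolding X0(1) using True nb by simp
            qed simp
          qed
        qed
      next
        case series
        have free_e: "cycle_free \<C> {e}" unfolding cycle_free_def
        proof (intro ballI impI)
          fix Z assume "Z \<in> \<C>" "Z \<subseteq> {e}"
          thus "Z = {}" using series(2,3) by blast
        qed
        have con: "cotransversal (E - {e}) (\<lambda>X. cycle_free \<C> (insert e X))"
        proof -
          have eq: "cycle_free (minor_cycles \<C> {e} (E - {e})) X \<longleftrightarrow> cycle_free \<C> (insert e X)" if "X \<subseteq> E - {e}" for X
            using cycle_free_minor_cycles[OF free_e, of "E - {e}" X] that by simp
          have "cotransversal (E - {e}) (cycle_free (minor_cycles \<C> {e} (E - {e}))) \<longleftrightarrow>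
              cotransversal (E - {e}) (\<lambda>X. cycle_free \<C> (insert e X))"
            by (rule cotransversal_cong) (rule eq)
          thus ?thesis using IH[of "{e}"] by blast
        qed
        show ?thesis
        proof (rule cotransversal_add_series[OF cs(1) e series(1) series(2)[symmetric] con])
          fix X assume X: "X \<subseteq> E"
          show "cycle_free \<C> X \<longleftrightarrow>
            cycle_free \<C> (insert e (if e \<in> X \<and> f \<in> X then X - {e} else X - {e, f}))"
          proof (cases "e \<in> X \<and> f \<in> X")
            case True thus ?thesis by (simp add: insert_absorb)
          next
            case False
            have eq: "Z \<subseteq> X \<longleftrightarrow> Z \<subseteq> insert e (X - {e, f})" if "Z \<in> \<C>" for Z
              using series(2,3) False that by blast
            show ?thesis unfolding if_not_P[OF False] cycle_free_def
              by (intro ball_cong refl) (simp only: eq)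
          qed
        qed
      qed
    qed
  qed
qed

lemma binary_gammoid_iff_no_K4_minor:
  assumes C: "cycle_space E \<C>" and bin: "binary (cycle_space_matroid E \<C>)"
  shows "binary_gammoid (cycle_space_matroid E \<C>) \<longleftrightarrow> \<not> K4_minor E \<C>"
proof -
  let ?M = "cycle_space_matroid E \<C>"
  have "gammoid ?M \<longleftrightarrow> cotransversal E (\<lambda>X. X \<in> indeps ?M)"
    using gammoid_iff_cotransversal[OF is_matroid_cycle_space_matroid[OF C]]
    by (simp add: cycle_space_matroid_def)
  also have "\<dots> \<longleftrightarrow> cotransversal E (cycle_free \<C>)"
    by (rule cotransversal_cong) (simp add: cycle_space_matroid_def)
  also have "\<dots> \<longleftrightarrow> \<not> K4_minor E \<C>"
    using cotransversal_no_K4_minor[OF C] cotransversal_of_no_K4_minor[OF C] by blast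
  finally show ?thesis unfolding binary_gammoid_def using bin by simp
qed

section \<open>Splittings and the minors $M(G_2)$ and $M(G_4)$\<close>

text \<open>
  The classes of parallel edges are \<open>p p'\<close>, \<open>q q'\<close> and \<open>r\<close>, and \<open>l\<close> is the loop. The loop may
  belong to a cycle or not, and therefore no equation mentions it.
\<close>
definition G2_parity :: pattern where
  "G2_parity p p' q q' r l \<longleftrightarrow> (r \<longleftrightarrow> (p \<noteq> p')) \<and> (r \<longleftrightarrow> (q \<noteq> q'))"

definition G4_parity :: pattern where
  "G4_parity p p' q q' r r' \<longleftrightarrow> ((r \<noteq> r') \<longleftrightarrow> (p \<noteq> p')) \<and> ((r \<noteq> r') \<longleftrightarrow> (q \<noteq> q'))"

abbreviation "G2_at \<equiv> matches G2_parity"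
abbreviation "G2_minor \<equiv> pattern_minor G2_parity"
abbreviation "G4_at \<equiv> matches G4_parity"
abbreviation "G4_minor \<equiv> pattern_minor G4_parity"
lemmas G2_minor_iff = pattern_minor_def[of G2_parity]
lemmas G4_minor_iff = pattern_minor_def[of G4_parity]

lemma G2_at_iff:
  "G2_at \<D> p p' q q' r l \<longleftrightarrow> distinct [p, p', q, q', r, l] \<and>
     (\<forall>Z\<subseteq>{p, p', q, q', r, l}. Z \<in> \<D> \<longleftrightarrow>
        (r \<in> Z \<longleftrightarrow> ((p \<in> Z) \<noteq> (p' \<in> Z))) \<and> (r \<in> Z \<longleftrightarrow> ((q \<in> Z) \<noteq> (q' \<in> Z))))"
  unfolding matches_def G2_parity_def ..

lemma G4_at_iff:
  "G4_at \<D> p p' q q' r r' \<longleftrightarrow> distinct [p, p', q, q', r, r'] \<and>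
     (\<forall>Z\<subseteq>{p, p', q, q', r, r'}. Z \<in> \<D> \<longleftrightarrow>
        (((r \<in> Z) \<noteq> (r' \<in> Z)) \<longleftrightarrow> ((p \<in> Z) \<noteq> (p' \<in> Z))) \<and>
        (((r \<in> Z) \<noteq> (r' \<in> Z)) \<longleftrightarrow> ((q \<in> Z) \<noteq> (q' \<in> Z))))"
  unfolding matches_def G4_parity_def ..

lemma minor_cycles_split_cycles:
  assumes "H \<subseteq> F"
  shows "minor_cycles (split_cycles \<C> H) Y F = split_cycles (minor_cycles \<C> Y F) H"
proof -
  have FH: "Z \<inter> F \<inter> H = Z \<inter> H" for Z using assms by blast
  show ?thesis
  proof (intro set_eqI iffI)
    fix X assume "X \<in> minor_cycles (split_cycles \<C> H) Y F"
    then obtain Z where Z: "Z \<in> \<C>" "even (card (Z \<inter> H))" "Z \<subseteq> F \<union> Y" "X = Z \<inter> F"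
      unfolding minor_cycles_def split_cycles_def by blast
    show "X \<in> split_cycles (minor_cycles \<C> Y F) H"
      unfolding split_cycles_def Z(4) mem_Collect_eq FH using minor_cyclesI[OF Z(1,3)] Z(2) by (rule conjI)
  next
    fix X assume "X \<in> split_cycles (minor_cycles \<C> Y F) H"
    then obtain Z where Z: "Z \<in> \<C>" "Z \<subseteq> F \<union> Y" "X = Z \<inter> F" "even (card (X \<inter> H))"
      unfolding minor_cycles_def split_cycles_def by blast
    have "Z \<in> split_cycles \<C> H" using Z(1,4) unfolding split_cycles_def Z(3) FH by simp
    thus "X \<in> minor_cycles (split_cycles \<C> H) Y F" unfolding Z(3) using Z(2) by (rule minor_cyclesI)
  qed
qed

lemma even_card_Int_three:
  assumes "distinct [x, y, z]"
  shows "even (card (X \<inter> {x, y, z})) \<longleftrightarrow> (x \<in> X \<longleftrightarrow> ((y \<in> X) \<noteq> (z \<in> X)))"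
proof -
  have "odd (card (X \<inter> {x, y, z})) \<longleftrightarrow> (x \<in> X) \<noteq> ((y \<in> X) \<noteq> (z \<in> X))"
    using odd_card_three[OF assms, of X "\<lambda>_. True"] by (simp only: simp_thms Collect_mem_eq)
  thus ?thesis by blast
qed

text \<open>
  With vectors \<open>p = p'\<close>, \<open>q = q'\<close>, \<open>r = p + q\<close> and \<open>l = 0\<close>, the new coordinate is 1 at \<open>p\<close>,
  \<open>q\<close>, \<open>l\<close>. The six vectors are then distinct and nonzero, and \<open>p + q + l\<close> lifted in this way,
  the vector (1, 1, 1), is the one missing from the Fano plane.
\<close>
lemma K4_at_of_G2_at:
  assumes "G2_at \<D> p p' q q' r l"
  shows "K4_at (split_cycles \<D> {p, q, l}) p' q' l r q p"
proof -
  have d: "distinct [p, q, l]" "distinct [p', q', l, r, q, p]" using assms unfolding G2_at_iff by auto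
  have eq: "{p', q', l, r, q, p} = {p, p', q, q', r, l}" by auto
  have "Z \<in> split_cycles \<D> {p, q, l} \<longleftrightarrow> ((p' \<in> Z) \<longleftrightarrow> ((r \<in> Z) \<noteq> (p \<in> Z))) \<and>
      ((q' \<in> Z) \<longleftrightarrow> ((r \<in> Z) \<noteq> (q \<in> Z))) \<and> ((l \<in> Z) \<longleftrightarrow> ((q \<in> Z) \<noteq> (p \<in> Z)))"
    if "Z \<subseteq> {p, p', q, q', r, l}" for Z
  proof -
    have "Z \<in> \<D> \<longleftrightarrow> (r \<in> Z \<longleftrightarrow> ((p \<in> Z) \<noteq> (p' \<in> Z))) \<and> (r \<in> Z \<longleftrightarrow> ((q \<in> Z) \<noteq> (q' \<in> Z)))"
      using assms that unfolding G2_at_iff by blast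
    thus ?thesis unfolding split_cycles_def mem_Collect_eq even_card_Int_three[OF d(1)] by blast
  qed
  thus ?thesis unfolding K4_at_iff eq using d(2) by blast
qed

text \<open>
  The new coordinate separates each of the three parallel pairs, so that the Fano plane
  without the vector (0, 0, 1) results.
\<close>
lemma K4_at_of_G4_at:
  assumes "G4_at \<D> p p' q q' r r'"
  shows "K4_at (split_cycles \<D> {p, q, r}) p' q' r r' p q"
proof -
  have d: "distinct [p, q, r]" "distinct [p', q', r, r', p, q]" using assms unfolding G4_at_iff by auto
  have eq: "{p', q', r, r', p, q} = {p, p', q, q', r, r'}" by auto
  have "Z \<in> split_cycles \<D> {p, q, r} \<longleftrightarrow> ((p' \<in> Z) \<longleftrightarrow> ((r' \<in> Z) \<noteq> (q \<in> Z))) \<and>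
      ((q' \<in> Z) \<longleftrightarrow> ((r' \<in> Z) \<noteq> (p \<in> Z))) \<and> ((r \<in> Z) \<longleftrightarrow> ((p \<in> Z) \<noteq> (q \<in> Z)))"
    if "Z \<subseteq> {p, p', q, q', r, r'}" for Z
  proof -
    have "Z \<in> \<D> \<longleftrightarrow> (((r \<in> Z) \<noteq> (r' \<in> Z)) \<longleftrightarrow> ((p \<in> Z) \<noteq> (p' \<in> Z))) \<and>
        (((r \<in> Z) \<noteq> (r' \<in> Z)) \<longleftrightarrow> ((q \<in> Z) \<noteq> (q' \<in> Z)))"
      using assms that unfolding G4_at_iff by blast
    thus ?thesis unfolding split_cycles_def mem_Collect_eq even_card_Int_three[OF d(1)] by blast
  qed
  thus ?thesis unfolding K4_at_iff eq using d(2) by blast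
qed

text \<open>
  The three elements are taken inside the minor, so splitting commutes with passing to the
  minor.
\<close>
lemma splitting_of_G2_G4_minor:
  assumes "G2_minor E \<C> \<or> G4_minor E \<C>"
  shows "\<exists>H\<subseteq>E. card H = 3 \<and> K4_minor E (split_cycles \<C> H)"
  using assms
proof
  assume "G2_minor E \<C>"
  then obtain Y p p' q q' r l where Y: "Y \<subseteq> E" "{p, p', q, q', r, l} \<subseteq> E - Y"
    and G: "G2_at (minor_cycles \<C> Y {p, p', q, q', r, l}) p p' q q' r l"
    unfolding G2_minor_iff by (elim exE conjE)
  have eq: "{p', q', l, r, q, p} = {p, p', q, q', r, l}" by auto
  have "K4_at (minor_cycles (split_cycles \<C> {p, q, l}) Y {p', q', l, r, q, p}) p' q' l r q p"
    unfolding eq using K4_at_of_G2_at[OF G] minor_cycles_split_cycles[of "{p, q, l}" "{p, p', q, q', r, l}" \<C> Y] by simp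
  hence "K4_minor E (split_cycles \<C> {p, q, l})"
    unfolding K4_minor_iff using Y unfolding eq[symmetric] by blast
  moreover have "card {p, q, l} = 3" "{p, q, l} \<subseteq> E" using G Y unfolding G2_at_iff by auto
  ultimately show ?thesis by blast
next
  assume "G4_minor E \<C>"
  then obtain Y p p' q q' r r' where Y: "Y \<subseteq> E" "{p, p', q, q', r, r'} \<subseteq> E - Y"
    and G: "G4_at (minor_cycles \<C> Y {p, p', q, q', r, r'}) p p' q q' r r'"
    unfolding G4_minor_iff by (elim exE conjE)
  have eq: "{p', q', r, r', p, q} = {p, p', q, q', r, r'}" by auto
  have "K4_at (minor_cycles (split_cycles \<C> {p, q, r}) Y {p', q', r, r', p, q}) p' q' r r' p q"
    unfolding eq using K4_at_of_G4_at[OF G] minor_cycles_split_cycles[of "{p, q, r}" "{p, p', q, q', r, r'}" \<C> Y] by simp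
  hence "K4_minor E (split_cycles \<C> {p, q, r})"
    unfolding K4_minor_iff using Y unfolding eq[symmetric] by blast
  moreover have "card {p, q, r} = 3" "{p, q, r} \<subseteq> E" using G Y unfolding G4_at_iff by auto
  ultimately show ?thesis by blast
qed

text \<open>
  The booleans \<open>t1 Z\<close>, \<open>t2 Z\<close>, \<open>t3 Z\<close> are the syndrome of \<open>Z\<close> with respect to the three parity
  conditions of $K_4$, and cosets of \<open>\<K>\<close> correspond to syndromes. The syndrome of \<open>D\<close> is one
  of seven nonzero triples. Six of them are the vectors of single elements, which become
  loops; the remaining one, (1, 1, 1), is the sum of any pair of opposite edges, which become
  parallel.
\<close>
lemma K4_at_quotient:
  assumes K: "K4_at \<K> a b c x y z" and D: "D \<subseteq> {a, b, c, x, y, z}" "D \<notin> \<K>"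
    and iff: "\<And>Z. Z \<subseteq> {a, b, c, x, y, z} \<Longrightarrow> Z \<in> \<D> \<longleftrightarrow> Z \<in> \<K> \<or> sym_diff Z D \<in> \<K>"
  shows "G2_at \<D> b x c z y a \<or> G2_at \<D> a x c y z b \<or> G2_at \<D> a z b y x c \<or>
    G2_at \<D> a b y z c x \<or> G2_at \<D> b c x z a y \<or> G2_at \<D> a c x y b z \<or> G4_at \<D> b z c x a y"
proof -
  let ?F = "{a, b, c, x, y, z}"
  define t1 where "t1 Z \<longleftrightarrow> ((a \<in> Z) \<noteq> ((x \<in> Z) \<noteq> (z \<in> Z)))" for Z
  define t2 where "t2 Z \<longleftrightarrow> ((b \<in> Z) \<noteq> ((x \<in> Z) \<noteq> (y \<in> Z)))" for Z
  define t3 where "t3 Z \<longleftrightarrow> ((c \<in> Z) \<noteq> ((y \<in> Z) \<noteq> (z \<in> Z)))" for Z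
  have d: "distinct [a, b, c, x, y, z]" using K unfolding K4_at_iff by blast
  have Kt: "Z \<in> \<K> \<longleftrightarrow> \<not> t1 Z \<and> \<not> t2 Z \<and> \<not> t3 Z" if "Z \<subseteq> ?F" for Z
    using K that unfolding K4_at_iff t1_def t2_def t3_def by blast
  have sd: "e \<in> sym_diff Z D \<longleftrightarrow> ((e \<in> Z) \<noteq> (e \<in> D))" for e Z by blast
  have lin: "t1 (sym_diff Z D) \<longleftrightarrow> (t1 Z \<noteq> t1 D)" "t2 (sym_diff Z D) \<longleftrightarrow> (t2 Z \<noteq> t2 D)"
    "t3 (sym_diff Z D) \<longleftrightarrow> (t3 Z \<noteq> t3 D)" for Z
    unfolding t1_def t2_def t3_def sd by blast+
  have Dt: "Z \<in> \<D> \<longleftrightarrow> (\<not> t1 Z \<and> \<not> t2 Z \<and> \<not> t3 Z) \<or> (t1 Z \<longleftrightarrow> t1 D) \<and> (t2 Z \<longleftrightarrow> t2 D) \<and> (t3 Z \<longleftrightarrow> t3 D)"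
    if Z: "Z \<subseteq> ?F" for Z
  proof -
    have "sym_diff Z D \<subseteq> ?F" using Z D(1) by blast
    thus ?thesis using iff[OF Z] Kt[OF Z] Kt[of "sym_diff Z D"] lin[of Z] by blast
  qed
  have nz: "t1 D \<or> t2 D \<or> t3 D" using Kt[OF D(1)] D(2) by blast
  have perm: "{b, x, c, z, y, a} = ?F" "{a, x, c, y, z, b} = ?F" "{a, z, b, y, x, c} = ?F"
    "{a, b, y, z, c, x} = ?F" "{b, c, x, z, a, y} = ?F" "{a, c, x, y, b, z} = ?F" "{b, z, c, x, a, y} = ?F"
    by auto
  show ?thesis
  proof (cases "t1 D"; cases "t2 D"; cases "t3 D")
    assume s: "t1 D" "\<not> t2 D" "\<not> t3 D"
    have "Z \<in> \<D> \<longleftrightarrow> \<not> t2 Z \<and> \<not> t3 Z" if "Z \<subseteq> ?F" for Z using Dt[OF that] s by blast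
    hence "G2_at \<D> b x c z y a" unfolding G2_at_iff perm t2_def t3_def using d by auto
    thus ?thesis by simp
  next
    assume s: "\<not> t1 D" "t2 D" "\<not> t3 D"
    have "Z \<in> \<D> \<longleftrightarrow> \<not> t1 Z \<and> \<not> t3 Z" if "Z \<subseteq> ?F" for Z using Dt[OF that] s by blast
    hence "G2_at \<D> a x c y z b" unfolding G2_at_iff perm t1_def t3_def using d by auto
    thus ?thesis by simp
  next
    assume s: "\<not> t1 D" "\<not> t2 D" "t3 D"
    have "Z \<in> \<D> \<longleftrightarrow> \<not> t1 Z \<and> \<not> t2 Z" if "Z \<subseteq> ?F" for Z using Dt[OF that] s by blast
    hence "G2_at \<D> a z b y x c" unfolding G2_at_iff perm t1_def t2_def using d by auto
    thus ?thesis by simp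
  next
    assume s: "t1 D" "t2 D" "\<not> t3 D"
    have "Z \<in> \<D> \<longleftrightarrow> (t1 Z \<longleftrightarrow> t2 Z) \<and> \<not> t3 Z" if "Z \<subseteq> ?F" for Z using Dt[OF that] s by blast
    hence "G2_at \<D> a b y z c x" unfolding G2_at_iff perm t1_def t2_def t3_def using d by auto
    thus ?thesis by simp
  next
    assume s: "\<not> t1 D" "t2 D" "t3 D"
    have "Z \<in> \<D> \<longleftrightarrow> \<not> t1 Z \<and> (t2 Z \<longleftrightarrow> t3 Z)" if "Z \<subseteq> ?F" for Z using Dt[OF that] s by blast
    hence "G2_at \<D> b c x z a y" unfolding G2_at_iff perm t1_def t2_def t3_def using d by auto
    thus ?thesis by simp
  next
    assume s: "t1 D" "\<not> t2 D" "t3 D"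
    have "Z \<in> \<D> \<longleftrightarrow> \<not> t2 Z \<and> (t1 Z \<longleftrightarrow> t3 Z)" if "Z \<subseteq> ?F" for Z using Dt[OF that] s by blast
    hence "G2_at \<D> a c x y b z" unfolding G2_at_iff perm t1_def t2_def t3_def using d by auto
    thus ?thesis by simp
  next
    assume s: "t1 D" "t2 D" "t3 D"
    have "Z \<in> \<D> \<longleftrightarrow> (t1 Z \<longleftrightarrow> t2 Z) \<and> (t1 Z \<longleftrightarrow> t3 Z)" if "Z \<subseteq> ?F" for Z using Dt[OF that] s by blast
    hence "G4_at \<D> b z c x a y" unfolding G4_at_iff perm t1_def t2_def t3_def using d by auto
    thus ?thesis by simp
  qed (use nz in blast)
qed

text \<open>
  Two cycles that meet \<open>H\<close> oddly have a sum that meets \<open>H\<close> evenly. Hence \<open>\<K>\<close> has index at most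
  two in \<open>\<D>\<close>, and \<open>K4_at_quotient\<close> applies.
\<close>
lemma G2_G4_minor_of_splitting:
  assumes C: "cycle_space E \<C>" and no: "\<not> K4_minor E \<C>" and K4: "K4_minor E (split_cycles \<C> H)"
  shows "G2_minor E \<C> \<or> G4_minor E \<C>"
proof -
  obtain Y a b c x y z where Y: "Y \<subseteq> E" "{a, b, c, x, y, z} \<subseteq> E - Y"
    and K: "K4_at (minor_cycles (split_cycles \<C> H) Y {a, b, c, x, y, z}) a b c x y z"
    using K4 unfolding K4_minor_iff by (elim exE conjE)
  let ?F = "{a, b, c, x, y, z}"
  define \<K> where "\<K> = minor_cycles (split_cycles \<C> H) Y ?F"
  define \<D> where "\<D> = minor_cycles \<C> Y ?F"
  have FE: "?F \<subseteq> E" using Y(2) by (rule subset_trans) blast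
  have Ds: "cycle_space ?F \<D>" unfolding \<D>_def by (rule cycle_space_minor_cycles[OF C FE])
  have KD: "\<K> \<subseteq> \<D>" unfolding \<K>_def \<D>_def minor_cycles_def split_cycles_def by blast
  have diff: "sym_diff Z D \<in> \<K>" if h: "Z \<in> \<D>" "Z \<notin> \<K>" "D \<in> \<D>" "D \<notin> \<K>" for Z D
  proof -
    obtain Z1 where Z1: "Z1 \<in> \<C>" "Z1 \<subseteq> ?F \<union> Y" "Z = Z1 \<inter> ?F"
      using h(1) unfolding \<D>_def minor_cycles_def by blast
    obtain D1 where D1: "D1 \<in> \<C>" "D1 \<subseteq> ?F \<union> Y" "D = D1 \<inter> ?F"
      using h(3) unfolding \<D>_def minor_cycles_def by blast
    have odd: "odd (card (Z1 \<inter> H))" "odd (card (D1 \<inter> H))"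
      using h(2,4) Z1 D1 minor_cyclesI[of _ "split_cycles \<C> H" ?F Y] unfolding \<K>_def split_cycles_def by blast+
    have fin: "finite Z1" "finite D1" using cycle_spaceD(1,2)[OF C] Z1(1) D1(1) finite_subset by metis+
    have "sym_diff Z1 D1 \<inter> H = sym_diff (Z1 \<inter> H) (D1 \<inter> H)" by blast
    hence "even (card (sym_diff Z1 D1 \<inter> H))" using sym_diff_parity[of "Z1 \<inter> H" "D1 \<inter> H"] odd fin by simp
    hence "sym_diff Z1 D1 \<in> split_cycles \<C> H"
      using cycle_spaceD(4)[OF C Z1(1) D1(1)] unfolding split_cycles_def by simp
    moreover have "sym_diff Z1 D1 \<subseteq> ?F \<union> Y" using Z1(2) D1(2) by blast
    ultimately have "sym_diff Z1 D1 \<inter> ?F \<in> \<K>" unfolding \<K>_def by (rule minor_cyclesI)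
    moreover have "sym_diff Z1 D1 \<inter> ?F = sym_diff Z D" using Z1(3) D1(3) by blast
    ultimately show ?thesis by simp
  qed
  have "\<D> \<noteq> \<K>"
  proof
    assume "\<D> = \<K>"
    hence "K4_at (minor_cycles \<C> Y ?F) a b c x y z" using K unfolding \<D>_def \<K>_def by simp
    thus False using no Y unfolding K4_minor_iff by blast
  qed
  then obtain D where D: "D \<in> \<D>" "D \<notin> \<K>" using KD by blast
  have iff: "Z \<in> \<D> \<longleftrightarrow> Z \<in> \<K> \<or> sym_diff Z D \<in> \<K>" for Z
  proof
    show "Z \<in> \<D> \<Longrightarrow> Z \<in> \<K> \<or> sym_diff Z D \<in> \<K>" using diff D by blast
    show "Z \<in> \<D>" if "Z \<in> \<K> \<or> sym_diff Z D \<in> \<K>"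
      using that
    proof
      assume "sym_diff Z D \<in> \<K>"
      hence "sym_diff (sym_diff Z D) D \<in> \<D>" using cycle_spaceD(4)[OF Ds _ D(1)] KD by blast
      moreover have "sym_diff (sym_diff Z D) D = Z" by blast
      ultimately show ?thesis by simp
    qed (use KD in blast)
  qed
  have "D \<subseteq> ?F" using cycle_spaceD(2)[OF Ds D(1)] .
  from K4_at_quotient[OF K[folded \<K>_def] this D(2) iff]
  have cases: "G2_at \<D> b x c z y a \<or> G2_at \<D> a x c y z b \<or> G2_at \<D> a z b y x c \<or>
    G2_at \<D> a b y z c x \<or> G2_at \<D> b c x z a y \<or> G2_at \<D> a c x y b z \<or> G4_at \<D> b z c x a y" .
  have minor: "pattern_minor P E \<C>" if "matches P \<D> p p' q q' r l" "{p, p', q, q', r, l} = ?F" for P p p' q q' r l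
    unfolding pattern_minor_def
    by (rule exI[of _ Y], rule exI[of _ p], rule exI[of _ p'], rule exI[of _ q], rule exI[of _ q'],
        rule exI[of _ r], rule exI[of _ l]) (use that Y in \<open>simp only: \<D>_def\<close>)
  have perm: "{b, x, c, z, y, a} = ?F" "{a, x, c, y, z, b} = ?F" "{a, z, b, y, x, c} = ?F"
    "{a, b, y, z, c, x} = ?F" "{b, c, x, z, a, y} = ?F" "{a, c, x, y, b, z} = ?F" "{b, z, c, x, a, y} = ?F"
    by auto
  show ?thesis
    using cases minor[OF _ perm(1)] minor[OF _ perm(2)] minor[OF _ perm(3)] minor[OF _ perm(4)] minor[OF _ perm(5)]
      minor[OF _ perm(6)] minor[OF _ perm(7)] by blast
qed

section \<open>Cycle matroids of the three graphs\<close>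

definition pattern_cycles :: "pattern \<Rightarrow> nat set set" where
  "pattern_cycles P = {I. I \<subseteq> {..<6} \<and> P (0 \<in> I) (1 \<in> I) (2 \<in> I) (3 \<in> I) (4 \<in> I) (5 \<in> I)}"

abbreviation "cycles_G2 \<equiv> pattern_cycles G2_parity"
abbreviation "cycles_G4 \<equiv> pattern_cycles G4_parity"

lemma cycles_G2_eq:
  "cycles_G2 = {Z. Z \<subseteq> {..<6} \<and> (4 \<in> Z \<longleftrightarrow> ((0 \<in> Z) \<noteq> (1 \<in> Z))) \<and> (4 \<in> Z \<longleftrightarrow> ((2 \<in> Z) \<noteq> (3 \<in> Z)))}"
  unfolding pattern_cycles_def G2_parity_def ..

lemma cycles_G4_eq:
  "cycles_G4 = {Z. Z \<subseteq> {..<6} \<and> (((4 \<in> Z) \<noteq> (5 \<in> Z)) \<longleftrightarrow> ((0 \<in> Z) \<noteq> (1 \<in> Z))) \<and>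
     (((4 \<in> Z) \<noteq> (5 \<in> Z)) \<longleftrightarrow> ((2 \<in> Z) \<noteq> (3 \<in> Z)))}"
  unfolding pattern_cycles_def G4_parity_def ..

lemma cycle_space_pattern_cycles:
  assumes "P False False False False False False"
    and add: "\<And>a b c d e f a' b' c' d' e' f'. P a b c d e f \<Longrightarrow> P a' b' c' d' e' f' \<Longrightarrow>
      P (a \<noteq> a') (b \<noteq> b') (c \<noteq> c') (d \<noteq> d') (e \<noteq> e') (f \<noteq> f')"
  shows "cycle_space {..<6} (pattern_cycles P)"
proof -
  have sd: "e \<in> sym_diff X Y \<longleftrightarrow> ((e \<in> X) \<noteq> (e \<in> Y))" for e :: nat and X Y by blast
  have "sym_diff X Y \<in> pattern_cycles P" if "X \<in> pattern_cycles P" "Y \<in> pattern_cycles P" for X Y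
  proof -
    have "sym_diff X Y \<subseteq> {..<6}" using that unfolding pattern_cycles_def by blast
    moreover have "P (0 \<in> X) (1 \<in> X) (2 \<in> X) (3 \<in> X) (4 \<in> X) (5 \<in> X)"
      "P (0 \<in> Y) (1 \<in> Y) (2 \<in> Y) (3 \<in> Y) (4 \<in> Y) (5 \<in> Y)"
      using that unfolding pattern_cycles_def by blast+
    ultimately show ?thesis
      unfolding pattern_cycles_def mem_Collect_eq sd by (intro conjI add)
  qed
  moreover have "{} \<in> pattern_cycles P" "pattern_cycles P \<subseteq> Pow {..<6}"
    using assms(1) by (simp_all add: pattern_cycles_def subset_iff)
  ultimately show ?thesis unfolding cycle_space_def by simp
qed

lemma cycle_space_cycles_G2: "cycle_space {..<6} cycles_G2"
  by (rule cycle_space_pattern_cycles) (unfold G2_parity_def, blast+)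

lemma cycle_space_cycles_G4: "cycle_space {..<6} cycles_G4"
  by (rule cycle_space_pattern_cycles) (unfold G4_parity_def, blast+)

lemma circuits_in_cycles_G2:
  "{5} \<in> cycles_G2" "{0, 1} \<in> cycles_G2" "{2, 3} \<in> cycles_G2"
  "{0, 2, 4} \<in> cycles_G2" "{0, 3, 4} \<in> cycles_G2" "{1, 2, 4} \<in> cycles_G2" "{1, 3, 4} \<in> cycles_G2"
  by (simp_all add: cycles_G2_eq)

lemma circuits_in_cycles_G4:
  "{0, 1} \<in> cycles_G4" "{2, 3} \<in> cycles_G4" "{4, 5} \<in> cycles_G4"
  "{0, 2, 4} \<in> cycles_G4" "{0, 3, 4} \<in> cycles_G4" "{1, 2, 4} \<in> cycles_G4" "{1, 3, 4} \<in> cycles_G4"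
  "{0, 2, 5} \<in> cycles_G4" "{0, 3, 5} \<in> cycles_G4" "{1, 2, 5} \<in> cycles_G4" "{1, 3, 5} \<in> cycles_G4"
  by (simp_all add: cycles_G4_eq)

text \<open>
  There are only three vertices, so a cycle has length at most three.
\<close>
lemma cycle_edge_set_cases:
  assumes "is_cycle_edge_set (graph_of_ends xs) C"
  shows "(\<exists>e<length xs. \<exists>x. xs ! e = {x} \<and> C = {e}) \<or>
    (\<exists>e<length xs. \<exists>f<length xs. \<exists>x y. e \<noteq> f \<and> x \<noteq> y \<and> xs ! e = {x, y} \<and> xs ! f = {x, y} \<and> C = {e, f}) \<or>
    (\<exists>e<length xs. \<exists>f<length xs. \<exists>g<length xs.
       xs ! e = {vu, vv} \<and> xs ! f = {vu, vw} \<and> xs ! g = {vv, vw} \<and> C = {e, f, g})"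
proof -
  obtain vs es where ve: "es \<noteq> []" "length vs = length es" "distinct vs" "distinct es"
    "set es \<subseteq> {..<length xs}" "C = set es"
    "\<forall>i<length es. xs ! (es ! i) = {vs ! i, vs ! (Suc i mod length es)}"
    using assms unfolding is_cycle_edge_set_def graph_of_ends_def by auto
  have v: "x \<in> {vu, vv, vw}" for x by (cases x) auto
  have "card (set vs) \<le> card {vu, vv, vw}" by (rule card_mono) (use v in auto)
  hence "length es \<le> 3" using ve(2,3) distinct_card[OF ve(3)] by simp
  moreover have "length es \<noteq> 0" using ve(1) by simp
  ultimately consider "length es = 1" | "length es = 2" | "length es = 3" by linarith
  thus ?thesis
  proof cases
    case 1
    then obtain e where e: "es = [e]" by (auto simp: length_Suc_conv)
    have "xs ! e = {vs ! 0}" using ve(7)[rule_format, of 0] e by simp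
    thus ?thesis using ve(5,6) e by auto
  next
    case 2
    then obtain e f where e: "es = [e, f]" by (auto simp: length_Suc_conv numeral_2_eq_2)
    have "xs ! e = {vs ! 0, vs ! 1}" "xs ! f = {vs ! 1, vs ! 0}"
      using ve(7)[rule_format, of 0] ve(7)[rule_format, of 1] e by auto
    moreover have "vs ! 0 \<noteq> vs ! 1" using ve(2,3) e by (simp add: nth_eq_iff_index_eq)
    moreover have "e < length xs" "f < length xs" "e \<noteq> f" "C = {e, f}" using ve(4,5,6) e by auto
    ultimately have "\<exists>e<length xs. \<exists>f<length xs. \<exists>x y. e \<noteq> f \<and> x \<noteq> y \<and> xs ! e = {x, y} \<and> xs ! f = {x, y} \<and> C = {e, f}"
      by (intro exI[of _ e] exI[of _ f] conjI exI[of _ "vs ! 0"] exI[of _ "vs ! 1"]) (auto simp: insert_commute)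
    thus ?thesis by (rule disjI2[OF disjI1])
  next
    case 3
    then obtain e f g where e: "es = [e, f, g]" by (auto simp: length_Suc_conv numeral_3_eq_3)
    obtain x y z where vs: "vs = [x, y, z]" using ve(2) 3 by (auto simp: length_Suc_conv numeral_3_eq_3)
    have ends: "xs ! e = {x, y}" "xs ! f = {y, z}" "xs ! g = {z, x}"
      using ve(7)[rule_format, of 0, unfolded e vs] ve(7)[rule_format, of 1, unfolded e vs]
        ve(7)[rule_format, of 2, unfolded e vs] by simp_all
    have d: "x \<noteq> y" "x \<noteq> z" "y \<noteq> z" using ve(3) vs by auto
    have l: "e < length xs" "f < length xs" "g < length xs" "C = {e, f, g}" using ve(5,6) e by auto
    have tri: "\<exists>e<length xs. \<exists>f<length xs. \<exists>g<length xs.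
       xs ! e = {vu, vv} \<and> xs ! f = {vu, vw} \<and> xs ! g = {vv, vw} \<and> C = {e, f, g}"
      if "e' < length xs" "f' < length xs" "g' < length xs" "xs ! e' = {vu, vv}" "xs ! f' = {vu, vw}"
        "xs ! g' = {vv, vw}" "C = {e', f', g'}" for e' f' g'
      by (rule exI[of _ e'], intro conjI that(1), rule exI[of _ f'], intro conjI that(2),
          rule exI[of _ g'], intro conjI that)
    have "\<exists>e<length xs. \<exists>f<length xs. \<exists>g<length xs.
       xs ! e = {vu, vv} \<and> xs ! f = {vu, vw} \<and> xs ! g = {vv, vw} \<and> C = {e, f, g}"
    proof (cases x; cases y; cases z)
      assume s: "x = vu" "y = vv" "z = vw"
      show ?thesis by (rule tri[of e g f]) (use ends l in \<open>simp_all add: s insert_commute\<close>)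
    next
      assume s: "x = vu" "y = vw" "z = vv"
      show ?thesis by (rule tri[of g e f]) (use ends l in \<open>simp_all add: s insert_commute\<close>)
    next
      assume s: "x = vv" "y = vu" "z = vw"
      show ?thesis by (rule tri[of e f g]) (use ends l in \<open>simp_all add: s insert_commute\<close>)
    next
      assume s: "x = vv" "y = vw" "z = vu"
      show ?thesis by (rule tri[of g f e]) (use ends l in \<open>simp_all add: s insert_commute\<close>)
    next
      assume s: "x = vw" "y = vu" "z = vv"
      show ?thesis by (rule tri[of f e g]) (use ends l in \<open>simp_all add: s insert_commute\<close>)
    next
      assume s: "x = vw" "y = vv" "z = vu"
      show ?thesis by (rule tri[of f g e]) (use ends l in \<open>simp_all add: s insert_commute\<close>)
    qed (use d in auto)
    thus ?thesis by (rule disjI2[OF disjI2])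
  qed
qed

lemma cycle_edge_set_loop:
  assumes "e < length xs" "xs ! e = {x}"
  shows "is_cycle_edge_set (graph_of_ends xs) {e}"
  unfolding is_cycle_edge_set_def graph_of_ends_def
  by (rule exI[of _ "[x]"], rule exI[of _ "[e]"]) (use assms in \<open>cases x; auto\<close>)

lemma cycle_edge_set_parallel:
  assumes "e < length xs" "f < length xs" "e \<noteq> f" "x \<noteq> y" "xs ! e = {x, y}" "xs ! f = {x, y}"
  shows "is_cycle_edge_set (graph_of_ends xs) {e, f}"
proof -
  have "{x, y} \<subseteq> {vu, vv, vw}" by (cases x; cases y) auto
  thus ?thesis
    unfolding is_cycle_edge_set_def graph_of_ends_def using assms
    by (intro exI[of _ "[x, y]"] exI[of _ "[e, f]"]) (auto simp: less_Suc_eq insert_commute)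
qed

lemma cycle_edge_set_triangle:
  assumes "e < length xs" "f < length xs" "g < length xs"
    "xs ! e = {vu, vv}" "xs ! f = {vu, vw}" "xs ! g = {vv, vw}"
  shows "is_cycle_edge_set (graph_of_ends xs) {e, f, g}"
proof -
  have "{vu, vv} \<noteq> {vu, vw}" "{vu, vv} \<noteq> {vv, vw}" "{vu, vw} \<noteq> {vv, vw}" by auto
  hence "distinct [e, g, f]" using assms by auto
  thus ?thesis
    unfolding is_cycle_edge_set_def graph_of_ends_def using assms
    by (intro exI[of _ "[vu, vv, vw]"] exI[of _ "[e, g, f]"]) (auto simp: less_Suc_eq insert_commute)
qed

lemma cycle_matroid_eq_cycle_space_matroid:
  assumes "\<And>C. is_cycle_edge_set G C \<Longrightarrow> C \<in> \<C> \<and> C \<noteq> {}"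
    and "\<And>Z. Z \<in> \<C> \<Longrightarrow> Z \<noteq> {} \<Longrightarrow> \<exists>C\<subseteq>Z. is_cycle_edge_set G C"
  shows "cycle_matroid G = cycle_space_matroid (medges G) \<C>"
proof -
  have "(\<forall>C\<subseteq>X. \<not> is_cycle_edge_set G C) \<longleftrightarrow> cycle_free \<C> X" for X
  proof
    show "cycle_free \<C> X" if "\<forall>C\<subseteq>X. \<not> is_cycle_edge_set G C"
      unfolding cycle_free_def using assms(2) that by (meson subset_trans)
    show "\<forall>C\<subseteq>X. \<not> is_cycle_edge_set G C" if "cycle_free \<C> X"
      using assms(1) that unfolding cycle_free_def by meson
  qed
  thus ?thesis unfolding cycle_matroid_def cycle_space_matroid_def by simp
qed

lemma less_6_cases: "(e::nat) < 6 \<longleftrightarrow> e = 0 \<or> e = 1 \<or> e = 2 \<or> e = 3 \<or> e = 4 \<or> e = 5"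
  by auto

text \<open>
  The three graphs agree in the edges 0 to 4; edge 5 is a loop or a second edge between \<open>vv\<close>
  and \<open>vw\<close>. The sets \<open>W\<close> and \<open>L\<close> collect the edges between these two vertices and the loops.
\<close>
lemma cycle_matroid_doubled_triangle:
  assumes len: "length xs = 6"
    and uv: "\<And>e. e < 6 \<Longrightarrow> xs ! e = {vu, vv} \<longleftrightarrow> e \<in> {0, 1}"
    and uw: "\<And>e. e < 6 \<Longrightarrow> xs ! e = {vu, vw} \<longleftrightarrow> e \<in> {2, 3}"
    and vw: "\<And>e. e < 6 \<Longrightarrow> xs ! e = {vv, vw} \<longleftrightarrow> e \<in> W"
    and loop: "\<And>e. e < 6 \<Longrightarrow> (\<exists>y. xs ! e = {y}) \<longleftrightarrow> e \<in> L"
    and WL: "W = {4} \<and> L = {5} \<and> \<G> = cycles_G2 \<or> W = {4, 5} \<and> L = {} \<and> \<G> = cycles_G4"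
  shows "cycle_matroid (graph_of_ends xs) = cycle_space_matroid {..<6} \<G>"
proof -
  have W6: "e < 6" if "e \<in> W \<union> L" for e using WL that by auto
  have loopG: "{e} \<in> \<G>" if "e \<in> L" for e
    using WL that circuits_in_cycles_G2(1) by auto
  have parG: "{0, 1} \<in> \<G>" "{2, 3} \<in> \<G>"
    using WL circuits_in_cycles_G2(2,3) circuits_in_cycles_G4(1,2) by auto
  have parW: "{e, f} \<in> \<G>" if "e \<in> W" "f \<in> W" "e \<noteq> f" for e f
  proof -
    have "{e, f} = {4, 5} \<and> \<G> = cycles_G4" using WL that by auto
    thus ?thesis using circuits_in_cycles_G4(3) by simp
  qed
  have triG: "{e, f, g} \<in> \<G>" if "e \<in> {0, 1}" "f \<in> {2, 3}" "g \<in> W" for e f g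
  proof -
    have "e = 0 \<or> e = 1" "f = 2 \<or> f = 3" "\<G> = cycles_G2 \<and> g = 4 \<or> \<G> = cycles_G4 \<and> (g = 4 \<or> g = 5)"
      using that WL by auto
    thus ?thesis
      by (elim disjE conjE) (simp_all only: circuits_in_cycles_G2 circuits_in_cycles_G4)
  qed
  have "cycle_matroid (graph_of_ends xs) = cycle_space_matroid (medges (graph_of_ends xs)) \<G>"
  proof (rule cycle_matroid_eq_cycle_space_matroid)
    fix C assume "is_cycle_edge_set (graph_of_ends xs) C"
    from cycle_edge_set_cases[OF this, unfolded len] show "C \<in> \<G> \<and> C \<noteq> {}"
    proof (elim disjE exE conjE)
      fix e y assume h: "e < 6" "xs ! e = {y}" "C = {e}"
      thus ?thesis using loopG[of e] loop[OF h(1)] by auto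
    next
      fix e f p q
      assume h: "e < 6" "f < 6" "e \<noteq> f" "p \<noteq> q" "xs ! e = {p, q}" "xs ! f = {p, q}" "C = {e, f}"
      have "{p, q} = {vu, vv} \<or> {p, q} = {vu, vw} \<or> {p, q} = {vv, vw}"
        using h(4) by (cases p; cases q) auto
      thus ?thesis
      proof (elim disjE)
        assume "{p, q} = {vu, vv}"
        hence "{e, f} = {0, 1}" using uv[OF h(1)] uv[OF h(2)] h(3,5,6) by auto
        thus ?thesis using parG(1) h(7) by simp
      next
        assume "{p, q} = {vu, vw}"
        hence "{e, f} = {2, 3}" using uw[OF h(1)] uw[OF h(2)] h(3,5,6) by auto
        thus ?thesis using parG(2) h(7) by simp
      next
        assume "{p, q} = {vv, vw}"
        hence "e \<in> W" "f \<in> W" using vw[OF h(1)] vw[OF h(2)] h(5,6) by auto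
        thus ?thesis using parW[of e f] h(3,7) by simp
      qed
    next
      fix e f g
      assume h: "e < 6" "f < 6" "g < 6" "xs ! e = {vu, vv}" "xs ! f = {vu, vw}" "xs ! g = {vv, vw}" "C = {e, f, g}"
      thus ?thesis using triG[of e f g] uv[OF h(1)] uw[OF h(2)] vw[OF h(3)] by simp
    qed
  next
    fix Z assume Z: "Z \<in> \<G>" "Z \<noteq> {}"
    have par: "is_cycle_edge_set (graph_of_ends xs) {0, 1}" "is_cycle_edge_set (graph_of_ends xs) {2, 3}"
      using cycle_edge_set_parallel[of 0 xs 1 vu vv] cycle_edge_set_parallel[of 2 xs 3 vu vw]
        uv[of 0] uv[of 1] uw[of 2] uw[of 3] len by simp_all
    have "(\<exists>e\<in>L. e \<in> Z) \<or> 0 \<in> Z \<and> 1 \<in> Z \<or> 2 \<in> Z \<and> 3 \<in> Z \<or> (\<exists>e\<in>W. \<exists>f\<in>W. e \<noteq> f \<and> e \<in> Z \<and> f \<in> Z) \<or>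
        (\<exists>e\<in>{0, 1}. \<exists>f\<in>{2, 3}. \<exists>g\<in>W. e \<in> Z \<and> f \<in> Z \<and> g \<in> Z)"
      using WL
    proof
      assume G: "W = {4} \<and> L = {5} \<and> \<G> = cycles_G2"
      have "Z \<subseteq> {0, 1, 2, 3, 4, 5}" using Z(1) G less_6_cases unfolding cycles_G2_eq by blast
      moreover have "4 \<in> Z \<longleftrightarrow> ((0 \<in> Z) \<noteq> (1 \<in> Z))" "4 \<in> Z \<longleftrightarrow> ((2 \<in> Z) \<noteq> (3 \<in> Z))"
        using Z(1) G unfolding cycles_G2_eq by blast+
      ultimately show ?thesis using Z(2) G by (elim conjE) (simp only: bex_simps, blast)
    next
      assume G: "W = {4, 5} \<and> L = {} \<and> \<G> = cycles_G4"
      have "Z \<subseteq> {0, 1, 2, 3, 4, 5}" using Z(1) G less_6_cases unfolding cycles_G4_eq by blast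
      moreover have "((4 \<in> Z) \<noteq> (5 \<in> Z)) \<longleftrightarrow> ((0 \<in> Z) \<noteq> (1 \<in> Z))" "((4 \<in> Z) \<noteq> (5 \<in> Z)) \<longleftrightarrow> ((2 \<in> Z) \<noteq> (3 \<in> Z))"
        using Z(1) G unfolding cycles_G4_eq by blast+
      moreover have "(4::nat) \<noteq> 5" by simp
      ultimately show ?thesis using Z(2) G by (elim conjE) (simp only: bex_simps, blast)
    qed
    thus "\<exists>C\<subseteq>Z. is_cycle_edge_set (graph_of_ends xs) C"
    proof (elim disjE bexE conjE)
      fix e assume e: "e \<in> L" "e \<in> Z"
      then obtain y where "xs ! e = {y}" using loop W6 by blast
      thus ?thesis using cycle_edge_set_loop[of e xs y] e W6[of e] len by (intro exI[of _ "{e}"]) simp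
    next
      assume "0 \<in> Z" "1 \<in> Z"
      thus ?thesis using par(1) by (intro exI[of _ "{0, 1}"]) simp
    next
      assume "2 \<in> Z" "3 \<in> Z"
      thus ?thesis using par(2) by (intro exI[of _ "{2, 3}"]) simp
    next
      fix e f assume h: "e \<in> W" "f \<in> W" "e \<noteq> f" "e \<in> Z" "f \<in> Z"
      have "is_cycle_edge_set (graph_of_ends xs) {e, f}"
        using cycle_edge_set_parallel[of e xs f vv vw] h vw[of e] vw[of f] W6[of e] W6[of f] len by simp
      thus ?thesis using h(4,5) by (intro exI[of _ "{e, f}"]) simp
    next
      fix e f g assume h: "e \<in> {0, 1}" "f \<in> {2, 3}" "g \<in> W" "e \<in> Z" "f \<in> Z" "g \<in> Z"
      have l: "e < 6" "f < 6" "g < 6" using h(1,2) W6[of g] h(3) by auto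
      have "is_cycle_edge_set (graph_of_ends xs) {e, f, g}"
        using cycle_edge_set_triangle[of e xs f g] uv[OF l(1)] uw[OF l(2)] vw[OF l(3)] h(1-3) l len by simp
      thus ?thesis using h(4-6) by (intro exI[of _ "{e, f, g}"]) simp
    qed
  qed
  moreover have "medges (graph_of_ends xs) = {..<6}"
    unfolding graph_of_ends_def by (simp only: multigraph.select_convs len)
  ultimately show ?thesis by (simp only:)
qed

text \<open>
  The position of the loop does not influence the cycle matroid, which is why $G_2$ and $G_3$
  give the same minor.
\<close>
lemma cycle_matroid_doubled_triangle_loop:
  "cycle_matroid (graph_of_ends [{vu, vv}, {vu, vv}, {vu, vw}, {vu, vw}, {vv, vw}, {x}]) =
    cycle_space_matroid {..<6} cycles_G2"
proof (rule cycle_matroid_doubled_triangle[where W = "{4}" and L = "{5}"])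
  fix e :: nat assume e: "e < 6"
  let ?xs = "[{vu, vv}, {vu, vv}, {vu, vw}, {vu, vw}, {vv, vw}, {x}]"
  show "?xs ! e = {vu, vv} \<longleftrightarrow> e \<in> {0, 1}" "?xs ! e = {vu, vw} \<longleftrightarrow> e \<in> {2, 3}"
    "?xs ! e = {vv, vw} \<longleftrightarrow> e \<in> {4}" "(\<exists>y. ?xs ! e = {y}) \<longleftrightarrow> e \<in> {5}"
    using e unfolding less_6_cases by (elim disjE; auto simp: doubleton_eq_iff)+
qed simp_all

lemma cycle_matroid_G4: "cycle_matroid graph_G4 = cycle_space_matroid {..<6} cycles_G4"
  unfolding graph_G4_def
proof (rule cycle_matroid_doubled_triangle[where W = "{4, 5}" and L = "{}"])
  fix e :: nat assume e: "e < 6"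
  let ?xs = "[{vu, vv}, {vu, vv}, {vu, vw}, {vu, vw}, {vv, vw}, {vv, vw}]"
  show "?xs ! e = {vu, vv} \<longleftrightarrow> e \<in> {0, 1}" "?xs ! e = {vu, vw} \<longleftrightarrow> e \<in> {2, 3}"
    "?xs ! e = {vv, vw} \<longleftrightarrow> e \<in> {4, 5}" "(\<exists>y. ?xs ! e = {y}) \<longleftrightarrow> e \<in> {}"
    using e unfolding less_6_cases by (elim disjE; auto simp: doubleton_eq_iff)+
qed simp_all

section \<open>Matroid isomorphism in terms of cycle spaces\<close>

lemma cycle_space_pullback:
  assumes g: "bij_betw g D F" and F: "cycle_space F \<D>"
  shows "cycle_space D {I. I \<subseteq> D \<and> g ` I \<in> \<D>}"
proof -
  have inj: "inj_on g D" using g by (rule bij_betw_imp_inj_on)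
  have fin: "finite D" using bij_betw_finite[OF g] cycle_spaceD(1)[OF F] by simp
  have "g ` sym_diff I J \<in> \<D>" if "I \<subseteq> D" "g ` I \<in> \<D>" "J \<subseteq> D" "g ` J \<in> \<D>" for I J
  proof -
    have "I - J \<subseteq> D" "J - I \<subseteq> D" using that by blast+
    hence "g ` sym_diff I J = sym_diff (g ` I) (g ` J)"
      unfolding image_Un using inj_on_image_set_diff[OF inj] that(1,3) by simp
    thus ?thesis using cycle_spaceD(4)[OF F that(2,4)] by simp
  qed
  thus ?thesis unfolding cycle_space_def using fin cycle_spaceD(3)[OF F] by auto
qed

lemma cycle_free_pullback:
  assumes g: "bij_betw g D F" and F: "cycle_space F \<D>" and I: "I \<subseteq> D"
  shows "cycle_free {I. I \<subseteq> D \<and> g ` I \<in> \<D>} I \<longleftrightarrow> cycle_free \<D> (g ` I)"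
proof
  assume L: "cycle_free {I. I \<subseteq> D \<and> g ` I \<in> \<D>} I"
  show "cycle_free \<D> (g ` I)" unfolding cycle_free_def
  proof (intro ballI impI)
    fix Z assume Z: "Z \<in> \<D>" "Z \<subseteq> g ` I"
    then obtain J where J: "J \<subseteq> I" "Z = g ` J" by (meson subset_imageE)
    have "J = {}" using L J Z(1) I unfolding cycle_free_def by auto
    thus "Z = {}" using J(2) by simp
  qed
next
  assume R: "cycle_free \<D> (g ` I)"
  show "cycle_free {I. I \<subseteq> D \<and> g ` I \<in> \<D>} I" unfolding cycle_free_def
  proof (intro ballI impI)
    fix J assume "J \<in> {I. I \<subseteq> D \<and> g ` I \<in> \<D>}" "J \<subseteq> I"
    hence J: "g ` J \<in> \<D>" "g ` J \<subseteq> g ` I" by auto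
    from R[unfolded cycle_free_def, rule_format, OF J] show "J = {}" by simp
  qed
qed

text \<open>
  An isomorphism of matroids only matches independent sets; by \<open>cycle_space_eqI\<close> it also
  matches cycles.
\<close>
lemma has_minor_iso_cycle_space_iff:
  assumes C: "cycle_space E \<C>" and G: "cycle_space D \<G>"
  shows "has_minor_iso (cycle_space_matroid E \<C>) (cycle_space_matroid D \<G>) \<longleftrightarrow>
    (\<exists>Y g. Y \<subseteq> E \<and> inj_on g D \<and> g ` D \<subseteq> E - Y \<and>
      (\<forall>I\<subseteq>D. g ` I \<in> minor_cycles \<C> Y (g ` D) \<longleftrightarrow> I \<in> \<G>))"
proof
  assume "has_minor_iso (cycle_space_matroid E \<C>) (cycle_space_matroid D \<G>)"
  then obtain Y F f where Y: "Y \<subseteq> E" "F \<subseteq> E - Y" and f: "bij_betw f F D"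
    and iso: "\<forall>X\<subseteq>F. (X \<subseteq> F \<and> cycle_free (minor_cycles \<C> Y F) X) \<longleftrightarrow> (f ` X \<subseteq> D \<and> cycle_free \<G> (f ` X))"
    unfolding has_minor_iso_def is_minor_cycle_space_matroid_iff[OF C] matroid_iso_def
    by (auto simp: cycle_space_matroid_def)
  let ?\<D> = "minor_cycles \<C> Y F"
  have Ds: "cycle_space F ?\<D>" by (rule cycle_space_minor_cycles[OF C]) (use Y in blast)
  define g where "g = inv_into F f"
  have g: "bij_betw g D F" unfolding g_def using f by (rule bij_betw_inv_into)
  have fg: "f ` (g ` I) = I" if "I \<subseteq> D" for I
    unfolding g_def using f that by (simp add: bij_betw_imp_surj_on image_inv_into_cancel)
  have "{I. I \<subseteq> D \<and> g ` I \<in> ?\<D>} = \<G>"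
  proof (rule cycle_space_eqI[OF cycle_space_pullback[OF g Ds] G])
    fix I assume I: "I \<subseteq> D"
    have "g ` I \<subseteq> F" using g I unfolding bij_betw_def by blast
    hence "cycle_free ?\<D> (g ` I) \<longleftrightarrow> cycle_free \<G> I" using iso fg[OF I] I by auto
    thus "cycle_free {I. I \<subseteq> D \<and> g ` I \<in> ?\<D>} I \<longleftrightarrow> cycle_free \<G> I"
      using cycle_free_pullback[OF g Ds I] by simp
  qed
  moreover have "g ` D = F" "inj_on g D" using g unfolding bij_betw_def by auto
  ultimately show "\<exists>Y g. Y \<subseteq> E \<and> inj_on g D \<and> g ` D \<subseteq> E - Y \<and>
      (\<forall>I\<subseteq>D. g ` I \<in> minor_cycles \<C> Y (g ` D) \<longleftrightarrow> I \<in> \<G>)"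
    using Y by (intro exI[of _ Y] exI[of _ g]) auto
next
  assume "\<exists>Y g. Y \<subseteq> E \<and> inj_on g D \<and> g ` D \<subseteq> E - Y \<and>
      (\<forall>I\<subseteq>D. g ` I \<in> minor_cycles \<C> Y (g ` D) \<longleftrightarrow> I \<in> \<G>)"
  then obtain Y g where Y: "Y \<subseteq> E" "inj_on g D" "g ` D \<subseteq> E - Y"
    and iff: "\<forall>I\<subseteq>D. g ` I \<in> minor_cycles \<C> Y (g ` D) \<longleftrightarrow> I \<in> \<G>" by (elim exE conjE)
  let ?F = "g ` D" and ?\<D> = "minor_cycles \<C> Y (g ` D)"
  have g: "bij_betw g D ?F" using Y(2) by (simp add: bij_betw_def)
  have Ds: "cycle_space ?F ?\<D>" by (rule cycle_space_minor_cycles[OF C]) (use Y in blast)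
  have eq: "{I. I \<subseteq> D \<and> g ` I \<in> ?\<D>} = \<G>" using iff cycle_spaceD(2)[OF G] by blast
  define f where "f = inv_into D g"
  have f: "bij_betw f ?F D" unfolding f_def using g by (rule bij_betw_inv_into)
  have "matroid_iso (cycle_space_matroid ?F ?\<D>) (cycle_space_matroid D \<G>)"
    unfolding matroid_iso_def
  proof (intro exI[of _ f] conjI allI impI)
    show "bij_betw f (ground (cycle_space_matroid ?F ?\<D>)) (ground (cycle_space_matroid D \<G>))"
      using f by (simp add: cycle_space_matroid_def)
    fix X assume "X \<subseteq> ground (cycle_space_matroid ?F ?\<D>)"
    hence X: "X \<subseteq> ?F" by (simp add: cycle_space_matroid_def)
    have fX: "f ` X \<subseteq> D" using f X unfolding bij_betw_def by blast
    have "g ` (f ` X) = X" unfolding f_def using X by (simp add: image_inv_into_cancel)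
    hence "cycle_free \<G> (f ` X) \<longleftrightarrow> cycle_free ?\<D> X"
      using cycle_free_pullback[OF g Ds fX] unfolding eq by simp
    thus "X \<in> indeps (cycle_space_matroid ?F ?\<D>) \<longleftrightarrow> f ` X \<in> indeps (cycle_space_matroid D \<G>)"
      using X fX by (simp add: cycle_space_matroid_def)
  qed
  thus "has_minor_iso (cycle_space_matroid E \<C>) (cycle_space_matroid D \<G>)"
    unfolding has_minor_iso_def is_minor_cycle_space_matroid_iff[OF C] using Y by blast
qed

lemma lessThan_6: "{..<6::nat} = {0, 1, 2, 3, 4, 5}" by auto

lemma nth_six:
  "[p0, p1, p2, p3, p4, p5] ! 0 = p0" "[p0, p1, p2, p3, p4, p5] ! 1 = p1" "[p0, p1, p2, p3, p4, p5] ! 2 = p2"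
  "[p0, p1, p2, p3, p4, p5] ! 3 = p3" "[p0, p1, p2, p3, p4, p5] ! 4 = p4" "[p0, p1, p2, p3, p4, p5] ! 5 = p5"
  by simp_all

lemma inj_on_six:
  "inj_on g {..<6::nat} \<longleftrightarrow> distinct [g 0, g 1, g 2, g 3, g 4, g 5]"
  unfolding lessThan_6 by (auto simp: inj_on_def)

lemma image_six: "g ` {..<6::nat} = {g 0, g 1, g 2, g 3, g 4, g 5}"
  unfolding lessThan_6 by simp

lemma matches_labelling:
  fixes g :: "nat \<Rightarrow> 'a"
  assumes inj: "inj_on g {..<6}"
  shows "(\<forall>I\<subseteq>{..<6}. g ` I \<in> \<D> \<longleftrightarrow> I \<in> pattern_cycles P) \<longleftrightarrow> matches P \<D> (g 0) (g 1) (g 2) (g 3) (g 4) (g 5)"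
proof -
  let ?Q = "\<lambda>Z. P (g 0 \<in> Z) (g 1 \<in> Z) (g 2 \<in> Z) (g 3 \<in> Z) (g 4 \<in> Z) (g 5 \<in> Z)"
  have mem: "g i \<in> g ` I \<longleftrightarrow> i \<in> I" if "I \<subseteq> {..<6}" "i \<in> {..<6}" for I i
    using inj_on_image_mem_iff[OF inj that(2,1)] .
  have PZ: "I \<in> pattern_cycles P \<longleftrightarrow> ?Q (g ` I)" if I: "I \<subseteq> {..<6}" for I
    unfolding pattern_cycles_def using I by (simp add: mem[OF I])
  have "(\<forall>I\<subseteq>{..<6}. g ` I \<in> \<D> \<longleftrightarrow> I \<in> pattern_cycles P) \<longleftrightarrow>
      (\<forall>Z\<subseteq>{g 0, g 1, g 2, g 3, g 4, g 5}. Z \<in> \<D> \<longleftrightarrow> ?Q Z)"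
  proof (rule iffI; intro allI impI)
    fix Z assume L: "\<forall>I\<subseteq>{..<6}. g ` I \<in> \<D> \<longleftrightarrow> I \<in> pattern_cycles P" and Z: "Z \<subseteq> {g 0, g 1, g 2, g 3, g 4, g 5}"
    obtain I where I: "I \<subseteq> {..<6}" "Z = g ` I" using subset_imageE[OF Z[folded image_six]] by metis
    show "Z \<in> \<D> \<longleftrightarrow> ?Q Z" unfolding I(2) PZ[OF I(1), symmetric] using L I(1) by blast
  next
    fix I :: "nat set"
    assume R: "\<forall>Z\<subseteq>{g 0, g 1, g 2, g 3, g 4, g 5}. Z \<in> \<D> \<longleftrightarrow> ?Q Z" and I: "I \<subseteq> {..<6}"
    have "g ` I \<subseteq> {g 0, g 1, g 2, g 3, g 4, g 5}" unfolding image_six[symmetric] using I by (rule image_mono)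
    thus "g ` I \<in> \<D> \<longleftrightarrow> I \<in> pattern_cycles P" unfolding PZ[OF I] using R by blast
  qed
  thus ?thesis using inj unfolding matches_def inj_on_six by blast
qed

lemma has_minor_iso_pattern_iff:
  assumes C: "cycle_space E \<C>" and P: "cycle_space {..<6} (pattern_cycles P)"
  shows "has_minor_iso (cycle_space_matroid E \<C>) (cycle_space_matroid {..<6} (pattern_cycles P)) \<longleftrightarrow>
    pattern_minor P E \<C>"
  unfolding has_minor_iso_cycle_space_iff[OF C P]
proof
  assume "\<exists>Y g. Y \<subseteq> E \<and> inj_on g {..<6} \<and> g ` {..<6} \<subseteq> E - Y \<and>
      (\<forall>I\<subseteq>{..<6}. g ` I \<in> minor_cycles \<C> Y (g ` {..<6}) \<longleftrightarrow> I \<in> pattern_cycles P)"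
  then obtain Y g where Y: "Y \<subseteq> E" "inj_on g {..<6}" "g ` {..<6} \<subseteq> E - Y"
    "\<forall>I\<subseteq>{..<6}. g ` I \<in> minor_cycles \<C> Y (g ` {..<6}) \<longleftrightarrow> I \<in> pattern_cycles P" by (elim exE conjE)
  from Y(4)[unfolded matches_labelling[OF Y(2)]] Y(1,3) show "pattern_minor P E \<C>"
    unfolding pattern_minor_def image_six
    by (intro exI[of _ Y] exI[of _ "g 0"] exI[of _ "g 1"] exI[of _ "g 2"] exI[of _ "g 3"] exI[of _ "g 4"] exI[of _ "g 5"] conjI)
next
  assume "pattern_minor P E \<C>"
  then obtain Y a b c x y z where Y: "Y \<subseteq> E" "{a, b, c, x, y, z} \<subseteq> E - Y"
    and G: "matches P (minor_cycles \<C> Y {a, b, c, x, y, z}) a b c x y z"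
    unfolding pattern_minor_def by (elim exE conjE)
  define g where "g i = [a, b, c, x, y, z] ! i" for i
  have g: "g 0 = a" "g 1 = b" "g 2 = c" "g 3 = x" "g 4 = y" "g 5 = z" unfolding g_def nth_six by simp_all
  have inj: "inj_on g {..<6}" unfolding inj_on_six g using G unfolding matches_def by blast
  have "\<forall>I\<subseteq>{..<6}. g ` I \<in> minor_cycles \<C> Y (g ` {..<6}) \<longleftrightarrow> I \<in> pattern_cycles P"
    unfolding matches_labelling[OF inj] image_six g by (rule G)
  thus "\<exists>Y g. Y \<subseteq> E \<and> inj_on g {..<6} \<and> g ` {..<6} \<subseteq> E - Y \<and>
      (\<forall>I\<subseteq>{..<6}. g ` I \<in> minor_cycles \<C> Y (g ` {..<6}) \<longleftrightarrow> I \<in> pattern_cycles P)"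
    using Y inj by (intro exI[of _ Y] exI[of _ g] conjI) (simp_all only: image_six g)
qed

section \<open>The forbidden minors\<close>

theorem theorem1p5:
  fixes M :: "'a matroid"
  assumes "binary_gammoid M"
  shows "M \<notin> class_G3 \<longleftrightarrow>
         \<not> (\<exists>G\<in>{graph_G2, graph_G3, graph_G4}. has_minor_iso M (cycle_matroid G))"
proof -
  have "binary M" using assms unfolding binary_gammoid_def by simp
  then obtain \<C> where C: "cycle_space (ground M) \<C>" and M: "M = cycle_space_matroid (ground M) \<C>"
    and split: "\<And>H. splitting M H = cycle_space_matroid (ground M) (split_cycles \<C> H)"
    and bin: "\<And>H. binary (splitting M H)"
    by (rule binary_cycle_space) (rule that)
  let ?E = "ground M"
  have no: "\<not> K4_minor ?E \<C>"
    using binary_gammoid_iff_no_K4_minor[OF C] M assms \<open>binary M\<close> by simp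
  have gam: "binary_gammoid (splitting M H) \<longleftrightarrow> \<not> K4_minor ?E (split_cycles \<C> H)" for H
    unfolding split by (rule binary_gammoid_iff_no_K4_minor[OF cycle_space_split_cycles[OF C] bin[unfolded split]])
  have "M \<in> class_G3 \<longleftrightarrow> (\<exists>H\<subseteq>?E. card H = 3 \<and> K4_minor ?E (split_cycles \<C> H))"
    unfolding class_G3_def mem_Collect_eq gam using assms by simp
  also have "\<dots> \<longleftrightarrow> G2_minor ?E \<C> \<or> G4_minor ?E \<C>"
    using G2_G4_minor_of_splitting[OF C no] splitting_of_G2_G4_minor[of ?E \<C>] by blast
  also have "\<dots> \<longleftrightarrow> (\<exists>G\<in>{graph_G2, graph_G3, graph_G4}. has_minor_iso M (cycle_matroid G))"
  proof -
    have "cycle_matroid graph_G2 = cycle_space_matroid {..<6} cycles_G2"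
      "cycle_matroid graph_G3 = cycle_space_matroid {..<6} cycles_G2"
      unfolding graph_G2_def graph_G3_def by (rule cycle_matroid_doubled_triangle_loop)+
    hence "has_minor_iso M (cycle_matroid graph_G2) \<longleftrightarrow> G2_minor ?E \<C>"
      "has_minor_iso M (cycle_matroid graph_G3) \<longleftrightarrow> G2_minor ?E \<C>"
      "has_minor_iso M (cycle_matroid graph_G4) \<longleftrightarrow> G4_minor ?E \<C>"
      using has_minor_iso_pattern_iff[OF C cycle_space_cycles_G2, folded M]
        has_minor_iso_pattern_iff[OF C cycle_space_cycles_G4, folded M] cycle_matroid_G4 by simp_all
    thus ?thesis by blast
  qed
  finally show ?thesis by blast
qed

end
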